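(* Let $(\Omega,\nu)$ be as in the context, with isoperimetric function $I_{\Omega,\nu}$. Let $I:[0,1]\to[0,\infty)$ be a non-decreasing function with $\inf_{t\in(0,1)}\frac{I(t)}{t}>0$, and assume that there is a constant $c>0$ such that $I_{\Omega,\nu}(s)\ge c\,I(cs)$ for every $s\in[0,\tfrac12]$. Let $\|\cdot\|_{X(0,1)}$ be a rearrangement-invariant function norm, and let $k,h\in\mathbb N$. Then $$(X_{k,I})_{h,I}(\Omega,\nu)=X_{k+h,I}(\Omega,\nu),$$ up to equivalent norms.
   Context: Setting: $\Omega\subset\mathbb R^n$, $n\ge1$, is a domain (open connected set) equipped with a measure $d\nu(x)=\omega(x)\,dx$, where $\omega$ is a Borel function with $\omega>0$ a.e. in $\Omega$, and $\nu(\Omega)=1$. Rearrangement-invariant (r.i.) spaces. $\mathcal M_+(0,1)$ is the set of measurable functions $(0,1)\to[0,\infty]$. For a measurable $u:\Omega\to[-\infty,\infty]$, $u^*(s)=\sup\{t\in\mathbb R:\nu(\{x\in\Omega:|u(x)|>t\})>s\}$ for $s\in(0,1)$ (similarly on $(0,1)$ with Lebesgue measure). An r.i. function norm is a functional $\|\cdot\|_{X(0,1)}:\mathcal M_+(0,1)\to[0,\infty]$ such that for all $f,g,f_j\in\mathcal M_+(0,1)$ and $\lambda\ge0$: (P1) $\|f\|=0$ iff $f=0$ a.e., $\|\lambda f\|=\lambda\|f\|$, $\|f+g\|\le\|f\|+\|g\|$; (P2) $f\le g$ a.e. implies $\|f\|\le\|g\|$; (P3) $f_j\nearrow f$ a.e.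 implies $\|f_j\|\nearrow\|f\|$; (P4) $\|1\|<\infty$; (P5) $\int_0^1f\,dx\le C\|f\|$ with $C$ independent of $f$; (P6) $\|f\|=\|g\|$ whenever $f^*=g^*$. The associate norm is $\|g\|_{X'(0,1)}=\sup\{\int_0^1fg\,ds:f\ge0,\ \|f\|_{X(0,1)}\le1\}$, again an r.i. function norm, and $X''=X$. The space $X(\Omega,\nu)$ consists of all measurable $u$ on $\Omega$ with $\|u\|_{X(\Omega,\nu)}:=\|u^*\|_{X(0,1)}<\infty$. Isoperimetric function. For measurable $E\subset\Omega$, $P_\nu(E,\Omega)=\int_{\Omega\cap\partial^ME}\omega\,d\mathcal H^{n-1}$, where $\partial^ME$ is the essential boundary of $E$. For $s\in[0,\frac12]$, $I_{\Omega,\nu}(s)=\inf\{P_\nu(E,\Omega):E\subset\Omega,\ s\le\nu(E)\le\frac12\}$, and $I_{\Omega,\nu}(s)=I_{\Omega,\nu}(1-s)$ for $s\in(\frac12,1]$. The spaces $X_{m,I}$. For an r.i. function norm $\|\cdot\|_{X(0,1)}$ and $m\in\mathbb N$, $\|\cdot\|_{X_{m,I}(0,1)}$ is the r.i. function norm whose associate norm is $$\|f\|_{X'_{m,I}(0,1)}=\left\|\frac1{I(t)}\int_0^t\left(\int_s^t\frac{dr}{I(r)}\right)^{m-1}f^*(s)\,ds\right\|_{X'(0,1)},\qquad f\in\mathcal M_+(0,1)$$ (this functional is indeed an r.i. function norm under the assumptions on $I$). The space $(X_{k,I})_{h,I}$ is obtained by applying this construction with $m=h$ to the norm $\|\cdot\|_{X_{k,I}(0,1)}$.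 *)

theory Defs
  imports "HOL-Analysis.Analysis"
begin

section \<open>Rearrangement-invariant function norms\<close>

abbreviation unit_leb :: "real measure" where
  "unit_leb \<equiv> lebesgue_on {0<..<1}"

text \<open>A function norm acts on \<open>real \<Rightarrow> ennreal\<close>, but only its values on \<open>Mplus\<close> carry
  meaning. The functions in \<open>Mplus\<close> are measurable on (0,1) and arbitrary elsewhere; axiom (P2)
  makes the norm blind to what happens outside (0,1).\<close>

definition Mplus :: "(real \<Rightarrow> ennreal) set" where
  "Mplus = borel_measurable unit_leb"

text \<open>For a probability measure the set of admissible \<open>t\<close> contains all negative reals, so the
  supremum is nonnegative and the conversion to \<open>ennreal\<close> loses nothing.\<close>

definition rearr :: "'a measure \<Rightarrow> ('a \<Rightarrow> ereal) \<Rightarrow> real \<Rightarrow> ennreal" where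
  "rearr M u s = e2ennreal (Sup {ereal t | t :: real.
     emeasure M {x \<in> space M. \<bar>u x\<bar> > ereal t} > ennreal s})"

abbreviation rearr01 :: "(real \<Rightarrow> ennreal) \<Rightarrow> real \<Rightarrow> ennreal" where
  "rearr01 f \<equiv> rearr unit_leb (\<lambda>x. enn2ereal (f x))"

definition ri_norm :: "((real \<Rightarrow> ennreal) \<Rightarrow> ennreal) \<Rightarrow> bool" where
  "ri_norm X \<longleftrightarrow>
     \<comment> \<open>(P1)\<close>
     (\<forall>f\<in>Mplus. X f = 0 \<longleftrightarrow> (AE x in unit_leb. f x = 0)) \<and>
     (\<forall>f\<in>Mplus. \<forall>a\<ge>0::real. X (\<lambda>x. ennreal a * f x) = ennreal a * X f) \<and>
     (\<forall>f\<in>Mplus. \<forall>g\<in>Mplus. X (\<lambda>x. f x + g x) \<le> X f + X g) \<and>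
     \<comment> \<open>(P2)\<close>
     (\<forall>f\<in>Mplus. \<forall>g\<in>Mplus. (AE x in unit_leb. f x \<le> g x) \<longrightarrow> X f \<le> X g) \<and>
     \<comment> \<open>(P3)\<close>
     (\<forall>F f. (\<forall>j::nat. F j \<in> Mplus) \<longrightarrow> f \<in> Mplus \<longrightarrow>
        (AE x in unit_leb. incseq (\<lambda>j. F j x) \<and> (SUP j. F j x) = f x) \<longrightarrow>
        incseq (\<lambda>j. X (F j)) \<and> (SUP j. X (F j)) = X f) \<and>
     \<comment> \<open>(P4)\<close>
     X (\<lambda>_. 1) < \<infinity> \<and>
     \<comment> \<open>(P5)\<close>
     (\<exists>C::real. \<forall>f\<in>Mplus. (\<integral>\<^sup>+x. f x \<partial>unit_leb) \<le> ennreal C * X f) \<and>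
     \<comment> \<open>(P6)\<close>
     (\<forall>f\<in>Mplus. \<forall>g\<in>Mplus.
        (\<forall>s\<in>{0<..<1}. rearr01 f s = rearr01 g s) \<longrightarrow> X f = X g)"

definition associate_norm ::
    "((real \<Rightarrow> ennreal) \<Rightarrow> ennreal) \<Rightarrow> (real \<Rightarrow> ennreal) \<Rightarrow> ennreal" where
  "associate_norm X g = (SUP f\<in>{f \<in> Mplus. X f \<le> 1}. \<integral>\<^sup>+s. f s * g s \<partial>unit_leb)"

definition ri_space_norm ::
    "'a measure \<Rightarrow> ((real \<Rightarrow> ennreal) \<Rightarrow> ennreal) \<Rightarrow> ('a \<Rightarrow> ereal) \<Rightarrow> ennreal" where
  "ri_space_norm M X u = X (rearr M u)"

definition ri_space ::
    "'a measure \<Rightarrow> ((real \<Rightarrow> ennreal) \<Rightarrow> ennreal) \<Rightarrow> ('a \<Rightarrow> ereal) set" where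
  "ri_space M X = {u \<in> borel_measurable M. ri_space_norm M X u < \<infinity>}"

definition equal_up_to_equivalent_norms ::
    "'a measure \<Rightarrow> ((real \<Rightarrow> ennreal) \<Rightarrow> ennreal) \<Rightarrow> ((real \<Rightarrow> ennreal) \<Rightarrow> ennreal) \<Rightarrow> bool" where
  "equal_up_to_equivalent_norms M X Y \<longleftrightarrow>
     ri_space M X = ri_space M Y \<and>
     (\<exists>C1>0::real. \<exists>C2>0::real. \<forall>u\<in>ri_space M X.
        ennreal C1 * ri_space_norm M Y u \<le> ri_space_norm M X u \<and>
        ri_space_norm M X u \<le> ennreal C2 * ri_space_norm M Y u)"

section \<open>The spaces \<open>X\<^sub>m\<^sub>,\<^sub>I\<close>\<close>

text \<open>The functional prescribed as the associate norm of \<open>X\<^sub>m\<^sub>,\<^sub>I\<close>, for \<open>m \<ge> 1\<close>.\<close>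

definition assoc_XmI ::
    "((real \<Rightarrow> ennreal) \<Rightarrow> ennreal) \<Rightarrow> nat \<Rightarrow> (real \<Rightarrow> real) \<Rightarrow> (real \<Rightarrow> ennreal) \<Rightarrow> ennreal" where
  "assoc_XmI X m I f = associate_norm X
     (\<lambda>t. ennreal (1 / I t) *
        (\<integral>\<^sup>+s\<in>{0<..<t}. ((\<integral>\<^sup>+r\<in>{s<..<t}. ennreal (1 / I r) \<partial>lebesgue) ^ (m - 1) * rearr01 f s)
           \<partial>lebesgue))"

text \<open>The r.i. function norm whose associate norm is \<open>assoc_XmI X m I\<close>. Because \<open>Y'' = Y\<close> for
  r.i. function norms, it is unique on \<open>Mplus\<close>; the choice operator only fixes the irrelevant
  values outside \<open>Mplus\<close>, for which a definite description would not be unique.\<close>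

definition XmI ::
    "((real \<Rightarrow> ennreal) \<Rightarrow> ennreal) \<Rightarrow> nat \<Rightarrow> (real \<Rightarrow> real) \<Rightarrow> (real \<Rightarrow> ennreal) \<Rightarrow> ennreal" where
  "XmI X m I = (SOME Y. ri_norm Y \<and> (\<forall>f\<in>Mplus. associate_norm Y f = assoc_XmI X m I f))"

section \<open>Weighted perimeter and isoperimetric function\<close>

text \<open>Hausdorff measure of integer dimension \<open>d\<close>, normalised to agree with Lebesgue measure on
  \<open>d\<close>-dimensional Euclidean space. For \<open>d = 0\<close> a nonempty set contributes 1 (by \<open>0 ^ 0 = 1\<close>) and
  the empty set 0, so this is counting measure. Covering sets are required to be bounded because
  \<open>diameter\<close> is unspecified on unbounded sets.\<close>

definition hausdorff_pre :: "nat \<Rightarrow> real \<Rightarrow> 'a::euclidean_space set \<Rightarrow> ennreal" where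
  "hausdorff_pre d \<delta> A =
     (INF C\<in>{C :: nat \<Rightarrow> 'a set. A \<subseteq> (\<Union>i. C i) \<and> (\<forall>i. bounded (C i) \<and> diameter (C i) \<le> \<delta>)}.
        \<Sum>i. if C i = {} then 0 else ennreal (unit_ball_vol (real d) * (diameter (C i) / 2) ^ d))"

definition hausdorff_outer :: "nat \<Rightarrow> 'a::euclidean_space set \<Rightarrow> ennreal" where
  "hausdorff_outer d A = (SUP \<delta>\<in>{0<..}. hausdorff_pre d \<delta> A)"

text \<open>A metric outer measure is countably additive on the Borel sets, so \<open>measure_of\<close>
  does not fall back to the zero measure here.\<close>

definition hausdorff_measure :: "nat \<Rightarrow> 'a::euclidean_space measure" where
  "hausdorff_measure d = measure_of UNIV (sets borel) (hausdorff_outer d)"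

text \<open>The points at which \<open>E\<close> has neither density 0 nor density 1.\<close>

definition essential_boundary :: "'a::euclidean_space set \<Rightarrow> 'a set" where
  "essential_boundary E = {x.
     \<not> ((\<lambda>r. measure lebesgue (E \<inter> ball x r) / measure lebesgue (ball x r)) \<longlongrightarrow> 0) (at_right 0) \<and>
     \<not> ((\<lambda>r. measure lebesgue (E \<inter> ball x r) / measure lebesgue (ball x r)) \<longlongrightarrow> 1) (at_right 0)}"

text \<open>The weight is real-valued and only a.e. positive; \<open>ennreal (\<omega> x)\<close> is its positive part, which
  leaves the measure unchanged and agrees with \<open>\<omega>\<close> in the perimeter wherever \<open>\<omega> \<ge> 0\<close>.\<close>

definition weighted_measure ::
    "(real ^ 'n) set \<Rightarrow> (real ^ 'n \<Rightarrow> real) \<Rightarrow> (real ^ 'n) measure" where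
  "weighted_measure \<Omega> \<omega> = density (lebesgue_on \<Omega>) (\<lambda>x. ennreal (\<omega> x))"

definition weighted_perimeter ::
    "(real ^ 'n) set \<Rightarrow> (real ^ 'n \<Rightarrow> real) \<Rightarrow> (real ^ 'n) set \<Rightarrow> ennreal" where
  "weighted_perimeter \<Omega> \<omega> E =
     (\<integral>\<^sup>+x\<in>\<Omega> \<inter> essential_boundary E. ennreal (\<omega> x) \<partial>hausdorff_measure (CARD('n) - 1))"

definition isoperimetric ::
    "(real ^ 'n) set \<Rightarrow> (real ^ 'n \<Rightarrow> real) \<Rightarrow> real \<Rightarrow> ennreal" where
  "isoperimetric \<Omega> \<omega> s =
     (let s' = (if s \<le> 1/2 then s else 1 - s) in
      INF E\<in>{E \<in> sets (weighted_measure \<Omega> \<omega>).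
               ennreal s' \<le> emeasure (weighted_measure \<Omega> \<omega>) E \<and>
               emeasure (weighted_measure \<Omega> \<omega>) E \<le> ennreal (1/2)}.
        weighted_perimeter \<Omega> \<omega> E)"

end

theory Submission
  imports Defs
begin

text \<open>Put \<open>R u(t) = (1 / I(t)) \<integral>\<^sub>0\<^sup>t u\<close>. Up to constants the associate norm of \<open>X\<^sub>m\<^sub>,\<^sub>I\<close> is
  \<open>f \<mapsto> \<parallel>R\<^sup>m f\<^sup>*\<parallel>\<close>, the norm being that of \<open>X'\<close>. A Banach function norm is determined by its
  associate norm (Lorentz--Luxemburg), so the claim reduces to comparing \<open>\<parallel>R\<^sup>k ((R\<^sup>h f\<^sup>*)\<^sup>*)\<parallel>\<close>
  with \<open>\<parallel>R\<^sup>k\<^sup>+\<^sup>h f\<^sup>*\<parallel>\<close>. One inequality is Hardy--Littlewood. For the other, induction on \<open>k\<close>, applied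
  to the norm \<open>X\<^sub>1\<^sub>,\<^sub>I\<close>, reduces to \<open>k = 1\<close>. The functions \<open>f\<^sub>j = R\<^sup>j f\<^sup>*\<close> need not decrease, but
  \<open>f\<^sub>j(b) \<le> 2\<^sup>j f\<^sub>j(t)\<close> for \<open>b/2 \<le> t \<le> b\<close>. Hence the decreasing majorant \<open>G\<^sub>j\<close> of \<open>f\<^sub>j\<close> has a norm
  comparable to that of \<open>f\<^sub>j\<close>, and the pointwise bound \<open>R(f\<^sub>h\<^sup>*) \<le> C G\<^sub>h\<^sub>+\<^sub>1\<close> finishes the proof; it
  rests on \<open>(t / I(t)) G\<^sub>h(t) \<le> C G\<^sub>h\<^sub>+\<^sub>1(t)\<close>, proved by induction on \<open>h\<close>.\<close>

section \<open>Distribution functions and rearrangements on the unit interval\<close>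

text \<open>\<open>X\<^sub>m\<^sub>,\<^sub>I\<close> is given only through its associate norm, so
  its existence has to be proved before anything is compared. The obstacle is the nonlinear map from
  \<open>f\<close> to its rearrangement: the triangle inequality, and the fact that the prescribed
  functional is its own second associate, require integrals of the rearrangement against a
  decreasing weight to become linear functionals of \<open>f\<close>. Ryff's measure-preserving map
  does this by transporting the weight. The Lorentz--Luxemburg theorem serves the way back from
  associate norms to norms.

  The iterates of \<open>R\<close> may fail to decrease because \<open>1 / I\<close> decreases while
  the integral grows, and their rearrangement has no convenient formula; hence the majorant. The
  induction that bounds it picks a point where a supremum is nearly attained, so the supremum must
  be finite. The estimates are therefore proved for bounded \<open>f\<close>, with constants
  independent of the bound, and (P3) removes it. The constants must not depend on the norm either,
  since the induction on \<open>k\<close> changes the norm.\<close>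

lemma sets_unit_leb: "A \<in> sets unit_leb \<longleftrightarrow> A \<subseteq> {0<..<1} \<and> A \<in> sets lebesgue"
  by (auto simp: sets_restrict_space_iff)

lemma space_unit_leb [simp]: "space unit_leb = {0<..<1}"
  by (simp add: space_restrict_space)

lemma emeasure_unit_leb: "A \<subseteq> {0<..<1} \<Longrightarrow> emeasure unit_leb A = emeasure lebesgue A"
  by (rule emeasure_restrict_space) auto

lemma emeasure_unit_leb_space [simp]: "emeasure unit_leb {0<..<1} = 1"
  by (simp add: emeasure_unit_leb)

interpretation unit_leb: finite_measure unit_leb
  by standard simp

lemma unit_leb_ident [measurable]: "(\<lambda>x. x) \<in> borel_measurable unit_leb"
  using id_borel_measurable_lebesgue_on by (simp add: id_def)

text \<open>Covers open, half-open and closed intervals at once: \<open>A\<close> differs from the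
  open interval by some of the two endpoints, a null set.\<close>

lemma emeasure_unit_leb_interval:
  assumes "0 \<le> a" "a \<le> b" "b \<le> 1" "{a<..<b} \<subseteq> A" "A \<subseteq> {a..b}" "A \<subseteq> {0<..<1}"
  shows "A \<in> sets unit_leb" "emeasure unit_leb A = ennreal (b - a)"
proof -
  have A: "A = {a<..<b} \<union> (A \<inter> {a,b})" using assms(4,5) by fastforce
  have "A \<inter> {a,b} \<in> null_sets lebesgue"
    by (intro null_sets_completionI finite_imp_null_set_lborel) auto
  then have "emeasure lebesgue A = emeasure lebesgue {a<..<b}"
    by (subst A, subst emeasure_Un_null_set) auto
  also have "\<dots> = ennreal (b - a)" using assms(2) by simp
  finally have E: "emeasure lebesgue A = ennreal (b - a)" .
  have "A \<in> sets lebesgue"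
    by (subst A) (use \<open>A \<inter> {a,b} \<in> null_sets lebesgue\<close> in auto)
  then show "A \<in> sets unit_leb" using assms(6) by (simp add: sets_unit_leb)
  show "emeasure unit_leb A = ennreal (b - a)"
    using assms(6) E by (simp add: emeasure_unit_leb)
qed

section \<open>Distribution functions and their link with the rearrangement\<close>

lemma Mplus_iff: "f \<in> Mplus \<longleftrightarrow> f \<in> borel_measurable unit_leb"
  by (simp add: Mplus_def)

text \<open>The distribution function of \<open>f\<close>. Levels are extended reals so that values
  of functions can serve as levels without a finiteness case distinction.\<close>

definition dfun :: "(real \<Rightarrow> ennreal) \<Rightarrow> ennreal \<Rightarrow> ennreal" where
  "dfun f l = emeasure unit_leb {x \<in> {0<..<1}. l < f x}"

lemma Mplus_sets:
  assumes "f \<in> Mplus"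
  shows "{x \<in> {0<..<1}. l < f x} \<in> sets unit_leb"
proof -
  have [measurable]: "f \<in> borel_measurable unit_leb" using assms by (simp add: Mplus_def)
  have "{x \<in> space unit_leb. l < f x} \<in> sets unit_leb" by measurable
  then show ?thesis by simp
qed

lemma Mplus_sets' [simp]: "f \<in> Mplus \<Longrightarrow> {x. 0 < x \<and> x < 1 \<and> l < f x} \<in> sets unit_leb"
  using Mplus_sets[of f l] by simp

lemma dfun_le_1: "dfun f l \<le> 1"
proof -
  have "dfun f l \<le> emeasure unit_leb (space unit_leb)"
    unfolding dfun_def by (rule emeasure_space)
  then show ?thesis by simp
qed

lemma dfun_not_top [simp]: "dfun f l \<noteq> top" "dfun f l < top"
  using dfun_le_1[of f l] by (auto simp: less_top[symmetric] top_unique)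

lemma dfun_top [simp]: "dfun f top = 0"
  by (simp add: dfun_def)

lemma dfun_mono_AE:
  assumes "g \<in> Mplus" "AE x in unit_leb. f x \<le> g x"
  shows "dfun f l \<le> dfun g l"
  unfolding dfun_def
  by (rule emeasure_mono_AE) (use assms in \<open>auto elim!: eventually_mono intro: less_le_trans\<close>)

lemma dfun_SUP:
  assumes "\<And>j. F j \<in> Mplus" "f \<in> Mplus"
    and "AE x in unit_leb. incseq (\<lambda>j::nat. F j x) \<and> (SUP j. F j x) = f x"
  shows "dfun f l = (SUP j. dfun (F j) l)"
proof -
  let ?A = "\<lambda>j. {x \<in> {0<..<1}. l < F j x}"
  have [measurable]: "\<And>j. ?A j \<in> sets unit_leb" using assms(1) by auto
  have "dfun f l = emeasure unit_leb (\<Union>j. ?A j)"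
    unfolding dfun_def
  proof (rule emeasure_eq_AE)
    show "AE x in unit_leb. (x \<in> {x \<in> {0<..<1}. l < f x}) = (x \<in> (\<Union>j. ?A j))"
      using assms(3) by eventually_elim (auto simp flip: less_SUP_iff[where A=UNIV, simplified])
  qed (use assms in auto)
  also have "\<dots> \<le> (SUP j. dfun (F j) l)"
  proof -
    \<comment> \<open>The sets \<open>?A j\<close> increase only up to null sets, so continuity from
      below is applied to their partial unions.\<close>
    have "emeasure unit_leb (\<Union>j. ?A j) = emeasure unit_leb (\<Union>j. \<Union>i\<le>j. ?A i)"
      by (rule arg_cong[where f="emeasure unit_leb"]) auto
    also have "\<dots> = (SUP j. emeasure unit_leb (\<Union>i\<le>j. ?A i))"
      by (rule SUP_emeasure_incseq[symmetric])
        (auto simp: incseq_def assms intro: order_trans sets.finite_UN)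
    also have "\<dots> \<le> (SUP j. dfun (F j) l)"
    proof (rule SUP_mono)
      fix j :: nat
      have "emeasure unit_leb (\<Union>i\<le>j. ?A i) \<le> emeasure unit_leb (?A j)"
        by (rule emeasure_mono_AE, use assms(3) in eventually_elim)
          (auto simp: incseq_def assms intro: less_le_trans)
      then show "\<exists>m\<in>UNIV. emeasure unit_leb (\<Union>i\<le>j. ?A i) \<le> dfun (F m) l"
        unfolding dfun_def by auto
    qed
    finally show ?thesis .
  qed
  finally have 1: "dfun f l \<le> (SUP j. dfun (F j) l)" .
  have "(SUP j. dfun (F j) l) \<le> dfun f l"
    by (rule SUP_least, rule dfun_mono_AE[OF assms(2)], use assms(3) in eventually_elim)
      (metis SUP_upper UNIV_I)
  with 1 show ?thesis by simp
qed

text \<open>Right continuity in the form needed for the supremum over real levels in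
  \<open>rearr\<close>: the set at level \<open>l\<close> is the increasing union of the sets at the
  levels \<open>l + 1 / Suc n\<close>.\<close>

lemma dfun_right_continuous:
  assumes "f \<in> Mplus" "0 \<le> l" "ennreal s < dfun f (ennreal l)"
  shows "\<exists>t>l. ennreal s < dfun f (ennreal t)"
proof -
  let ?A = "\<lambda>n::nat. {x \<in> {0<..<1}. ennreal (l + 1 / Suc n) < f x}"
  have "{x \<in> {0<..<1}. ennreal l < f x} = (\<Union>n. ?A n)"
  proof (intro equalityI subsetI)
    fix x assume "x \<in> {x \<in> {0<..<1}. ennreal l < f x}"
    then have x: "x \<in> {0<..<1}" "ennreal l < f x" by auto
    obtain y where y: "ennreal l < y" "y < f x" using dense[OF x(2)] by auto
    then obtain r where r: "y = ennreal r" "0 \<le> r" by (cases y) (auto simp: top_unique)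
    have "l < r" using y(1) r assms(2) by (simp add: ennreal_less_iff)
    then obtain n where "1 / real (Suc n) < r - l"
      using reals_Archimedean[of "r - l"] by (auto simp: inverse_eq_divide)
    then have "ennreal (l + 1 / Suc n) \<le> ennreal r" by (intro ennreal_leI) simp
    then have "ennreal (l + 1 / Suc n) < f x" using y(2) r(1) by (auto intro: le_less_trans)
    then show "x \<in> (\<Union>n. ?A n)" using x by blast
  next
    fix x assume "x \<in> (\<Union>n. ?A n)"
    then obtain n where n: "x \<in> {0<..<1}" "ennreal (l + 1 / Suc n) < f x" by auto
    moreover have "ennreal l \<le> ennreal (l + 1 / Suc n)" by (intro ennreal_leI) simp
    ultimately show "x \<in> {x \<in> {0<..<1}. ennreal l < f x}" by auto
  qed
  then have "dfun f l = emeasure unit_leb (\<Union>n. ?A n)" unfolding dfun_def by simp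
  also have "\<dots> = (SUP n. emeasure unit_leb (?A n))"
  proof (rule SUP_emeasure_incseq[symmetric])
    show "incseq ?A"
    proof (rule incseq_SucI)
      fix n
      have "ennreal (l + 1 / Suc (Suc n)) \<le> ennreal (l + 1 / Suc n)"
        by (intro ennreal_leI) (simp add: frac_le)
      then show "?A n \<subseteq> ?A (Suc n)" by (auto intro: le_less_trans)
    qed
  qed (use assms in auto)
  finally obtain n where "ennreal s < emeasure unit_leb (?A n)"
    using assms(3) by (auto simp: less_SUP_iff)
  then show ?thesis unfolding dfun_def by (intro exI[of _ "l + 1 / Suc n"]) auto
qed

text \<open>A Galois connection: the rearrangement is the generalized inverse of the distribution
  function. Most facts about \<open>rearr01\<close> are read off from it, since an element of a
  linear order is determined by what lies strictly below it.\<close>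

lemma less_rearr01_iff:
  assumes f: "f \<in> Mplus"
  shows "l < rearr01 f s \<longleftrightarrow> ennreal s < dfun f l"
proof -
  define S where "S = {ereal t | t :: real. emeasure unit_leb
     {x \<in> space unit_leb. \<bar>enn2ereal (f x)\<bar> > ereal t} > ennreal s}"
  have R: "rearr01 f s = e2ennreal (Sup S)" by (simp add: rearr_def S_def)
  have lt: "ereal t < \<bar>enn2ereal y\<bar> \<longleftrightarrow> ennreal t < y"
    "ereal t < enn2ereal y \<longleftrightarrow> ennreal t < y" if "0 \<le> t" for t y
    using that by (auto simp: ennreal.rep_eq less_ennreal.rep_eq max_def)
  show ?thesis
  proof
    assume "l < rearr01 f s"
    then have "enn2ereal l < Sup S"
      unfolding R by (metis e2ennreal_enn2ereal e2ennreal_mono linorder_not_le)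
    then obtain t where t: "ereal t \<in> S" "enn2ereal l < ereal t"
      unfolding less_Sup_iff S_def by blast
    have t0: "0 \<le> t" using t(2) enn2ereal_nonneg[of l] by (metis ereal_less_eq(5) less_imp_le order_trans)
    have lt': "l < ennreal t" using t(2) t0 by (simp add: less_ennreal.rep_eq ennreal.rep_eq max_def)
    have "ennreal s < dfun f (ennreal t)" using t(1) t0 by (simp add: S_def dfun_def lt)
    also have "\<dots> \<le> dfun f l"
      unfolding dfun_def by (rule emeasure_mono) (use lt' f in auto)
    finally show "ennreal s < dfun f l" .
  next
    assume s: "ennreal s < dfun f l"
    then obtain r where r: "l = ennreal r" "0 \<le> r" by (cases l) auto
    obtain t where t: "r < t" "ennreal s < dfun f (ennreal t)"
      using dfun_right_continuous[OF f r(2)] s r by auto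
    have "ereal t \<in> S" using t r by (simp add: S_def dfun_def lt)
    then have "ereal t \<le> Sup S" by (rule Sup_upper)
    then have "e2ennreal (ereal t) \<le> e2ennreal (Sup S)" by (rule e2ennreal_mono)
    then have "ennreal t \<le> rearr01 f s" using R by (simp add: e2ennreal_ereal)
    moreover have "l < ennreal t" using r t by (simp add: ennreal_less_iff)
    ultimately show "l < rearr01 f s" by (rule less_le_trans[rotated])
  qed
qed

section \<open>Decreasing functions and elementary properties of the rearrangement\<close>

lemma rearr_antimono:
  assumes "s \<le> t"
  shows "rearr M u t \<le> rearr M u s"
  unfolding rearr_def
  by (intro e2ennreal_mono Sup_subset_mono) (use ennreal_leI[OF assms] in \<open>auto intro: le_less_trans\<close>)

lemma antimono_on_Mplus:
  fixes u :: "real \<Rightarrow> ennreal"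
  assumes "antimono_on {0<..<1} u"
  shows "u \<in> Mplus"
  unfolding Mplus_iff
proof (rule borel_measurableI_greater)
  fix l
  have "is_interval {x \<in> {0<..<1}. l < u x}"
    using assms unfolding is_interval_1 monotone_on_def by (auto intro: less_le_trans)
  then have "{x \<in> {0<..<1}. l < u x} \<in> sets borel" by (rule real_interval_borel_measurable)
  then show "{x \<in> space unit_leb. l < u x} \<in> sets unit_leb"
    by (auto simp: sets_unit_leb)
qed

lemma antimono_on_rearr: "antimono_on A (rearr M u)"
  by (auto simp: monotone_on_def rearr_antimono)

lemma rearr_Mplus [simp]: "rearr M u \<in> Mplus"
  by (intro antimono_on_Mplus antimono_on_rearr)

text \<open>Superlevel sets of decreasing functions are initial intervals. Whether the endpoint
  \<open>a\<close> belongs to the set depends on \<open>u\<close>, so the set is only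
  enclosed.\<close>

lemma antimono_on_dfun:
  assumes "antimono_on {0<..<1} u"
  obtains a where "0 \<le> a" "a \<le> 1" "{0<..<a} \<subseteq> {x \<in> {0<..<1}. l < u x}"
    "{x \<in> {0<..<1}. l < u x} \<subseteq> {0..a}" "dfun u l = ennreal a"
proof -
  let ?A = "{x \<in> {0<..<1}. l < u x}"
  \<comment> \<open>The extra point \<open>0\<close> gives the supremum a meaning when the
    superlevel set is empty.\<close>
  define a where "a = Sup (insert 0 ?A)"
  have bdd: "bdd_above (insert 0 ?A)" by (rule bdd_above_mono[of "{..1}"]) auto
  note bdd' = bdd[simplified]
  have a: "0 \<le> a" "a \<le> 1" unfolding a_def
    by (auto intro!: cSup_upper cSup_least bdd bdd')
  have sub1: "{0<..<a} \<subseteq> ?A"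
  proof
    fix x assume x: "x \<in> {0<..<a}"
    then obtain y where "y \<in> insert 0 ?A" "x < y"
      unfolding a_def by (metis (no_types, lifting) greaterThanLessThan_iff insert_not_empty less_cSupE)
    with x have y: "y \<in> ?A" by auto
    then have "u y \<le> u x" using assms \<open>x < y\<close> x a by (auto simp: monotone_on_def)
    then show "x \<in> ?A" using y x a by auto
  qed
  have sub2: "?A \<subseteq> {0..a}" unfolding a_def by (auto intro!: cSup_upper bdd bdd')
  have "dfun u l = ennreal (a - 0)"
    unfolding dfun_def by (rule emeasure_unit_leb_interval) (use a sub1 sub2 in auto)
  then show thesis using that a sub1 sub2 by auto
qed

lemma dfun_rearr01:
  assumes "f \<in> Mplus"
  shows "dfun (rearr01 f) l = dfun f l"
proof -
  obtain d where d: "dfun f l = ennreal d" "0 \<le> d" by (metis dfun_not_top(1) ennreal_cases)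
  have d1: "d \<le> 1" using d dfun_le_1[of f l] by simp
  have "dfun (rearr01 f) l = emeasure unit_leb {x \<in> {0<..<1}. x < d}"
    unfolding dfun_def[of "rearr01 f"] less_rearr01_iff[OF assms] d(1)
    by (rule arg_cong[where f="emeasure unit_leb"]) (auto simp: ennreal_less_iff)
  also have "\<dots> = ennreal (d - 0)"
    by (rule emeasure_unit_leb_interval) (use d d1 in auto)
  finally show ?thesis using d by simp
qed

lemma rearr01_cong:
  assumes "f \<in> Mplus" "g \<in> Mplus" "\<And>l. dfun f l = dfun g l"
  shows "rearr01 f s = rearr01 g s"
proof (rule antisym; rule ccontr)
  assume "\<not> rearr01 f s \<le> rearr01 g s"
  then have "rearr01 g s < rearr01 f s" by simp
  then show False using less_rearr01_iff[OF assms(1)] less_rearr01_iff[OF assms(2)] assms(3) by auto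
next
  assume "\<not> rearr01 g s \<le> rearr01 f s"
  then have "rearr01 f s < rearr01 g s" by simp
  then show False using less_rearr01_iff[OF assms(1)] less_rearr01_iff[OF assms(2)] assms(3) by auto
qed

lemma rearr01_mono_AE:
  assumes "f \<in> Mplus" "g \<in> Mplus" "AE x in unit_leb. f x \<le> g x"
  shows "rearr01 f s \<le> rearr01 g s"
  by (rule ccontr) (metis assms dfun_mono_AE leD leI less_le_trans less_rearr01_iff order_less_irrefl)

lemma rearr01_SUP:
  assumes "\<And>j. F j \<in> Mplus" "f \<in> Mplus"
    and "AE x in unit_leb. incseq (\<lambda>j::nat. F j x) \<and> (SUP j. F j x) = f x"
  shows "incseq (\<lambda>j. rearr01 (F j) s)" "(SUP j. rearr01 (F j) s) = rearr01 f s"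
proof -
  show "incseq (\<lambda>j. rearr01 (F j) s)"
    by (intro incseq_SucI rearr01_mono_AE assms, use assms(3) in eventually_elim)
      (auto simp: incseq_def)
  have "l < (SUP j. rearr01 (F j) s) \<longleftrightarrow> l < rearr01 f s" for l
    by (simp add: less_SUP_iff less_rearr01_iff assms dfun_SUP[OF assms])
  then show "(SUP j. rearr01 (F j) s) = rearr01 f s"
    by (meson linorder_neqE order_less_irrefl)
qed

lemma rearr01_cmult:
  assumes "f \<in> Mplus" "0 \<le> a"
  shows "rearr01 (\<lambda>x. ennreal a * f x) s = ennreal a * rearr01 f s"
proof (cases "a = 0")
  case True
  have "\<not> 0 < rearr01 (\<lambda>x. ennreal a * f x) s"
    using True by (subst less_rearr01_iff) (auto simp: dfun_def Mplus_iff)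
  then show ?thesis using True by simp
next
  case False
  then have a: "0 < a" using assms by simp
  have af: "(\<lambda>x. ennreal a * f x) \<in> Mplus" using assms(1) by (auto simp: Mplus_iff)
  have sw: "l < ennreal a * y \<longleftrightarrow> l / ennreal a < y" for l y
    using a by (subst divide_less_ennreal) (auto simp: mult.commute)
  have "l < rearr01 (\<lambda>x. ennreal a * f x) s \<longleftrightarrow> l < ennreal a * rearr01 f s" for l
    unfolding less_rearr01_iff[OF af] sw less_rearr01_iff[OF assms(1)] by (simp add: dfun_def sw)
  then show ?thesis by (meson linorder_neqE order_less_irrefl)
qed

text \<open>Equality can fail at jumps, where \<open>u\<close> may lie above its right-continuous
  rearrangement.\<close>

lemma rearr01_le_antimono:
  assumes u: "antimono_on {0<..<1} u" and s: "s \<in> {0<..<1}"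
  shows "rearr01 u s \<le> u s"
proof (rule ccontr)
  assume "\<not> rearr01 u s \<le> u s"
  then have "ennreal s < dfun u (u s)"
    by (simp add: not_le less_rearr01_iff[OF antimono_on_Mplus[OF u]])
  moreover obtain a where "0 \<le> a" "{0<..<a} \<subseteq> {x \<in> {0<..<1}. u s < u x}" "dfun u (u s) = ennreal a"
    using antimono_on_dfun[OF u] by metis
  ultimately have "s < a" "{0<..<a} \<subseteq> {x \<in> {0<..<1}. u s < u x}"
    using s by (auto simp: ennreal_less_iff)
  then show False using s by auto
qed

lemma rearr01_upper_bound:
  assumes "f \<in> Mplus" "AE x in unit_leb. f x \<le> B" "0 \<le> s"
  shows "rearr01 f s \<le> B"
proof (rule ccontr)
  assume "\<not> rearr01 f s \<le> B"
  then have "ennreal s < dfun f B" using less_rearr01_iff[OF assms(1), of B s] by auto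
  then have "0 < dfun f B" by (rule le_less_trans[rotated]) simp
  moreover have "dfun f B = 0"
    unfolding dfun_def
    using emeasure_eq_0_AE[where M=unit_leb and P="\<lambda>x. B < f x"] assms(2) by (simp add: not_less)
  ultimately show False by simp
qed

section \<open>Layer cake formula and the Hardy--Littlewood inequality\<close>

abbreviation halfline :: "real measure" where
  "halfline \<equiv> restrict_space lborel {0<..}"

lemma sigma_finite_halfline: "sigma_finite_measure halfline"
  by (intro sigma_finite_measure_restrict_space lborel.sigma_finite_measure_axioms) auto

lemma ennreal_layer: "(\<integral>\<^sup>+l. of_bool (ennreal l < y) \<partial>halfline) = y"
proof -
  have "(\<integral>\<^sup>+l. of_bool (ennreal l < y) \<partial>halfline) = (\<integral>\<^sup>+l. of_bool (ennreal l < y) * indicator {0<..} l \<partial>lborel)"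
    by (rule nn_integral_restrict_space) auto
  also have "\<dots> = y"
  proof (cases y)
    case (real r)
    have "(\<integral>\<^sup>+l. of_bool (ennreal l < y) * indicator {0<..} l \<partial>lborel) = (\<integral>\<^sup>+l. indicator {0<..<r} l \<partial>lborel)"
      by (rule nn_integral_cong) (use real in \<open>auto simp: indicator_def ennreal_less_iff\<close>)
    also have "\<dots> = ennreal r" using real by (subst nn_integral_indicator) auto
    finally show ?thesis using real by simp
  next
    case top
    have "(\<integral>\<^sup>+l. of_bool (ennreal l < y) * indicator {0<..} l \<partial>lborel) = (\<integral>\<^sup>+l. indicator {0::real<..} l \<partial>lborel)"
      by (rule nn_integral_cong) (use top in \<open>auto simp: indicator_def\<close>)
    also have "\<dots> = emeasure lborel {0::real<..}" by (subst nn_integral_indicator) auto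
    also have "\<dots> = top"
    proof -
      have "ennreal (real n) \<le> emeasure lborel {0::real<..}" for n
      proof -
        have "ennreal (real n) = emeasure lborel {0<..<real n}" by simp
        also have "\<dots> \<le> emeasure lborel {0::real<..}" by (rule emeasure_mono) auto
        finally show ?thesis .
      qed
      then show ?thesis by (metis ennreal_of_nat_eq_real_of_nat ennreal_SUP_of_nat_eq_top SUP_least top_unique)
    qed
    finally show ?thesis using top by simp
  qed
  finally show ?thesis .
qed

lemma nn_integral_mult_layer:
  assumes "f \<in> Mplus" "g \<in> Mplus"
  shows "(\<integral>\<^sup>+x. f x * g x \<partial>unit_leb) =
    (\<integral>\<^sup>+l. (\<integral>\<^sup>+x. f x * of_bool (ennreal l < g x) \<partial>unit_leb) \<partial>halfline)"
proof -
  interpret H: sigma_finite_measure halfline by (rule sigma_finite_halfline)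
  interpret P: pair_sigma_finite unit_leb halfline ..
  have [measurable]: "f \<in> borel_measurable unit_leb" "g \<in> borel_measurable unit_leb"
    using assms by (auto simp: Mplus_def)
  have id [measurable]: "(\<lambda>x. x) \<in> borel_measurable halfline"
    by (rule measurable_restrict_space1) simp
  have "(\<integral>\<^sup>+x. f x * g x \<partial>unit_leb) =
      (\<integral>\<^sup>+x. (\<integral>\<^sup>+l. f x * of_bool (ennreal l < g x) \<partial>halfline) \<partial>unit_leb)"
    by (subst nn_integral_cmult) (auto simp: ennreal_layer)
  also have "\<dots> = (\<integral>\<^sup>+l. (\<integral>\<^sup>+x. f x * of_bool (ennreal l < g x) \<partial>unit_leb) \<partial>halfline)"
    by (rule P.Fubini'[symmetric]) measurable
  finally show ?thesis .
qed

lemma nn_integral_mult_layer2: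
  assumes f: "f \<in> Mplus" and g: "g \<in> Mplus"
  shows "(\<integral>\<^sup>+x. f x * g x \<partial>unit_leb) =
    (\<integral>\<^sup>+l. (\<integral>\<^sup>+m. emeasure unit_leb ({x \<in> {0<..<1}. ennreal l < g x} \<inter> {x \<in> {0<..<1}. ennreal m < f x})
       \<partial>halfline) \<partial>halfline)"
proof -
  have "(\<integral>\<^sup>+x. f x * of_bool (ennreal l < g x) \<partial>unit_leb) =
     (\<integral>\<^sup>+m. emeasure unit_leb ({x \<in> {0<..<1}. ennreal l < g x} \<inter> {x \<in> {0<..<1}. ennreal m < f x}) \<partial>halfline)"
    for l
  proof -
    have ind: "(\<lambda>x. of_bool (ennreal l < g x)) \<in> Mplus"
    proof -
      have [measurable]: "g \<in> borel_measurable unit_leb" using g by (simp add: Mplus_def)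
      show ?thesis unfolding Mplus_iff by measurable
    qed
    have "(\<integral>\<^sup>+x. f x * of_bool (ennreal l < g x) \<partial>unit_leb) =
       (\<integral>\<^sup>+x. of_bool (ennreal l < g x) * f x \<partial>unit_leb)" by (simp add: mult.commute)
    also have "\<dots> = (\<integral>\<^sup>+m. (\<integral>\<^sup>+x. of_bool (ennreal l < g x) * of_bool (ennreal m < f x) \<partial>unit_leb) \<partial>halfline)"
      by (rule nn_integral_mult_layer[OF ind f])
    also have "\<dots> = (\<integral>\<^sup>+m. (\<integral>\<^sup>+x. indicator ({x \<in> {0<..<1}. ennreal l < g x} \<inter> {x \<in> {0<..<1}. ennreal m < f x}) x \<partial>unit_leb) \<partial>halfline)"
      by (intro nn_integral_cong) (auto simp: indicator_def)
    finally show ?thesis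
      using Mplus_sets[OF f] Mplus_sets[OF g] by (subst (asm) nn_integral_indicator) auto
  qed
  then show ?thesis by (subst nn_integral_mult_layer[OF f g]) simp
qed

text \<open>By the layer cake formula for both factors it suffices to compare intersections of
  superlevel sets. For the rearrangements these sets are nested initial intervals, so their
  intersection has the smaller of the two measures, which bounds the intersection of the original
  sets.\<close>

lemma hardy_littlewood:
  assumes f: "f \<in> Mplus" and g: "g \<in> Mplus"
  shows "(\<integral>\<^sup>+x. f x * g x \<partial>unit_leb) \<le> (\<integral>\<^sup>+x. rearr01 f x * rearr01 g x \<partial>unit_leb)"
proof -
  have "emeasure unit_leb ({x \<in> {0<..<1}. l < g x} \<inter> {x \<in> {0<..<1}. m < f x})
     \<le> emeasure unit_leb ({x \<in> {0<..<1}. l < rearr01 g x} \<inter> {x \<in> {0<..<1}. m < rearr01 f x})" (is "?L \<le> ?R") for l m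
  proof -
    have L: "?L \<le> dfun g l" "?L \<le> dfun f m"
      unfolding dfun_def by (intro emeasure_mono Mplus_sets f g; auto)+
    have "?R = emeasure unit_leb {x \<in> {0<..<1}. ennreal x < dfun g l \<and> ennreal x < dfun f m}"
      by (rule arg_cong[where f="emeasure unit_leb"]) (auto simp: less_rearr01_iff f g)
    also have "\<dots> = (if dfun g l \<le> dfun f m then dfun (rearr01 g) l else dfun (rearr01 f) m)"
      unfolding dfun_def[of "rearr01 _"]
      by (auto simp: less_rearr01_iff f g intro!: arg_cong[where f="emeasure unit_leb"])
    also have "\<dots> = min (dfun g l) (dfun f m)" by (simp add: dfun_rearr01 f g min_def)
    finally show ?thesis using L by simp
  qed
  then show ?thesis
    unfolding nn_integral_mult_layer2[OF f g] nn_integral_mult_layer2[OF rearr_Mplus rearr_Mplus]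
    by (intro nn_integral_mono) auto
qed

lemma nn_integral_cong_dfun:
  assumes "f \<in> Mplus" "g \<in> Mplus" "\<And>l. dfun f l = dfun g l"
  shows "(\<integral>\<^sup>+x. f x \<partial>unit_leb) = (\<integral>\<^sup>+x. g x \<partial>unit_leb)"
proof -
  have *: "(\<integral>\<^sup>+x. f x \<partial>unit_leb) = (\<integral>\<^sup>+l. dfun f (ennreal l) \<partial>halfline)" if f: "f \<in> Mplus" for f
  proof -
    have "(\<integral>\<^sup>+x. 1 * f x \<partial>unit_leb) =
      (\<integral>\<^sup>+l. (\<integral>\<^sup>+x. 1 * of_bool (ennreal l < f x) \<partial>unit_leb) \<partial>halfline)"
      by (rule nn_integral_mult_layer) (use f in \<open>auto simp: Mplus_iff\<close>)
    also have "\<dots> = (\<integral>\<^sup>+l. (\<integral>\<^sup>+x. indicator {x \<in> {0<..<1}. ennreal l < f x} x \<partial>unit_leb) \<partial>halfline)"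
      by (intro nn_integral_cong) (auto simp: indicator_def)
    finally show ?thesis using Mplus_sets[OF f] by (simp add: dfun_def)
  qed
  show ?thesis by (simp add: * assms)
qed

section \<open>Ryff's measure-preserving map\<close>

text \<open>Preservation is demanded only for initial intervals, with and without endpoint: these
  are the superlevel sets of the decreasing functions that get composed with
  \<open>\<sigma>\<close>.\<close>

definition measure_preserving01 :: "(real \<Rightarrow> real) \<Rightarrow> bool" where
  "measure_preserving01 \<sigma> \<longleftrightarrow> (\<forall>x\<in>{0<..<1}. \<sigma> x \<in> {0<..<1}) \<and>
     (\<forall>t\<in>{0..1}. {x \<in> {0<..<1}. \<sigma> x < t} \<in> sets unit_leb \<and> {x \<in> {0<..<1}. \<sigma> x \<le> t} \<in> sets unit_leb \<and>
        emeasure unit_leb {x \<in> {0<..<1}. \<sigma> x < t} = ennreal t \<and>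
        emeasure unit_leb {x \<in> {0<..<1}. \<sigma> x \<le> t} = ennreal t)"

lemma measure_preserving01D:
  assumes "measure_preserving01 \<sigma>"
  shows "x \<in> {0<..<1} \<Longrightarrow> \<sigma> x \<in> {0<..<1}"
    and "t \<in> {0..1} \<Longrightarrow> {x \<in> {0<..<1}. \<sigma> x < t} \<in> sets unit_leb"
    and "t \<in> {0..1} \<Longrightarrow> {x \<in> {0<..<1}. \<sigma> x \<le> t} \<in> sets unit_leb"
    and "t \<in> {0..1} \<Longrightarrow> emeasure unit_leb {x \<in> {0<..<1}. \<sigma> x < t} = ennreal t"
    and "t \<in> {0..1} \<Longrightarrow> emeasure unit_leb {x \<in> {0<..<1}. \<sigma> x \<le> t} = ennreal t"
  using assms unfolding measure_preserving01_def by blast+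

lemma antimono_comp_measure_preserving:
  assumes u: "antimono_on {0<..<1} u" and s: "measure_preserving01 \<sigma>"
  shows "(\<lambda>x. u (\<sigma> x)) \<in> Mplus" "dfun (\<lambda>x. u (\<sigma> x)) l = dfun u l"
proof -
  have *: "{x \<in> {0<..<1}. l < u (\<sigma> x)} \<in> sets unit_leb \<and>
     emeasure unit_leb {x \<in> {0<..<1}. l < u (\<sigma> x)} = dfun u l" for l
  proof -
    obtain a where a: "0 \<le> a" "a \<le> 1" "{0<..<a} \<subseteq> {x \<in> {0<..<1}. l < u x}"
      "{x \<in> {0<..<1}. l < u x} \<subseteq> {0..a}" "dfun u l = ennreal a"
      by (rule antimono_on_dfun[OF u])
    have r: "\<sigma> x \<in> {0<..<1}" if "x \<in> {0<..<1}" for x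
      using measure_preserving01D(1)[OF s that] .
    have a01: "a \<in> {0..1}" using a by auto
    \<comment> \<open>Membership of the endpoint \<open>a\<close> in the superlevel set of
      \<open>u\<close> decides between the preimages given by \<open>\<sigma> x \<le> a\<close> and
      by \<open>\<sigma> x < a\<close>.\<close>
    show ?thesis
    proof (cases "a \<in> {x \<in> {0<..<1}. l < u x}")
      case True
      have "{x \<in> {0<..<1}. l < u (\<sigma> x)} = {x \<in> {0<..<1}. \<sigma> x \<le> a}"
      proof (intro Collect_cong conj_cong refl)
        fix x :: real assume "x \<in> {0<..<1}"
        then have rx: "\<sigma> x \<in> {0<..<1}" by (rule r)
        have "\<sigma> x < a \<Longrightarrow> l < u (\<sigma> x)" "l < u (\<sigma> x) \<Longrightarrow> \<sigma> x \<le> a"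
          using subsetD[OF a(3), of "\<sigma> x"] subsetD[OF a(4), of "\<sigma> x"] rx by simp_all
        then show "l < u (\<sigma> x) \<longleftrightarrow> \<sigma> x \<le> a"
          using True rx by (cases "\<sigma> x = a") auto
      qed
      then show ?thesis using measure_preserving01D(2-)[OF s a01] a(5) by (metis (no_types))
    next
      case False
      have "{x \<in> {0<..<1}. l < u (\<sigma> x)} = {x \<in> {0<..<1}. \<sigma> x < a}"
      proof (intro Collect_cong conj_cong refl)
        fix x :: real assume "x \<in> {0<..<1}"
        then have rx: "\<sigma> x \<in> {0<..<1}" by (rule r)
        have "\<sigma> x < a \<Longrightarrow> l < u (\<sigma> x)" "l < u (\<sigma> x) \<Longrightarrow> \<sigma> x \<le> a"
          using subsetD[OF a(3), of "\<sigma> x"] subsetD[OF a(4), of "\<sigma> x"] rx by simp_all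
        then show "l < u (\<sigma> x) \<longleftrightarrow> \<sigma> x < a"
          using False rx by (cases "\<sigma> x = a") auto
      qed
      then show ?thesis using measure_preserving01D(2-)[OF s a01] a(5) by (metis (no_types))
    qed
  qed
  show "(\<lambda>x. u (\<sigma> x)) \<in> Mplus"
    unfolding Mplus_iff by (rule borel_measurableI_greater) (use * in simp)
  show "dfun (\<lambda>x. u (\<sigma> x)) l = dfun u l" using * by (simp add: dfun_def)
qed

text \<open>If \<open>h < g\<close> held on a set of positive measure, some level \<open>q\<close>
  from a countable dense set would satisfy \<open>h x \<le> q < g x\<close> on a set of positive
  measure. But the superlevel sets at \<open>q\<close> are nested almost everywhere and have the
  same finite measure.\<close>

lemma AE_eq_of_dfun_eq:
  assumes h: "h \<in> Mplus" and g: "g \<in> Mplus" and le: "AE x in unit_leb. h x \<le> g x"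
    and eq: "\<And>l. dfun h l = dfun g l"
  shows "AE x in unit_leb. h x = g x"
proof -
  obtain D :: "ennreal set" where D: "countable D"
    "\<And>X. open X \<Longrightarrow> X \<noteq> {} \<Longrightarrow> \<exists>d\<in>D. d \<in> X"
    using countable_dense_setE by metis
  have "AE x in unit_leb. \<forall>q\<in>D. \<not> (h x \<le> q \<and> q < g x)"
  proof (subst AE_ball_countable[OF D(1)], intro ballI)
    fix q assume "q \<in> D"
    let ?H = "{x \<in> {0<..<1}. q < h x}" and ?G = "{x \<in> {0<..<1}. q < g x}"
    have [measurable]: "?H \<in> sets unit_leb" "?G \<in> sets unit_leb" using h g by auto
    have "emeasure unit_leb (?G \<inter> ?H) = emeasure unit_leb ?H"
    proof (rule emeasure_eq_AE)
      show "AE x in unit_leb. (x \<in> ?G \<inter> ?H) = (x \<in> ?H)"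
        using le by eventually_elim auto
    qed measurable
    moreover have "emeasure unit_leb (?G - ?G \<inter> ?H) = emeasure unit_leb ?G - emeasure unit_leb (?G \<inter> ?H)"
      by (rule emeasure_Diff) (auto simp: g h)
    ultimately have "emeasure unit_leb (?G - ?G \<inter> ?H) = 0"
      using eq[of q] by (simp add: dfun_def)
    then have "?G - ?G \<inter> ?H \<in> null_sets unit_leb"
      unfolding null_sets_def by (intro CollectI conjI) measurable
    then show "AE x in unit_leb. \<not> (h x \<le> q \<and> q < g x)"
      by (rule AE_I') auto
  qed
  with le show ?thesis
  proof eventually_elim
    case (elim x)
    show ?case
    proof (rule ccontr)
      assume "h x \<noteq> g x"
      then have "h x < g x" using elim by simp
      then have "{h x<..<g x} \<noteq> {}" by (metis dense greaterThanLessThan_iff empty_iff)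
      then obtain d where "d \<in> D" "d \<in> {h x<..<g x}" using D(2) open_greaterThanLessThan by blast
      then show False using elim(2) by fastforce
    qed
  qed
qed

text \<open>The points are ordered by decreasing value of \<open>g\<close>, ties being broken from left to right;
  the map sends a point to the measure of the set of its predecessors.\<close>

definition ryff :: "(real \<Rightarrow> ennreal) \<Rightarrow> real \<Rightarrow> real" where
  "ryff g x = measure unit_leb {y \<in> {0<..<1}. g x < g y \<or> g y = g x \<and> y < x}"

lemma ryff_sets:
  assumes "g \<in> Mplus"
  shows "{y \<in> {0<..<1}. v < g y \<or> g y = v \<and> y < b} \<in> sets unit_leb"
    and "{y \<in> {0<..<1}. v \<le> g y} \<in> sets unit_leb"
proof -
  have [measurable]: "g \<in> borel_measurable unit_leb" using assms by (simp add: Mplus_def)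
  have "{y \<in> space unit_leb. v < g y \<or> g y = v \<and> y < b} \<in> sets unit_leb" by measurable
  then show "{y \<in> {0<..<1}. v < g y \<or> g y = v \<and> y < b} \<in> sets unit_leb" by simp
  have "{y \<in> space unit_leb. v \<le> g y} \<in> sets unit_leb" by measurable
  then show "{y \<in> {0<..<1}. v \<le> g y} \<in> sets unit_leb" by simp
qed

lemma emeasure_ge_rearr01:
  assumes g: "g \<in> Mplus" and t: "0 \<le> t" "t \<le> 1"
  shows "ennreal t \<le> emeasure unit_leb {y \<in> {0<..<1}. rearr01 g t \<le> g y}"
proof (cases "rearr01 g t = 0")
  case True
  have "{y::real. 0 < y \<and> y < 1} = {0<..<1}" by auto
  then show ?thesis using True t by simp
next
  case False
  define v where "v = rearr01 g t"
  have "0 < v" using False by (simp add: v_def gr_zeroI)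
  then obtain u where u: "\<And>n. u n < v" "u \<longlonglongrightarrow> v"
    using approx_from_below_dense_linorder by blast
  \<comment> \<open>The sequence \<open>u\<close> need not be monotone; finite intersections make
    the sets decrease, so that continuity from above applies.\<close>
  let ?A = "\<lambda>n. \<Inter>i\<in>{..n}. {y \<in> {0<..<1}. u i < g y}"
  have A: "ennreal t \<le> emeasure unit_leb (?A n)" "?A n \<in> sets unit_leb" for n
  proof -
    define m where "m = Max (u ` {..n})"
    have "m \<in> u ` {..n}" unfolding m_def by (rule Max_in) auto
    then have "m < v" using u by auto
    moreover have "?A n = {y \<in> {0<..<1}. m < g y}"
      unfolding m_def by (auto simp: Max_less_iff)
    ultimately show "ennreal t \<le> emeasure unit_leb (?A n)" "?A n \<in> sets unit_leb"
      using less_rearr01_iff[OF g, of m t] g by (auto simp: v_def dfun_def)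
  qed
  have "emeasure unit_leb (\<Inter>n. ?A n) = (INF n. emeasure unit_leb (?A n))"
    by (rule INF_emeasure_decseq[symmetric]) (use A in \<open>auto simp: decseq_def\<close>)
  then have "ennreal t \<le> emeasure unit_leb (\<Inter>n. ?A n)"
    using A by (auto intro!: INF_greatest)
  also have "(\<Inter>n. ?A n) \<subseteq> {y \<in> {0<..<1}. v \<le> g y}"
  proof
    fix y assume "y \<in> (\<Inter>n. ?A n)"
    then have "y \<in> {0<..<1}" "\<And>n. u n < g y" by auto
    moreover from this have "v \<le> g y" by (intro LIMSEQ_le_const2[OF u(2)]) (auto intro: less_imp_le)
    ultimately show "y \<in> {y \<in> {0<..<1}. v \<le> g y}" by auto
  qed
  then have "emeasure unit_leb (\<Inter>n. ?A n) \<le> emeasure unit_leb {y \<in> {0<..<1}. v \<le> g y}"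
    by (rule emeasure_mono) (rule ryff_sets[OF g])
  finally show ?thesis by (simp add: v_def)
qed

text \<open>At the critical value \<open>v\<close> of \<open>g\<close> a level set of positive
  measure has to be cut at the right place. Breaking ties from left to right makes the measure
  \<open>c b\<close> of the points preceding \<open>b\<close> a 1-Lipschitz function of
  \<open>b\<close>, and it passes through \<open>t\<close> by the intermediate value
  theorem.\<close>

lemma ryff_sublevel:
  assumes g: "g \<in> Mplus" and t: "0 \<le> t" "t \<le> 1"
  shows "\<exists>S\<in>sets unit_leb. emeasure unit_leb S = ennreal t \<and>
    {x \<in> {0<..<1}. ryff g x < t} \<subseteq> S \<and> S \<subseteq> {x \<in> {0<..<1}. ryff g x \<le> t}"
proof -
  define v where "v = rearr01 g t"
  define S where "S b = {y \<in> {0<..<1}. v < g y \<or> g y = v \<and> y < b}" for b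
  define c where "c b = measure unit_leb (S b)" for b
  have S [measurable]: "S b \<in> sets unit_leb" for b unfolding S_def by (rule ryff_sets[OF g])
  have c: "emeasure unit_leb (S b) = ennreal (c b)" for b
    unfolding c_def by (rule unit_leb.emeasure_eq_measure)
  have mono: "c a \<le> c b" if "a \<le> b" for a b
    unfolding c_def by (rule unit_leb.finite_measure_mono[OF _ S]) (use that in \<open>auto simp: S_def\<close>)
  have lip: "c b \<le> c a + (b - a)" if "a \<le> b" "0 \<le> a" "b \<le> 1" for a b
  proof -
    have I: "{a..<b} \<inter> {0<..<1} \<in> sets unit_leb"
       "emeasure unit_leb ({a..<b} \<inter> {0<..<1}) = ennreal (b - a)"
      by (rule emeasure_unit_leb_interval[of a b]; use that in auto)+
    have "c b \<le> measure unit_leb (S a \<union> ({a..<b} \<inter> {0<..<1}))"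
      unfolding c_def by (rule unit_leb.finite_measure_mono[OF _ sets.Un[OF S I(1)]]) (auto simp: S_def)
    also have "\<dots> \<le> c a + measure unit_leb ({a..<b} \<inter> {0<..<1})"
      unfolding c_def by (rule measure_Un_le) (use I in auto)
    also have "measure unit_leb ({a..<b} \<inter> {0<..<1}) = b - a"
      using I that by (simp add: measure_def)
    finally show ?thesis .
  qed
  have "continuous_on {0..1} c"
    unfolding continuous_on_iff
  proof (intro ballI allI impI)
    fix x e :: real assume "x \<in> {0..1}" "0 < e"
    then have "\<forall>x'\<in>{0..1}. dist x' x < e \<longrightarrow> dist (c x') (c x) < e"
      using lip mono unfolding dist_real_def
      by (smt (verit, ccfv_SIG) atLeastAtMost_iff)
    with \<open>0 < e\<close> show "\<exists>d>0. \<forall>x'\<in>{0..1}. dist x' x < d \<longrightarrow> dist (c x') (c x) < e" by blast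
  qed
  moreover have "c 0 \<le> t"
  proof -
    have "ennreal (c 0) = dfun g v" unfolding c[symmetric] dfun_def S_def
      by (rule arg_cong[where f="emeasure unit_leb"]) auto
    also have "\<dots> \<le> ennreal t" using less_rearr01_iff[OF g, of v t] by (auto simp: v_def)
    finally show ?thesis using t by simp
  qed
  moreover have "t \<le> c 1"
  proof -
    have "ennreal t \<le> emeasure unit_leb {y \<in> {0<..<1}. v \<le> g y}"
      unfolding v_def by (rule emeasure_ge_rearr01[OF g t])
    also have "\<dots> = ennreal (c 1)" unfolding c[symmetric] S_def
      by (rule arg_cong[where f="emeasure unit_leb"]) auto
    finally show ?thesis by (simp add: c_def)
  qed
  ultimately obtain b where b: "c b = t" using IVT'[of c 0 t 1] by auto
  have "ryff g x \<le> t" if "x \<in> S b" for x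
  proof -
    have "ryff g x \<le> c b" unfolding ryff_def c_def
      by (rule unit_leb.finite_measure_mono[OF _ S]) (use that in \<open>auto simp: S_def\<close>)
    then show ?thesis using b by simp
  qed
  moreover have "t \<le> ryff g x" if "x \<in> {0<..<1}" "x \<notin> S b" for x
  proof -
    have "c b \<le> ryff g x" unfolding ryff_def c_def
      by (rule unit_leb.finite_measure_mono)
        (use that in \<open>auto simp: S_def not_less intro!: ryff_sets[OF g, simplified]\<close>)
    then show ?thesis using b by simp
  qed
  moreover have "S b \<subseteq> {0<..<1}" by (auto simp: S_def)
  ultimately show ?thesis
    using S[of b] c[of b] b by (intro bexI[of _ "S b"]) (auto simp: subset_iff not_less[symmetric])
qed

text \<open>The sandwiching sets give only that the open sublevel set has measure at most
  \<open>t\<close> and the closed one at least \<open>t\<close>. Since the closed set at a level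
  lies in the open set at any larger level, letting the levels converge forces equality.\<close>

lemma ryff_level:
  assumes g: "g \<in> Mplus"
  shows "{x \<in> {0<..<1}. ryff g x \<le> t} \<in> sets unit_leb"
    and "{x \<in> {0<..<1}. ryff g x < t} \<in> sets unit_leb"
    and "0 \<le> t \<Longrightarrow> t \<le> 1 \<Longrightarrow> emeasure unit_leb {x \<in> {0<..<1}. ryff g x \<le> t} = ennreal t"
    and "0 \<le> t \<Longrightarrow> t \<le> 1 \<Longrightarrow> emeasure unit_leb {x \<in> {0<..<1}. ryff g x < t} = ennreal t"
proof -
  have r0: "0 \<le> ryff g x" for x by (simp add: ryff_def)
  have r1: "ryff g x \<le> 1" for x
    using unit_leb.bounded_measure[of "{y \<in> {0<..<1}. g x < g y \<or> g y = g x \<and> y < x}"]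
    by (simp add: ryff_def measure_def[of _ "{0<..<1}"])
  have "\<forall>t\<in>{0..1}. \<exists>S. S \<in> sets unit_leb \<and> emeasure unit_leb S = ennreal t \<and>
    {x \<in> {0<..<1}. ryff g x < t} \<subseteq> S \<and> S \<subseteq> {x \<in> {0<..<1}. ryff g x \<le> t}"
  proof (intro ballI)
    fix t :: real assume "t \<in> {0..1}"
    then have "0 \<le> t" "t \<le> 1" by auto
    from ryff_sublevel[OF g this, unfolded Bex_def]
    show "\<exists>S. S \<in> sets unit_leb \<and> emeasure unit_leb S = ennreal t \<and>
      {x \<in> {0<..<1}. ryff g x < t} \<subseteq> S \<and> S \<subseteq> {x \<in> {0<..<1}. ryff g x \<le> t}" .
  qed
  from bchoice[OF this] obtain S where S0: "\<forall>t\<in>{0..1}. S t \<in> sets unit_leb \<and>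
    emeasure unit_leb (S t) = ennreal t \<and>
    {x \<in> {0<..<1}. ryff g x < t} \<subseteq> S t \<and> S t \<subseteq> {x \<in> {0<..<1}. ryff g x \<le> t}" ..
  have S: "S t \<in> sets unit_leb" "emeasure unit_leb (S t) = ennreal t"
    "{x \<in> {0<..<1}. ryff g x < t} \<subseteq> S t" "S t \<subseteq> {x \<in> {0<..<1}. ryff g x \<le> t}"
    if "0 \<le> t" "t \<le> 1" for t
    using bspec[OF S0, of t] that by (simp_all del: greaterThanLessThan_iff)
  have le: "{x \<in> {0<..<1}. ryff g x \<le> t} \<in> sets unit_leb" for t
  proof -
    consider "t < 0" | "1 \<le> t" | "0 \<le> t" "t < 1" by linarith
    then show ?thesis
    proof cases
      case 1
      then have "{x \<in> {0<..<1}. ryff g x \<le> t} = {}" using r0 by (auto simp: not_le intro: less_le_trans)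
      then show ?thesis by (metis sets.empty_sets)
    next
      case 2
      then have "{x \<in> {0<..<1}. ryff g x \<le> t} = space unit_leb" unfolding space_unit_leb using r1 by (auto intro: order_trans)
      then show ?thesis by (metis sets.top)
    next
      case 3
      \<comment> \<open>Levels slightly above \<open>t\<close>, cut off at 1 because
        \<open>S\<close> is controlled only on the unit interval.\<close>
      let ?t = "\<lambda>n::nat. min 1 (t + 1 / Suc n)"
      have "{x \<in> {0<..<1}. ryff g x \<le> t} = (\<Inter>n. S (?t n))"
      proof (intro equalityI subsetI)
        fix x assume x: "x \<in> {x \<in> {0<..<1}. ryff g x \<le> t}"
        have "x \<in> S (?t n)" for n
        proof -
          have "t < ?t n" using 3 by simp
          with x have "x \<in> {x \<in> {0<..<1}. ryff g x < ?t n}" by (simp del: min_less_iff_conj)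
          then show ?thesis by (rule subsetD[OF S(3), rotated 2]) (use 3 in auto)
        qed
        then show "x \<in> (\<Inter>n. S (?t n))" by auto
      next
        fix x assume x: "x \<in> (\<Inter>n. S (?t n))"
        have *: "x \<in> {0<..<1} \<and> ryff g x \<le> ?t n" for n
          using S(4)[of "?t n"] x 3 by auto
        have "ryff g x \<le> t"
        proof (rule field_le_epsilon)
          fix e :: real assume "0 < e"
          then obtain n where "1 / real (Suc n) < e" using reals_Archimedean by (auto simp: inverse_eq_divide)
          then show "ryff g x \<le> t + e" using *[of n] by simp
        qed
        then show "x \<in> {x \<in> {0<..<1}. ryff g x \<le> t}" using * by auto
      qed
      also have "\<dots> \<in> sets unit_leb" using S(1) 3 by (intro sets.countable_INT) auto
      finally show ?thesis .
    qed
  qed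
  then have [measurable]: "ryff g \<in> borel_measurable unit_leb"
    by (subst borel_measurable_iff_le) simp
  have "{x \<in> space unit_leb. ryff g x < t} \<in> sets unit_leb" for t by measurable
  then have lt: "{x \<in> {0<..<1}. ryff g x < t} \<in> sets unit_leb" for t by simp
  show "{x \<in> {0<..<1}. ryff g x \<le> t} \<in> sets unit_leb" "{x \<in> {0<..<1}. ryff g x < t} \<in> sets unit_leb"
    by (fact le lt)+
  define L where "L t = measure unit_leb {x \<in> {0<..<1}. ryff g x < t}" for t
  define R where "R t = measure unit_leb {x \<in> {0<..<1}. ryff g x \<le> t}" for t
  have L: "L t \<le> t" and R: "t \<le> R t" if "0 \<le> t" "t \<le> 1" for t
  proof -
    have m: "measure unit_leb (S t) = t" using S(2)[OF that] that by (simp add: measure_def)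
    show "L t \<le> t" unfolding L_def using S(1,3)[OF that]
      by (subst (2) m[symmetric]) (rule unit_leb.finite_measure_mono)
    show "t \<le> R t" unfolding R_def using S(4)[OF that]
      by (subst (1) m[symmetric]) (rule unit_leb.finite_measure_mono[OF _ le])
  qed
  have RL: "R s \<le> L t" if "s < t" for s t
    unfolding L_def R_def by (rule unit_leb.finite_measure_mono[OF _ lt]) (use that in auto)
  show "emeasure unit_leb {x \<in> {0<..<1}. ryff g x \<le> t} = ennreal t" if t: "0 \<le> t" "t \<le> 1"
  proof -
    have "R t \<le> t"
    proof (cases "t = 1")
      case True
      have "R t \<le> measure unit_leb (space unit_leb)" unfolding R_def by (rule unit_leb.bounded_measure)
      then show ?thesis using True by (simp add: measure_def)
    next
      case False
      show ?thesis
      proof (rule dense_ge_bounded[of t 1])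
        fix w assume "t < w" "w < 1"
        then show "R t \<le> w" using RL[of t w] L[of w] t by simp
      qed (use t False in simp)
    qed
    then show ?thesis using R[OF t] by (simp add: unit_leb.emeasure_eq_measure R_def)
  qed
  show "emeasure unit_leb {x \<in> {0<..<1}. ryff g x < t} = ennreal t" if t: "0 \<le> t" "t \<le> 1"
  proof -
    have "t \<le> L t"
    proof (cases "t = 0")
      case False
      show ?thesis
      proof (rule dense_le_bounded[of 0 t])
        fix w assume "0 < w" "w < t"
        then show "w \<le> L t" using RL[of w t] R[of w] t by simp
      qed (use t False in simp)
    qed (simp add: L_def)
    then show ?thesis using L[OF t] by (simp add: unit_leb.emeasure_eq_measure L_def)
  qed
qed

text \<open>All points with a value above \<open>g x\<close> precede \<open>x\<close>, which yields
  the rearrangement at \<open>ryff g x\<close> as a lower bound for \<open>g x\<close>. Both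
  functions are equimeasurable, so this inequality is an equality almost everywhere.\<close>

lemma ryff_factorization:
  assumes g: "g \<in> Mplus"
  obtains \<sigma> where "measure_preserving01 \<sigma>" "AE x in unit_leb. rearr01 g (\<sigma> x) = g x"
proof -
  \<comment> \<open>The values 0 and 1 of \<open>ryff g\<close> occur only on a null set; there an
    arbitrary interior value is put in their place.\<close>
  define \<sigma> where "\<sigma> x = (if ryff g x \<in> {0<..<1} then ryff g x else 1/2)" for x
  have r0: "0 \<le> ryff g x" for x by (simp add: ryff_def)
  have N: "AE x in unit_leb. \<sigma> x = ryff g x"
  proof -
    have "{x \<in> {0<..<1}. ryff g x \<le> 0} \<in> null_sets unit_leb"
      using ryff_level[OF g, of 0] by auto
    then have 1: "AE x in unit_leb. 0 < ryff g x"
      by (rule AE_I') auto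
    have "emeasure unit_leb (space unit_leb - {x \<in> {0<..<1}. ryff g x < 1}) = emeasure unit_leb (space unit_leb) - emeasure unit_leb {x \<in> {0<..<1}. ryff g x < 1}"
      by (rule emeasure_compl[symmetric, THEN sym]) (use ryff_level[OF g] in auto)
    then have "space unit_leb - {x \<in> {0<..<1}. ryff g x < 1} \<in> null_sets unit_leb"
      using ryff_level[OF g, of 1] by auto
    then have 2: "AE x in unit_leb. ryff g x < 1"
      by (rule AE_I') auto
    from 1 2 show ?thesis by eventually_elim (auto simp: \<sigma>_def)
  qed
  have "measure_preserving01 \<sigma>"
    unfolding measure_preserving01_def
  proof (intro conjI ballI)
    fix x show "\<sigma> x \<in> {0<..<1}" by (auto simp: \<sigma>_def)
  next
    fix t :: real assume t: "t \<in> {0..1}"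
    \<comment> \<open>Measurability of \<open>A\<close> is a conclusion here: it comes from the
      completeness of Lebesgue measure.\<close>
    have sets_eq: "A \<in> sets unit_leb \<and> emeasure unit_leb A = emeasure unit_leb B"
      if "B \<in> sets unit_leb" "A \<subseteq> {0<..<1}" "AE x in unit_leb. x \<in> A \<longleftrightarrow> x \<in> B" for A B
    proof -
      note * = that
      obtain M where M: "M \<in> null_sets unit_leb" "{x \<in> space unit_leb. \<not> (x \<in> A \<longleftrightarrow> x \<in> B)} \<subseteq> M"
        using *(3) by (auto simp: eventually_ae_filter)
      have Bs: "B \<subseteq> {0<..<1}" using *(1) by (simp add: sets_unit_leb)
      have null: "Z \<in> sets unit_leb" if "Z \<subseteq> M" for Z
      proof -
        have "M \<subseteq> {0<..<1}" "emeasure lebesgue M = 0" "M \<in> sets lebesgue"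
          using M(1) by (auto simp: null_sets_def sets_unit_leb emeasure_unit_leb)
        then have "M \<in> null_sets lebesgue" by auto
        then have "Z \<in> sets lebesgue" using that by (meson null_sets_completion_subset null_setsD2)
        then show ?thesis using that \<open>M \<subseteq> {0<..<1}\<close> by (auto simp: sets_unit_leb)
      qed
      have "A - B \<subseteq> {x \<in> space unit_leb. \<not> (x \<in> A \<longleftrightarrow> x \<in> B)}"
        "B - A \<subseteq> {x \<in> space unit_leb. \<not> (x \<in> A \<longleftrightarrow> x \<in> B)}" using *(2) Bs by auto
      then have "A - B \<subseteq> M" "B - A \<subseteq> M" using M(2) by (auto intro: order_trans)
      then have "(A - B) \<in> sets unit_leb" "(B - A) \<in> sets unit_leb" using null by auto
      moreover have "A = (B - (B - A)) \<union> (A - B)" by auto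
      ultimately have "A \<in> sets unit_leb" using *(1) by (metis sets.Diff sets.Un)
      then show ?thesis using * by (auto intro: emeasure_eq_AE)
    qed
    have 1: "{x \<in> {0<..<1}. \<sigma> x < t} \<in> sets unit_leb \<and> emeasure unit_leb {x \<in> {0<..<1}. \<sigma> x < t} = emeasure unit_leb {x \<in> {0<..<1}. ryff g x < t}"
      by (rule sets_eq) (use ryff_level[OF g] N in \<open>auto elim!: eventually_mono\<close>)
    have 2: "{x \<in> {0<..<1}. \<sigma> x \<le> t} \<in> sets unit_leb \<and> emeasure unit_leb {x \<in> {0<..<1}. \<sigma> x \<le> t} = emeasure unit_leb {x \<in> {0<..<1}. ryff g x \<le> t}"
      by (rule sets_eq) (use ryff_level[OF g] N in \<open>auto elim!: eventually_mono\<close>)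
    show "{x \<in> {0<..<1}. \<sigma> x < t} \<in> sets unit_leb" using 1 by simp
    show "{x \<in> {0<..<1}. \<sigma> x \<le> t} \<in> sets unit_leb" using 2 by simp
    show "emeasure unit_leb {x \<in> {0<..<1}. \<sigma> x < t} = ennreal t" using 1 ryff_level(4)[OF g] t by simp
    show "emeasure unit_leb {x \<in> {0<..<1}. \<sigma> x \<le> t} = ennreal t" using 2 ryff_level(3)[OF g] t by simp
  qed
  moreover have "AE x in unit_leb. rearr01 g (\<sigma> x) = g x"
  proof (rule AE_eq_of_dfun_eq)
    show "(\<lambda>x. rearr01 g (\<sigma> x)) \<in> Mplus"
      by (rule antimono_comp_measure_preserving[OF antimono_on_rearr]) fact
    show "dfun (\<lambda>x. rearr01 g (\<sigma> x)) l = dfun g l" for l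
      by (subst antimono_comp_measure_preserving[OF antimono_on_rearr]) (use calculation g in \<open>auto simp: dfun_rearr01\<close>)
    have "rearr01 g (ryff g x) \<le> g x" for x
    proof (rule ccontr)
      assume "\<not> rearr01 g (ryff g x) \<le> g x"
      then have "ennreal (ryff g x) < dfun g (g x)" by (simp add: not_le less_rearr01_iff[OF g])
      also have "\<dots> = ennreal (measure unit_leb {y \<in> {0<..<1}. g x < g y})"
        unfolding dfun_def by (rule unit_leb.emeasure_eq_measure)
      finally have "ryff g x < measure unit_leb {y \<in> {0<..<1}. g x < g y}"
        using r0 by (simp add: ennreal_less_iff)
      also have "\<dots> \<le> ryff g x"
        unfolding ryff_def by (rule unit_leb.finite_measure_mono) (use ryff_sets[OF g] in auto)
      finally show False by simp
    qed
    then show "AE x in unit_leb. rearr01 g (\<sigma> x) \<le> g x"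
      using N by (auto elim!: eventually_mono)
  qed fact
  ultimately show thesis using that by blast
qed

text \<open>The Hardy--Littlewood bound is attained: composing \<open>w\<close> with the Ryff map of
  \<open>f\<close> aligns it with \<open>f\<close> without changing its distribution. This replaces
  an integral of the rearrangement by an integral of \<open>f\<close> itself.\<close>

lemma resonance:
  assumes f: "f \<in> Mplus" and w: "antimono_on {0<..<1} w"
  obtains w' where "w' \<in> Mplus" "\<And>l. dfun w' l = dfun w l"
    "(\<integral>\<^sup>+x. f x * w' x \<partial>unit_leb) = (\<integral>\<^sup>+x. rearr01 f x * w x \<partial>unit_leb)"
proof -
  obtain \<sigma> where s: "measure_preserving01 \<sigma>" "AE x in unit_leb. rearr01 f (\<sigma> x) = f x"
    using ryff_factorization[OF f] .
  note c = antimono_comp_measure_preserving[OF _ s(1)]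
  have anti: "antimono_on {0<..<1} (\<lambda>x. rearr01 f x * w x)"
    using w by (auto simp: monotone_on_def intro!: mult_mono rearr_antimono)
  have "(\<integral>\<^sup>+x. f x * w (\<sigma> x) \<partial>unit_leb) = (\<integral>\<^sup>+x. rearr01 f (\<sigma> x) * w (\<sigma> x) \<partial>unit_leb)"
    by (rule nn_integral_cong_AE) (use s(2) in \<open>auto elim!: eventually_mono\<close>)
  also have "\<dots> = (\<integral>\<^sup>+x. rearr01 f x * w x \<partial>unit_leb)"
    by (rule nn_integral_cong_dfun) (use c[OF anti] antimono_on_Mplus[OF anti] in auto)
  finally show thesis using c[OF w] that by blast
qed

lemma hardy_littlewood_antimono:
  assumes f: "f \<in> Mplus" and w: "antimono_on {0<..<1} w"
    and w': "w' \<in> Mplus" "\<And>l. dfun w' l = dfun w l"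
  shows "(\<integral>\<^sup>+x. f x * w' x \<partial>unit_leb) \<le> (\<integral>\<^sup>+x. rearr01 f x * w x \<partial>unit_leb)"
proof -
  have "(\<integral>\<^sup>+x. f x * w' x \<partial>unit_leb) \<le> (\<integral>\<^sup>+x. rearr01 f x * rearr01 w' x \<partial>unit_leb)"
    by (rule hardy_littlewood[OF f w'(1)])
  also have "rearr01 w' = rearr01 w"
    by (intro ext rearr01_cong w' antimono_on_Mplus[OF w])
  also have "(\<integral>\<^sup>+x. rearr01 f x * rearr01 w x \<partial>unit_leb) \<le> (\<integral>\<^sup>+x. rearr01 f x * w x \<partial>unit_leb)"
    by (intro nn_integral_mono mult_left_mono rearr01_le_antimono w) auto
  finally show ?thesis .
qed

text \<open>Rearrangement is not subadditive pointwise, but its integrals against a decreasing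
  weight are: one \<open>w'\<close> realises the left side for the sum, the integral then splits,
  and Hardy--Littlewood bounds each summand with the same \<open>w'\<close>.\<close>

lemma nn_integral_rearr01_add_le:
  assumes f: "f \<in> Mplus" and g: "g \<in> Mplus" and w: "antimono_on {0<..<1} w"
  shows "(\<integral>\<^sup>+x. rearr01 (\<lambda>x. f x + g x) x * w x \<partial>unit_leb) \<le>
    (\<integral>\<^sup>+x. rearr01 f x * w x \<partial>unit_leb) + (\<integral>\<^sup>+x. rearr01 g x * w x \<partial>unit_leb)"
proof -
  have [measurable]: "f \<in> borel_measurable unit_leb" "g \<in> borel_measurable unit_leb"
    using f g by (auto simp: Mplus_def)
  have "(\<lambda>x. f x + g x) \<in> Mplus" unfolding Mplus_iff by measurable
  then obtain w' where w': "w' \<in> Mplus" "\<And>l. dfun w' l = dfun w l"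
    "(\<integral>\<^sup>+x. (f x + g x) * w' x \<partial>unit_leb) = (\<integral>\<^sup>+x. rearr01 (\<lambda>x. f x + g x) x * w x \<partial>unit_leb)"
    by (rule resonance[OF _ w]) blast
  have [measurable]: "w' \<in> borel_measurable unit_leb" using w' by (auto simp: Mplus_def)
  have "(\<integral>\<^sup>+x. (f x + g x) * w' x \<partial>unit_leb) =
     (\<integral>\<^sup>+x. f x * w' x \<partial>unit_leb) + (\<integral>\<^sup>+x. g x * w' x \<partial>unit_leb)"
    by (subst nn_integral_add[symmetric]) (auto simp: distrib_right)
  also have "\<dots> \<le> (\<integral>\<^sup>+x. rearr01 f x * w x \<partial>unit_leb) + (\<integral>\<^sup>+x. rearr01 g x * w x \<partial>unit_leb)"
    by (intro add_mono hardy_littlewood_antimono f g w w')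
  finally show ?thesis using w' by simp
qed

section \<open>Associate norms\<close>

lemma Mplus_const [simp]: "(\<lambda>_. c) \<in> Mplus"
  by (simp add: Mplus_iff)

lemma Mplus_add: "f \<in> Mplus \<Longrightarrow> g \<in> Mplus \<Longrightarrow> (\<lambda>x. f x + g x) \<in> Mplus"
  by (simp add: Mplus_iff)

lemma Mplus_mult: "f \<in> Mplus \<Longrightarrow> g \<in> Mplus \<Longrightarrow> (\<lambda>x. f x * g x) \<in> Mplus"
  by (simp add: Mplus_iff)

lemma Mplus_min: "f \<in> Mplus \<Longrightarrow> g \<in> Mplus \<Longrightarrow> (\<lambda>x. min (f x) (g x)) \<in> Mplus"
  by (simp add: Mplus_iff)

lemma ri_normD:
  assumes "ri_norm X"
  shows ri_norm_zero_iff: "f \<in> Mplus \<Longrightarrow> X f = 0 \<longleftrightarrow> (AE x in unit_leb. f x = 0)"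
    and ri_norm_cmult: "f \<in> Mplus \<Longrightarrow> 0 \<le> a \<Longrightarrow> X (\<lambda>x. ennreal a * f x) = ennreal a * X f"
    and ri_norm_add: "f \<in> Mplus \<Longrightarrow> g \<in> Mplus \<Longrightarrow> X (\<lambda>x. f x + g x) \<le> X f + X g"
    and ri_norm_mono_AE: "f \<in> Mplus \<Longrightarrow> g \<in> Mplus \<Longrightarrow> AE x in unit_leb. f x \<le> g x \<Longrightarrow> X f \<le> X g"
    and ri_norm_SUP: "(\<And>j::nat. F j \<in> Mplus) \<Longrightarrow> f \<in> Mplus \<Longrightarrow>
        AE x in unit_leb. incseq (\<lambda>j. F j x) \<and> (SUP j. F j x) = f x \<Longrightarrow> (SUP j. X (F j)) = X f"
    and ri_norm_one: "X (\<lambda>_. 1) < \<infinity>"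
    and ri_norm_L1: "\<exists>C::real. \<forall>f\<in>Mplus. (\<integral>\<^sup>+x. f x \<partial>unit_leb) \<le> ennreal C * X f"
    and ri_norm_rearr: "f \<in> Mplus \<Longrightarrow> g \<in> Mplus \<Longrightarrow> (\<And>s. s \<in> {0<..<1} \<Longrightarrow> rearr01 f s = rearr01 g s) \<Longrightarrow> X f = X g"
proof -
  note d = assms[unfolded ri_norm_def]
  note d1 = d[THEN conjunct1]
  note d2 = d[THEN conjunct2, THEN conjunct1]
  note d3 = d[THEN conjunct2, THEN conjunct2, THEN conjunct1]
  note d4 = d[THEN conjunct2, THEN conjunct2, THEN conjunct2, THEN conjunct1]
  note d5 = d[THEN conjunct2, THEN conjunct2, THEN conjunct2, THEN conjunct2, THEN conjunct1]
  note d6 = d[THEN conjunct2, THEN conjunct2, THEN conjunct2, THEN conjunct2, THEN conjunct2, THEN conjunct1]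
  note d7 = d[THEN conjunct2, THEN conjunct2, THEN conjunct2, THEN conjunct2, THEN conjunct2, THEN conjunct2, THEN conjunct1]
  note d8 = d[THEN conjunct2, THEN conjunct2, THEN conjunct2, THEN conjunct2, THEN conjunct2, THEN conjunct2, THEN conjunct2]
  show "f \<in> Mplus \<Longrightarrow> X f = 0 \<longleftrightarrow> (AE x in unit_leb. f x = 0)"
    by (rule d1[rule_format])
  show "f \<in> Mplus \<Longrightarrow> 0 \<le> a \<Longrightarrow> X (\<lambda>x. ennreal a * f x) = ennreal a * X f"
    by (rule d2[rule_format])
  show "f \<in> Mplus \<Longrightarrow> g \<in> Mplus \<Longrightarrow> X (\<lambda>x. f x + g x) \<le> X f + X g"
    by (rule d3[rule_format])
  show "f \<in> Mplus \<Longrightarrow> g \<in> Mplus \<Longrightarrow> AE x in unit_leb. f x \<le> g x \<Longrightarrow> X f \<le> X g"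
    by (rule d4[rule_format])
  show "(\<And>j::nat. F j \<in> Mplus) \<Longrightarrow> f \<in> Mplus \<Longrightarrow> AE x in unit_leb. incseq (\<lambda>j. F j x) \<and> (SUP j. F j x) = f x \<Longrightarrow> (SUP j. X (F j)) = X f"
    by (rule d5[rule_format, THEN conjunct2])
  show "X (\<lambda>_. 1) < \<infinity>"
    by (rule d6)
  show "\<exists>C::real. \<forall>f\<in>Mplus. (\<integral>\<^sup>+x. f x \<partial>unit_leb) \<le> ennreal C * X f"
    by (rule d7)
  show "f \<in> Mplus \<Longrightarrow> g \<in> Mplus \<Longrightarrow> (\<And>s. s \<in> {0<..<1} \<Longrightarrow> rearr01 f s = rearr01 g s) \<Longrightarrow> X f = X g"
    by (rule d8[rule_format])
qed

lemma ri_norm_mono: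
  assumes "ri_norm X" "f \<in> Mplus" "g \<in> Mplus" "\<And>x. x \<in> {0<..<1} \<Longrightarrow> f x \<le> g x"
  shows "X f \<le> X g"
  by (rule ri_norm_mono_AE[OF assms(1-3)]) (use assms(4) in auto)

lemma ri_norm_dfun_cong:
  assumes "ri_norm X" "f \<in> Mplus" "g \<in> Mplus" "\<And>l. dfun f l = dfun g l"
  shows "X f = X g"
  by (rule ri_norm_rearr[OF assms(1-3)]) (rule rearr01_cong[OF assms(2-4)])

lemma ri_norm_rearr01:
  assumes "ri_norm X" "f \<in> Mplus"
  shows "X (rearr01 f) = X f"
  by (rule ri_norm_dfun_cong) (use assms in \<open>auto simp: dfun_rearr01\<close>)

lemma ri_norm_one_pos:
  assumes "ri_norm X"
  obtains c where "0 < c" "X (\<lambda>_. 1) = ennreal c"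
proof -
  have "\<not> (AE x in unit_leb. (1::ennreal) = 0)"
  proof
    assume "AE x in unit_leb. (1::ennreal) = 0"
    then have "AE x in unit_leb. False" by simp
    then have "emeasure unit_leb (space unit_leb) = 0" by (rule emeasure_eq_0_AE[where P="\<lambda>_. True", simplified])
    then show False by simp
  qed
  then have "X (\<lambda>_. 1) \<noteq> 0" using ri_norm_zero_iff[OF assms, of "\<lambda>_. 1"] by simp
  then show thesis using ri_norm_one[OF assms] that by (cases "X (\<lambda>_. 1)") (auto simp: less_le)
qed

lemma associate_norm_upper: "f \<in> Mplus \<Longrightarrow> X f \<le> 1 \<Longrightarrow> (\<integral>\<^sup>+s. f s * g s \<partial>unit_leb) \<le> associate_norm X g"
  unfolding associate_norm_def by (rule SUP_upper) simp

lemma associate_norm_least: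
  "(\<And>f. f \<in> Mplus \<Longrightarrow> X f \<le> 1 \<Longrightarrow> (\<integral>\<^sup>+s. f s * g s \<partial>unit_leb) \<le> B) \<Longrightarrow> associate_norm X g \<le> B"
  unfolding associate_norm_def by (rule SUP_least) auto

lemma associate_norm_mono_AE:
  assumes "AE x in unit_leb. f x \<le> g x"
  shows "associate_norm X f \<le> associate_norm X g"
proof (rule associate_norm_least)
  fix p assume p: "p \<in> Mplus" "X p \<le> 1"
  have "(\<integral>\<^sup>+s. p s * f s \<partial>unit_leb) \<le> (\<integral>\<^sup>+s. p s * g s \<partial>unit_leb)"
    by (rule nn_integral_mono_AE) (use assms in \<open>auto elim!: eventually_mono intro: mult_left_mono\<close>)
  also have "\<dots> \<le> associate_norm X g" using p by (rule associate_norm_upper)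
  finally show "(\<integral>\<^sup>+s. p s * f s \<partial>unit_leb) \<le> associate_norm X g" .
qed

lemma associate_norm_mono:
  assumes "\<And>x. x \<in> {0<..<1} \<Longrightarrow> f x \<le> g x"
  shows "associate_norm X f \<le> associate_norm X g"
  by (rule associate_norm_mono_AE) (use assms in auto)

lemma associate_norm_cong:
  assumes "\<And>x. x \<in> {0<..<1} \<Longrightarrow> f x = g x"
  shows "associate_norm X f = associate_norm X g"
  by (intro antisym associate_norm_mono) (use assms in auto)

lemma associate_norm_cmult:
  assumes "g \<in> Mplus"
  shows "associate_norm X (\<lambda>x. a * g x) = a * associate_norm X g"
proof -
  have "associate_norm X (\<lambda>x. a * g x) = (SUP f\<in>{f \<in> Mplus. X f \<le> 1}. a * (\<integral>\<^sup>+s. f s * g s \<partial>unit_leb))"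
    unfolding associate_norm_def
  proof (rule SUP_cong[OF refl])
    fix f assume "f \<in> {f \<in> Mplus. X f \<le> 1}"
    then have [measurable]: "f \<in> borel_measurable unit_leb" "g \<in> borel_measurable unit_leb"
      using assms by (auto simp: Mplus_iff)
    show "(\<integral>\<^sup>+s. f s * (a * g s) \<partial>unit_leb) = a * (\<integral>\<^sup>+s. f s * g s \<partial>unit_leb)"
      by (subst nn_integral_cmult[symmetric]) (auto simp: mult_ac)
  qed
  then show ?thesis
    by (simp add: SUP_mult_left_ennreal associate_norm_def)
qed

text \<open>The constant function \<open>1 / c\<close> has norm one and serves as test function. The
  bound yields both (P5) and the definiteness of the associate norm.\<close>

lemma nn_integral_le_associate_norm:
  assumes X: "ri_norm X" and c: "0 < c" "X (\<lambda>_. 1) = ennreal c" and g: "g \<in> Mplus"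
  shows "(\<integral>\<^sup>+x. g x \<partial>unit_leb) \<le> ennreal c * associate_norm X g"
proof -
  have "X (\<lambda>_. ennreal (1 / c) * 1) = ennreal (1 / c) * X (\<lambda>_. 1)"
    by (rule ri_norm_cmult[OF X]) (use c in auto)
  also have "\<dots> = 1" using c by (simp add: ennreal_mult[symmetric] ennreal_1[symmetric] del: ennreal_1)
  finally have "(\<integral>\<^sup>+x. ennreal (1 / c) * g x \<partial>unit_leb) \<le> associate_norm X g"
    by (intro associate_norm_upper) auto
  then have *: "ennreal (1 / c) * (\<integral>\<^sup>+x. g x \<partial>unit_leb) \<le> associate_norm X g"
    using g by (simp add: nn_integral_cmult Mplus_iff)
  have "(\<integral>\<^sup>+x. g x \<partial>unit_leb) = ennreal c * (ennreal (1 / c) * (\<integral>\<^sup>+x. g x \<partial>unit_leb))"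
    using c by (simp add: ennreal_mult[symmetric] mult.assoc[symmetric])
  also have "\<dots> \<le> ennreal c * associate_norm X g" using * by (rule mult_left_mono) simp
  finally show ?thesis .
qed

lemma associate_norm_eq_0_iff:
  assumes X: "ri_norm X" and g: "g \<in> Mplus"
  shows "associate_norm X g = 0 \<longleftrightarrow> (AE x in unit_leb. g x = 0)"
proof
  obtain c where c: "0 < c" "X (\<lambda>_. 1) = ennreal c" using ri_norm_one_pos[OF X] .
  assume "associate_norm X g = 0"
  then have "(\<integral>\<^sup>+x. g x \<partial>unit_leb) = 0" using nn_integral_le_associate_norm[OF X c g] by simp
  then show "AE x in unit_leb. g x = 0" using g by (simp add: nn_integral_0_iff_AE Mplus_iff)
next
  assume "AE x in unit_leb. g x = 0"
  then have "associate_norm X g \<le> associate_norm X (\<lambda>_. 0)"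
    by (intro associate_norm_mono_AE) (auto elim!: eventually_mono)
  also have "associate_norm X (\<lambda>_. 0) \<le> 0" by (rule associate_norm_least) simp
  finally show "associate_norm X g = 0" by simp
qed

lemma associate_norm_SUP:
  assumes F: "\<And>j. F j \<in> Mplus" and f: "f \<in> Mplus"
    and lim: "AE x in unit_leb. incseq (\<lambda>j::nat. F j x) \<and> (SUP j. F j x) = f x"
  shows "incseq (\<lambda>j. associate_norm X (F j))" "(SUP j. associate_norm X (F j)) = associate_norm X f"
proof -
  show "incseq (\<lambda>j. associate_norm X (F j))"
    by (intro incseq_SucI associate_norm_mono_AE, use lim in eventually_elim) (auto simp: incseq_def)
  have "(\<integral>\<^sup>+s. p s * f s \<partial>unit_leb) = (SUP j. \<integral>\<^sup>+s. p s * F j s \<partial>unit_leb)" if "p \<in> Mplus" for p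
  proof -
    have [measurable]: "p \<in> borel_measurable unit_leb" "\<And>j. F j \<in> borel_measurable unit_leb"
      using that F by (auto simp: Mplus_iff)
    have "(\<integral>\<^sup>+s. p s * f s \<partial>unit_leb) = (\<integral>\<^sup>+s. (SUP j. p s * F j s) \<partial>unit_leb)"
      by (rule nn_integral_cong_AE, use lim in eventually_elim) (simp add: SUP_mult_left_ennreal[symmetric])
    also have "\<dots> = (SUP j. \<integral>\<^sup>+s. p s * F j s \<partial>unit_leb)"
      by (rule nn_integral_monotone_convergence_SUP_AE, use lim in eventually_elim)
        (auto simp: incseq_def intro: mult_left_mono)
    finally show ?thesis .
  qed
  then have "associate_norm X f = (SUP p\<in>{f \<in> Mplus. X f \<le> 1}. SUP j. \<integral>\<^sup>+s. p s * F j s \<partial>unit_leb)"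
    unfolding associate_norm_def by (intro SUP_cong) auto
  also have "\<dots> = (SUP j. associate_norm X (F j))"
    unfolding associate_norm_def by (rule SUP_commute)
  finally show "(SUP j. associate_norm X (F j)) = associate_norm X f" ..
qed

lemma associate_norm_add:
  assumes "f \<in> Mplus" "g \<in> Mplus"
  shows "associate_norm X (\<lambda>x. f x + g x) \<le> associate_norm X f + associate_norm X g"
proof (rule associate_norm_least)
  fix p assume p: "p \<in> Mplus" "X p \<le> 1"
  then have [measurable]: "p \<in> borel_measurable unit_leb" "f \<in> borel_measurable unit_leb" "g \<in> borel_measurable unit_leb"
    using assms by (auto simp: Mplus_iff)
  have "(\<integral>\<^sup>+s. p s * (f s + g s) \<partial>unit_leb) = (\<integral>\<^sup>+s. p s * f s \<partial>unit_leb) + (\<integral>\<^sup>+s. p s * g s \<partial>unit_leb)"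
    by (subst nn_integral_add[symmetric]) (auto simp: distrib_left)
  also have "\<dots> \<le> associate_norm X f + associate_norm X g"
    by (intro add_mono associate_norm_upper p)
  finally show "(\<integral>\<^sup>+s. p s * (f s + g s) \<partial>unit_leb) \<le> associate_norm X f + associate_norm X g" .
qed

text \<open>A test function \<open>p\<close> for \<open>f\<close> is replaced by an equimeasurable
  \<open>p'\<close> aligned with \<open>g\<close>; it has the same norm by (P6), and no smaller
  pairing.\<close>

lemma associate_norm_dfun_cong:
  assumes X: "ri_norm X" and f: "f \<in> Mplus" and g: "g \<in> Mplus" and eq: "\<And>l. dfun f l = dfun g l"
  shows "associate_norm X f = associate_norm X g"
proof -
  have *: "associate_norm X f \<le> associate_norm X g"
    if f: "f \<in> Mplus" and g: "g \<in> Mplus" and eq: "\<And>l. dfun f l = dfun g l" for f g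
  proof (rule associate_norm_least)
    fix p assume p: "p \<in> Mplus" "X p \<le> 1"
    obtain p' where p': "p' \<in> Mplus" "\<And>l. dfun p' l = dfun (rearr01 p) l"
       "(\<integral>\<^sup>+x. g x * p' x \<partial>unit_leb) = (\<integral>\<^sup>+x. rearr01 g x * rearr01 p x \<partial>unit_leb)"
      by (rule resonance[OF g antimono_on_rearr]) blast
    have "X p' = X p" by (rule ri_norm_dfun_cong[OF X]) (use p p' in \<open>auto simp: dfun_rearr01\<close>)
    have "(\<integral>\<^sup>+x. p x * f x \<partial>unit_leb) \<le> (\<integral>\<^sup>+x. rearr01 p x * rearr01 f x \<partial>unit_leb)"
      by (rule hardy_littlewood[OF p(1) f])
    also have "rearr01 f = rearr01 g" by (intro ext rearr01_cong f g eq)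
    also have "(\<integral>\<^sup>+x. rearr01 p x * rearr01 g x \<partial>unit_leb) = (\<integral>\<^sup>+x. p' x * g x \<partial>unit_leb)"
      using p'(3) by (simp add: mult.commute)
    also have "\<dots> \<le> associate_norm X g" by (rule associate_norm_upper) (use p p' \<open>X p' = X p\<close> in auto)
    finally show "(\<integral>\<^sup>+x. p x * f x \<partial>unit_leb) \<le> associate_norm X g" .
  qed
  show ?thesis using *[OF f g eq] *[OF g f] eq by (auto intro: antisym)
qed

lemma dfun_cong_of_rearr01:
  assumes f: "f \<in> Mplus" and g: "g \<in> Mplus" and eq: "\<And>s. s \<in> {0<..<1} \<Longrightarrow> rearr01 f s = rearr01 g s"
  shows "dfun f l = dfun g l"
proof -
  have "dfun (rearr01 f) l = dfun (rearr01 g) l"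
    unfolding dfun_def by (rule arg_cong[where f="emeasure unit_leb"]) (use eq in auto)
  then show ?thesis by (simp add: dfun_rearr01 f g)
qed

text \<open>Duality exchanges (P4) and (P5): the constant \<open>C\<close> of (P5) for
  \<open>X\<close> bounds the associate norm of 1, and the norm \<open>c\<close> of 1 in
  \<open>X\<close> is the constant of (P5) for the associate norm.\<close>

theorem ri_norm_associate:
  assumes X: "ri_norm X"
  shows "ri_norm (associate_norm X)"
proof -
  obtain c where c: "0 < c" "X (\<lambda>_. 1) = ennreal c" using ri_norm_one_pos[OF X] .
  obtain C where C: "\<And>f. f \<in> Mplus \<Longrightarrow> (\<integral>\<^sup>+x. f x \<partial>unit_leb) \<le> ennreal C * X f"
    using ri_norm_L1[OF X] by blast
  have one: "associate_norm X (\<lambda>_. 1) \<le> ennreal C"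
  proof (rule associate_norm_least)
    fix p assume p: "p \<in> Mplus" "X p \<le> 1"
    have "ennreal C * X p \<le> ennreal C * 1" by (rule mult_left_mono) (use p in auto)
    then show "(\<integral>\<^sup>+s. p s * 1 \<partial>unit_leb) \<le> ennreal C" using C[OF p(1)] by simp
  qed
  show ?thesis
    unfolding ri_norm_def
  proof (intro conjI)
    show "\<forall>f\<in>Mplus. (associate_norm X f = 0) = (AE x in unit_leb. f x = 0)"
      using associate_norm_eq_0_iff[OF X] by blast
    show "\<forall>f\<in>Mplus. \<forall>a\<ge>0. associate_norm X (\<lambda>x. ennreal a * f x) = ennreal a * associate_norm X f"
      using associate_norm_cmult by blast
    show "\<forall>f\<in>Mplus. \<forall>g\<in>Mplus. associate_norm X (\<lambda>x. f x + g x) \<le> associate_norm X f + associate_norm X g"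
      using associate_norm_add by blast
    show "\<forall>f\<in>Mplus. \<forall>g\<in>Mplus. (AE x in unit_leb. f x \<le> g x) \<longrightarrow> associate_norm X f \<le> associate_norm X g"
      using associate_norm_mono_AE by blast
    show "\<forall>F f. (\<forall>j::nat. F j \<in> Mplus) \<longrightarrow> f \<in> Mplus \<longrightarrow>
        (AE x in unit_leb. incseq (\<lambda>j. F j x) \<and> (SUP j. F j x) = f x) \<longrightarrow>
        incseq (\<lambda>j. associate_norm X (F j)) \<and> (SUP j. associate_norm X (F j)) = associate_norm X f"
      by (intro allI impI conjI associate_norm_SUP) blast+
    show "associate_norm X (\<lambda>_. 1) < \<infinity>" using one by (simp add: le_less_trans)
    show "\<exists>C::real. \<forall>f\<in>Mplus. (\<integral>\<^sup>+x. f x \<partial>unit_leb) \<le> ennreal C * associate_norm X f"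
      using nn_integral_le_associate_norm[OF X c] by blast
    show "\<forall>f\<in>Mplus. \<forall>g\<in>Mplus. (\<forall>s\<in>{0<..<1}. rearr01 f s = rearr01 g s) \<longrightarrow> associate_norm X f = associate_norm X g"
      by (intro ballI impI associate_norm_dfun_cong[OF X] dfun_cong_of_rearr01) auto
  qed
qed

lemma hoelder_associate:
  assumes X: "ri_norm X" and f: "f \<in> Mplus" and g: "g \<in> Mplus"
  shows "(\<integral>\<^sup>+x. f x * g x \<partial>unit_leb) \<le> X f * associate_norm X g"
proof -
  \<comment> \<open>Scaling \<open>f\<close> to norm one requires a positive finite norm. With
    \<open>0 * top = 0\<close> in \<open>ennreal\<close>, an infinite norm makes the right side
    infinite only if the other factor is nonzero.\<close>
  consider "AE x in unit_leb. f x * g x = 0" | "X f = top" "associate_norm X g \<noteq> 0"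
    | c where "0 < c" "X f = ennreal c"
  proof (cases "X f = 0 \<or> associate_norm X g = 0")
    case True
    then have "(AE x in unit_leb. f x = 0) \<or> (AE x in unit_leb. g x = 0)"
      using ri_norm_zero_iff[OF X f] associate_norm_eq_0_iff[OF X g] by auto
    then have "AE x in unit_leb. f x * g x = 0" by (auto elim!: eventually_mono)
    then show thesis by (rule that(1))
  next
    case False
    then show thesis using that(2,3) by (cases "X f") (auto simp: less_le)
  qed
  then show ?thesis
  proof cases
    case 1
    then have "(\<integral>\<^sup>+x. f x * g x \<partial>unit_leb) = (\<integral>\<^sup>+x. 0 \<partial>unit_leb)" by (rule nn_integral_cong_AE)
    then show ?thesis by simp
  next
    case 2
    then show ?thesis by (simp add: ennreal_top_mult)
  next
    case 3
    have "X (\<lambda>x. ennreal (1 / c) * f x) = ennreal (1 / c) * X f"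
      by (rule ri_norm_cmult[OF X f]) (use 3 in auto)
    also have "\<dots> = 1" using 3 by (simp add: ennreal_mult[symmetric] ennreal_1[symmetric] del: ennreal_1)
    finally have "(\<integral>\<^sup>+x. (ennreal (1 / c) * f x) * g x \<partial>unit_leb) \<le> associate_norm X g"
      by (intro associate_norm_upper) (use f in \<open>auto simp: Mplus_iff\<close>)
    then have *: "ennreal (1 / c) * (\<integral>\<^sup>+x. f x * g x \<partial>unit_leb) \<le> associate_norm X g"
      using f g by (simp add: nn_integral_cmult[symmetric] Mplus_iff mult.assoc)
    have "(\<integral>\<^sup>+x. f x * g x \<partial>unit_leb) = ennreal c * (ennreal (1 / c) * (\<integral>\<^sup>+x. f x * g x \<partial>unit_leb))"
      using 3 by (simp add: ennreal_mult[symmetric] mult.assoc[symmetric])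
    also have "\<dots> \<le> ennreal c * associate_norm X g" using * by (rule mult_left_mono) simp
    finally show ?thesis using 3 by simp
  qed
qed

lemma associate_norm_twice_le:
  assumes "ri_norm X" "f \<in> Mplus"
  shows "associate_norm (associate_norm X) f \<le> X f"
proof (rule associate_norm_least)
  fix p assume p: "p \<in> Mplus" "associate_norm X p \<le> 1"
  have "(\<integral>\<^sup>+s. p s * f s \<partial>unit_leb) = (\<integral>\<^sup>+s. f s * p s \<partial>unit_leb)" by (simp add: mult.commute)
  also have "\<dots> \<le> X f * associate_norm X p" by (rule hoelder_associate) (use assms p in auto)
  also have "\<dots> \<le> X f * 1" by (rule mult_left_mono) (use p in auto)
  finally show "(\<integral>\<^sup>+s. p s * f s \<partial>unit_leb) \<le> X f" by simp
qed

section \<open>The Lorentz--Luxemburg theorem\<close>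

lemma bounded_integrable_unit_leb:
  fixes u :: "real \<Rightarrow> real"
  assumes "u \<in> borel_measurable unit_leb" "\<And>x. \<bar>u x\<bar> \<le> B"
  shows "integrable unit_leb u"
  by (rule unit_leb.integrable_const_bound[where B=B]) (use assms in auto)

text \<open>The unit ball is convex and, by Fatou's property, closed under a.e. limits, so a bounded
  function outside it has a nearest point in the ball with respect to the \<open>L\<^sup>2\<close> distance;
  the difference is the separating functional.\<close>

lemma separation_from_unit_ball:
  fixes F :: "real \<Rightarrow> real"
  assumes Y: "ri_norm Y" and F [measurable]: "F \<in> borel_measurable unit_leb"
    and F0: "\<And>x. 0 \<le> F x" and FM: "\<And>x. F x \<le> M"
    and F1: "1 < Y (\<lambda>x. ennreal (F x))"
  obtains g where "g \<in> Mplus" "associate_norm Y g \<le> 1" "1 < (\<integral>\<^sup>+x. ennreal (F x) * g x \<partial>unit_leb)"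
proof -
  have M0: "0 \<le> M" using F0[of 0] FM[of 0] by linarith
  \<comment> \<open>Only members of the unit ball below \<open>F\<close> compete: they are bounded,
    so all square integrals are finite. Nothing is lost, as truncating at \<open>F\<close> never
    increases the distance to \<open>F\<close>.\<close>
  define R where "R = {p \<in> borel_measurable unit_leb. (\<forall>x. 0 \<le> p x \<and> p x \<le> F x) \<and> Y (\<lambda>x. ennreal (p x)) \<le> 1}"
  define D where "D p = (\<integral>x. (F x - p x)\<^sup>2 \<partial>unit_leb)" for p
  define d where "d = Inf (D ` R)"
  have Mp: "(\<lambda>x. ennreal (p x)) \<in> Mplus" if "p \<in> borel_measurable unit_leb" for p :: "real \<Rightarrow> real"
    using that by (simp add: Mplus_iff)
  have bddD: "bdd_below (D ` R)" by (rule bdd_belowI[of _ 0]) (auto simp: D_def)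
  have d_le: "d \<le> D p" if "p \<in> R" for p unfolding d_def by (rule cInf_lower) (use that bddD in auto)
  have sq_bound: "\<bar>(a - b)\<^sup>2\<bar> \<le> K\<^sup>2" if "0 \<le> a" "a \<le> K" "0 \<le> b" "b \<le> K" for a b K :: real
    using that by (simp add: abs_le_square_iff[symmetric])
  have Rm [measurable]: "p \<in> borel_measurable unit_leb" if "p \<in> R" for p using that unfolding R_def by blast
  have Rb: "0 \<le> p x" "p x \<le> F x" "p x \<le> M" if "p \<in> R" for p x
  proof -
    show "0 \<le> p x" "p x \<le> F x" using that unfolding R_def by blast+
    then show "p x \<le> M" using FM[of x] by linarith
  qed
  have Y0: "Y (\<lambda>_. 0) = 0" using ri_norm_zero_iff[OF Y, of "\<lambda>_. 0"] by simp
  have RI: "p \<in> R" if "p \<in> borel_measurable unit_leb" "\<And>x. 0 \<le> p x" "\<And>x. p x \<le> F x"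
    "Y (\<lambda>x. ennreal (p x)) \<le> 1" for p
    using that unfolding R_def by blast
  have RY: "Y (\<lambda>x. ennreal (p x)) \<le> 1" if "p \<in> R" for p using that unfolding R_def by blast
  have zR: "(\<lambda>_. 0) \<in> R" by (rule RI) (simp_all add: F0 Y0)
  have conv: "Y (\<lambda>x. ennreal ((1 - l) * p x + l * q x)) \<le> 1"
    if p: "p \<in> borel_measurable unit_leb" "\<And>x. 0 \<le> p x" "Y (\<lambda>x. ennreal (p x)) \<le> 1"
    and q: "q \<in> borel_measurable unit_leb" "\<And>x. 0 \<le> q x" "Y (\<lambda>x. ennreal (q x)) \<le> 1"
    and l: "0 \<le> l" "l \<le> 1" for p q :: "real \<Rightarrow> real" and l
  proof -
    have "Y (\<lambda>x. ennreal ((1 - l) * p x + l * q x)) =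
       Y (\<lambda>x. ennreal (1 - l) * ennreal (p x) + ennreal l * ennreal (q x))"
    proof (intro arg_cong[where f=Y] ext)
      fix x
      show "ennreal ((1 - l) * p x + l * q x) = ennreal (1 - l) * ennreal (p x) + ennreal l * ennreal (q x)"
        using p(2)[of x] q(2)[of x] l by (simp add: ennreal_plus ennreal_mult)
    qed
    also have "\<dots> \<le> Y (\<lambda>x. ennreal (1 - l) * ennreal (p x)) + Y (\<lambda>x. ennreal l * ennreal (q x))"
      by (rule ri_norm_add[OF Y]) (use p q in \<open>auto intro!: Mplus_mult Mp\<close>)
    also have "\<dots> = ennreal (1 - l) * Y (\<lambda>x. ennreal (p x)) + ennreal l * Y (\<lambda>x. ennreal (q x))"
      using p(1) q(1) l by (subst (1 2) ri_norm_cmult[OF Y]) (auto simp: Mp)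
    also have "\<dots> \<le> ennreal (1 - l) * 1 + ennreal l * 1"
      by (intro add_mono mult_left_mono p q) auto
    also have "\<dots> = 1" using l by (simp add: ennreal_plus[symmetric] del: ennreal_plus)
    finally show ?thesis .
  qed
  have intb: "integrable unit_leb (\<lambda>x. (u x - v x)\<^sup>2)"
    if "u \<in> borel_measurable unit_leb" "v \<in> borel_measurable unit_leb"
      "\<And>x. 0 \<le> u x" "\<And>x. u x \<le> K" "\<And>x. 0 \<le> v x" "\<And>x. v x \<le> K" for u v :: "real \<Rightarrow> real" and K
    by (rule bounded_integrable_unit_leb[where B="K\<^sup>2"]) (use that sq_bound in auto)
  note intR = intb[where K=M, OF _ _ F0 FM]

  \<comment> \<open>The rate \<open>(1/16)^n\<close> is fast enough to make consecutive
    \<open>L\<^sup>1\<close> distances summable, so that the minimising sequence itself converges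
    almost everywhere, without passing to a subsequence.\<close>
  have "\<exists>p\<in>R. D p \<le> d + (1/16)^n" for n
  proof -
    have "Inf (D ` R) < d + (1/16)^n" by (simp add: d_def)
    then show ?thesis using cInf_lessD[of "D ` R" "d + (1/16)^n"] zR by (auto intro: less_imp_le)
  qed
  then obtain p where p: "\<And>n. p n \<in> R" "\<And>n. D (p n) \<le> d + (1/16)^n" by metis
  have pm [measurable]: "p n \<in> borel_measurable unit_leb" for n using p(1) Rm by blast

  have diff_bound: "\<bar>p n x - p (Suc n) x\<bar> \<le> M" for n x
    using Rb(1,3)[OF p(1), of n x] Rb(1,3)[OF p(1), of "Suc n" x] by linarith
  have close: "(\<integral>x. \<bar>p n x - p (Suc n) x\<bar> \<partial>unit_leb) \<le> 5 * (1/4)^n" for n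
  proof -
    let ?m = "\<lambda>x. (1 - 1/2) * p n x + 1/2 * p (Suc n) x"
    have mR: "?m \<in> R"
      proof (rule RI)
      show "?m \<in> borel_measurable unit_leb" by measurable
      show "Y (\<lambda>x. ennreal (?m x)) \<le> 1"
        by (rule conv) (use Rb(1)[OF p(1)] RY[OF p(1)] in auto)
      fix x show "0 \<le> ?m x" "?m x \<le> F x"
        using Rb[OF p(1), of n x] Rb[OF p(1), of "Suc n" x] by (auto simp: field_simps)
    qed
    have int1: "integrable unit_leb (\<lambda>x. (F x - p n x)\<^sup>2)" for n
      by (rule intR) (use Rb[OF p(1)] in auto)
    have int2: "integrable unit_leb (\<lambda>x. (F x - ?m x)\<^sup>2)"
      by (rule intR) (use Rb[OF mR] in auto)
    have int3: "integrable unit_leb (\<lambda>x. (p n x - p (Suc n) x)\<^sup>2)"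
      by (rule intb[where K=M]) (use Rb[OF p(1)] in auto)
    \<comment> \<open>Parallelogram law; the midpoint \<open>?m\<close> lies in \<open>R\<close>,
      hence its distance is at least \<open>d\<close> and the \<open>d\<close> terms cancel.\<close>
    have "(\<integral>x. (p n x - p (Suc n) x)\<^sup>2 \<partial>unit_leb) =
       (\<integral>x. 2 * (F x - p n x)\<^sup>2 + 2 * (F x - p (Suc n) x)\<^sup>2 - 4 * (F x - ?m x)\<^sup>2 \<partial>unit_leb)"
      by (rule Bochner_Integration.integral_cong) (auto simp: power2_eq_square field_simps)
    also have "\<dots> = 2 * D (p n) + 2 * D (p (Suc n)) - 4 * D ?m"
      unfolding D_def using int1 int2 by (simp del: mult_minus_right)
    also have "\<dots> \<le> 4 * (1/16)^n"
    proof -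
      have "(1/16::real)^(Suc n) \<le> (1/16)^n" by (rule power_decreasing) auto
      then show ?thesis using p(2)[of n] p(2)[of "Suc n"] d_le[OF mR] by linarith
    qed
    finally have sq: "(\<integral>x. (p n x - p (Suc n) x)\<^sup>2 \<partial>unit_leb) \<le> 4 * (1/16)^n" .
    \<comment> \<open>Turns the square bound into an \<open>L\<^sup>1\<close> bound. The weight
      \<open>4^n\<close> balances \<open>4 * (1/16)^n\<close> against the additive term
      \<open>(1/4)^n\<close>.\<close>
    have amgm: "\<bar>t\<bar> \<le> 4^n * t\<^sup>2 + (1/4)^n" for t :: real
    proof -
      have "0 \<le> (2^n * \<bar>t\<bar> - (1/2)^n)\<^sup>2" by simp
      also have "\<dots> = 4^n * t\<^sup>2 + (1/4)^n - 2 * \<bar>t\<bar>"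
      proof -
        have "(2::real)^n * (1/2)^n = 1" by (simp add: power_mult_distrib[symmetric])
        moreover have "((2::real)^n)\<^sup>2 = 4^n" "((1/2::real)^n)\<^sup>2 = (1/4)^n"
          by (simp_all add: power_mult[symmetric] mult.commute[of n] power_mult power_divide)
        ultimately show ?thesis by (simp add: power2_diff power_mult_distrib mult.assoc mult.left_commute)
      qed
      finally show ?thesis by simp
    qed
    have "(\<integral>x. \<bar>p n x - p (Suc n) x\<bar> \<partial>unit_leb) \<le>
       (\<integral>x. 4^n * (p n x - p (Suc n) x)\<^sup>2 + (1/4)^n \<partial>unit_leb)"
    proof (rule integral_mono)
      show "integrable unit_leb (\<lambda>x. \<bar>p n x - p (Suc n) x\<bar>)"
        by (rule bounded_integrable_unit_leb[where B="M"]) (auto intro: diff_bound)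
      show "integrable unit_leb (\<lambda>x. 4^n * (p n x - p (Suc n) x)\<^sup>2 + (1/4)^n)"
        using int3 by auto
    qed (rule amgm)
    also have "\<dots> = 4^n * (\<integral>x. (p n x - p (Suc n) x)\<^sup>2 \<partial>unit_leb) + (1/4)^n"
      using int3 by (simp add: measure_def)
    also have "\<dots> \<le> 4^n * (4 * (1/16)^n) + (1/4)^n"
      by (intro add_right_mono mult_left_mono sq) auto
    also have "\<dots> = 5 * (1/4)^n"
    proof -
      have "(4::real)^n * (1/16)^n = (1/4)^n" by (simp add: power_mult_distrib[symmetric])
      then show ?thesis by simp
    qed
    finally show ?thesis .
  qed
  have lim_ae: "AE x in unit_leb. convergent (\<lambda>n. p n x)"
  proof -
    have "(\<integral>\<^sup>+x. (\<Sum>n. ennreal \<bar>p n x - p (Suc n) x\<bar>) \<partial>unit_leb) =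
       (\<Sum>n. \<integral>\<^sup>+x. ennreal \<bar>p n x - p (Suc n) x\<bar> \<partial>unit_leb)"
      by (rule nn_integral_suminf) measurable
    also have "\<dots> \<le> (\<Sum>n. ennreal (5 * (1/4)^n))"
    proof (rule suminf_le)
      fix n
      have "integrable unit_leb (\<lambda>x. \<bar>p n x - p (Suc n) x\<bar>)"
        by (rule bounded_integrable_unit_leb[where B="M"]) (auto intro: diff_bound)
      then show "(\<integral>\<^sup>+x. ennreal \<bar>p n x - p (Suc n) x\<bar> \<partial>unit_leb) \<le> ennreal (5 * (1/4)^n)"
        using close[of n] by (subst nn_integral_eq_integral) (auto intro: ennreal_leI)
    qed auto
    also have "\<dots> < top"
    proof -
      have "summable (\<lambda>n. 5 * (1/4::real)^n)" by (intro summable_mult summable_geometric) auto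
      then have "(\<Sum>n. ennreal (5 * (1/4)^n)) = ennreal (\<Sum>n. 5 * (1/4)^n)"
        by (intro suminf_ennreal2) auto
      then show ?thesis by simp
    qed
    finally have "AE x in unit_leb. (\<Sum>n. ennreal \<bar>p n x - p (Suc n) x\<bar>) \<noteq> \<infinity>"
      by (intro nn_integral_noteq_infinite) auto
    then show ?thesis
    proof eventually_elim
      case (elim x)
      then have "summable (\<lambda>n. \<bar>p n x - p (Suc n) x\<bar>)"
        by (intro summable_suminf_not_top) auto
      then have "summable (\<lambda>n. p n x - p (Suc n) x)" by (rule summable_rabs_cancel)
      then have "convergent (\<lambda>n. \<Sum>i<n. p i x - p (Suc i) x)" by (simp add: summable_iff_convergent)
      then have "convergent (\<lambda>n. p 0 x - (\<Sum>i<n. p i x - p (Suc i) x))"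
        by (intro convergent_diff convergent_const)
      moreover have "p 0 x - (\<Sum>i<n. p i x - p (Suc i) x) = p n x" for n
        by (induction n) auto
      ultimately show ?case by simp
    qed
  qed
  \<comment> \<open>Clipping to the range from 0 to \<open>F\<close> makes the bounds hold
    everywhere, also at points where the sequence diverges.\<close>
  define q where "q x = max 0 (min (F x) (lim (\<lambda>n. p n x)))" for x
  have qm [measurable]: "q \<in> borel_measurable unit_leb"
    unfolding q_def by measurable
  have qb: "0 \<le> q x" "q x \<le> F x" "q x \<le> M" for x using F0[of x] FM[of x] by (auto simp: q_def)
  have lim_q: "AE x in unit_leb. (\<lambda>n. p n x) \<longlonglongrightarrow> q x"
    using lim_ae
  proof eventually_elim
    case (elim x)
    then have l: "(\<lambda>n. p n x) \<longlonglongrightarrow> lim (\<lambda>n. p n x)" by (simp add: convergent_LIMSEQ_iff)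
    have "0 \<le> lim (\<lambda>n. p n x)" by (rule LIMSEQ_le_const[OF l]) (use Rb[OF p(1)] in auto)
    moreover have "lim (\<lambda>n. p n x) \<le> F x" by (rule LIMSEQ_le_const2[OF l]) (use Rb[OF p(1)] in auto)
    ultimately show ?case using l by (simp add: q_def)
  qed
  have qY: "Y (\<lambda>x. ennreal (q x)) \<le> 1"
  proof -
    \<comment> \<open>Fatou's argument: the tail infima increase to \<open>q\<close> almost
      everywhere and each lies below a member of the ball, so (P3) applies.\<close>
    define r where "r k x = (INF n\<in>{k..}. ennreal (p n x))" for k :: nat and x
    have rm: "r k \<in> Mplus" for k
      unfolding Mplus_iff r_def[abs_def] by (rule borel_measurable_INF) auto
    have "(SUP k. Y (r k)) = Y (\<lambda>x. ennreal (q x))"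
    proof (rule ri_norm_SUP[OF Y rm Mp[OF qm]])
      show "AE x in unit_leb. incseq (\<lambda>k. r k x) \<and> (SUP k. r k x) = ennreal (q x)"
        using lim_q
      proof eventually_elim
        case (elim x)
        have "incseq (\<lambda>k. r k x)" unfolding r_def incseq_def by (auto intro!: INF_superset_mono)
        moreover have "(SUP k. r k x) = liminf (\<lambda>n. ennreal (p n x))"
          unfolding r_def liminf_SUP_INF by simp
        moreover have "liminf (\<lambda>n. ennreal (p n x)) = ennreal (q x)"
          by (rule lim_imp_Liminf) (use elim Rb[OF p(1)] in \<open>auto intro!: tendsto_ennrealI\<close>)
        ultimately show ?case by simp
      qed
    qed
    moreover have "Y (r k) \<le> 1" for k
    proof -
      have "Y (r k) \<le> Y (\<lambda>x. ennreal (p k x))"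
        by (rule ri_norm_mono[OF Y rm Mp]) (auto simp: r_def intro!: INF_lower)
      also have "\<dots> \<le> 1" by (rule RY[OF p(1)])
      finally show ?thesis .
    qed
    ultimately show ?thesis by (metis SUP_least)
  qed
  have Dq: "D q \<le> d"
  proof -
    have "(\<lambda>n. D (p n)) \<longlonglongrightarrow> D q"
      unfolding D_def
    proof (rule integral_dominated_convergence[where w="\<lambda>_. M\<^sup>2"])
      show "AE x in unit_leb. (\<lambda>n. (F x - p n x)\<^sup>2) \<longlonglongrightarrow> (F x - q x)\<^sup>2"
        using lim_q by eventually_elim (intro tendsto_intros)
      show "AE x in unit_leb. norm ((F x - p n x)\<^sup>2) \<le> M\<^sup>2" for n
        using sq_bound[OF F0 FM Rb(1,3)[OF p(1)]] by simp
    qed auto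
    moreover have "(\<lambda>n. d + (1/16)^n) \<longlonglongrightarrow> d + 0"
      by (intro tendsto_intros LIMSEQ_realpow_zero) auto
    ultimately show ?thesis using LIMSEQ_le[of "\<lambda>n. D (p n)" "D q" "\<lambda>n. d + (1/16)^n" d] p(2) by auto
  qed
  define g where "g x = F x - q x" for x
  have gm [measurable]: "g \<in> borel_measurable unit_leb" unfolding g_def[abs_def] by measurable
  have gb: "0 \<le> g x" "g x \<le> M" for x using qb[of x] FM[of x] by (auto simp: g_def)
  have int_mult: "integrable unit_leb (\<lambda>x. u x * v x)"
    if "u \<in> borel_measurable unit_leb" "v \<in> borel_measurable unit_leb"
      "\<And>x. 0 \<le> u x" "\<And>x. u x \<le> K" "\<And>x. 0 \<le> v x" "\<And>x. v x \<le> K'" for u v :: "real \<Rightarrow> real" and K K'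
    by (rule bounded_integrable_unit_leb[where B="K * K'"])
      (use that in \<open>auto simp: abs_mult abs_of_nonneg intro!: mult_mono intro: order_trans\<close>)
  define \<kappa> where "\<kappa> = (\<integral>x. g x * q x \<partial>unit_leb)"
  \<comment> \<open>The first-order condition at the minimiser: \<open>q\<close> maximises the
    pairing with \<open>g\<close> over the bounded members of the ball. It results from moving from
    \<open>q\<close> towards \<open>v\<close> by a fraction \<open>l\<close>, dividing by
    \<open>l\<close> and letting \<open>l\<close> tend to 0.\<close>
  have var: "(\<integral>x. g x * v x \<partial>unit_leb) \<le> \<kappa>"
    if v [measurable]: "v \<in> borel_measurable unit_leb" and vb: "\<And>x. 0 \<le> v x" "\<And>x. v x \<le> K"
      and vY: "Y (\<lambda>x. ennreal (v x)) \<le> 1" for v K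
  proof -
    let ?K = "max M K"
    have vK: "v x \<le> ?K" "q x \<le> ?K" "F x \<le> ?K" for x using vb[of x] qb[of x] FM[of x] by auto
    have i0: "integrable unit_leb (\<lambda>x. (v x - q x)\<^sup>2)"
      by (rule intb[where K="?K"]) (use vb vK qb in auto)
    have i1: "integrable unit_leb (\<lambda>x. g x * v x)" "integrable unit_leb (\<lambda>x. g x * q x)"
      by (rule int_mult[where K=M and K'="?K"]; use gb vb vK qb in auto)+
    have i2: "integrable unit_leb (\<lambda>x. (g x)\<^sup>2)"
      unfolding g_def by (rule intR) (use qb in auto)
    define B where "B = (\<integral>x. (v x - q x)\<^sup>2 \<partial>unit_leb)"
    have key: "2 * ((\<integral>x. g x * v x \<partial>unit_leb) - \<kappa>) \<le> l * B" if l: "0 < l" "l \<le> 1" for l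
    proof -
      let ?w = "\<lambda>x. (1 - l) * q x + l * v x"
      \<comment> \<open>The convex combination may exceed \<open>F\<close> because \<open>v\<close>
        is not bounded by \<open>F\<close>; truncation brings it back into \<open>R\<close>.\<close>
      let ?u = "\<lambda>x. min (?w x) (F x)"
      have w0: "0 \<le> ?w x" for x using l qb[of x] vb[of x] by simp
      have wK: "?w x \<le> ?K" for x
        using convex_bound_le[of "q x" ?K "v x" "1 - l" l] l vK[of x] by simp
      have uR: "?u \<in> R"
        proof (rule RI)
        show "?u \<in> borel_measurable unit_leb" by measurable
        have "Y (\<lambda>x. ennreal (?u x)) \<le> Y (\<lambda>x. ennreal (?w x))"
          by (rule ri_norm_mono[OF Y Mp Mp]) (auto intro: ennreal_leI)
        also have "\<dots> \<le> 1" by (rule conv) (use qb vb qY vY l in auto)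
        finally show "Y (\<lambda>x. ennreal (?u x)) \<le> 1" .
      qed (use w0 F0 in auto)
      have "D q \<le> D ?u" using Dq d_le[OF uR] by simp
      also have "\<dots> \<le> (\<integral>x. (F x - ?w x)\<^sup>2 \<partial>unit_leb)"
        unfolding D_def
      proof (rule integral_mono)
        show "integrable unit_leb (\<lambda>x. (F x - ?u x)\<^sup>2)" by (rule intR) (use Rb[OF uR] in auto)
        show "integrable unit_leb (\<lambda>x. (F x - ?w x)\<^sup>2)"
          by (rule intb[where K="?K"]) (use w0 wK F0 vK in auto)
        fix x show "(F x - ?u x)\<^sup>2 \<le> (F x - ?w x)\<^sup>2" by (auto simp: min_def)
      qed
      also have "\<dots> = (\<integral>x. (g x)\<^sup>2 - 2 * l * (g x * v x) + 2 * l * (g x * q x) + l\<^sup>2 * (v x - q x)\<^sup>2 \<partial>unit_leb)"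
        by (rule Bochner_Integration.integral_cong) (auto simp: g_def power2_eq_square algebra_simps)
      also have "\<dots> = D q - 2 * l * (\<integral>x. g x * v x \<partial>unit_leb) + 2 * l * \<kappa> + l\<^sup>2 * B"
        unfolding D_def \<kappa>_def B_def g_def[symmetric] using i0 i1 i2 by simp
      finally have "l * (2 * ((\<integral>x. g x * v x \<partial>unit_leb) - \<kappa>)) \<le> l * (l * B)"
        by (simp add: power2_eq_square algebra_simps)
      then show ?thesis using l by simp
    qed
    have B0: "0 \<le> B" unfolding B_def by simp
    have "2 * ((\<integral>x. g x * v x \<partial>unit_leb) - \<kappa>) \<le> 0"
    proof (rule field_le_epsilon)
      fix e :: real assume e: "0 < e"
      define l where "l = min 1 (e / (B + 1))"
      have "0 < l" "l \<le> 1" using e B0 by (auto simp: l_def)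
      then have "2 * ((\<integral>x. g x * v x \<partial>unit_leb) - \<kappa>) \<le> l * B" by (rule key)
      also have "\<dots> \<le> e / (B + 1) * (B + 1)" using B0 e by (intro mult_mono) (auto simp: l_def)
      also have "\<dots> = e" using B0 by simp
      finally show "2 * ((\<integral>x. g x * v x \<partial>unit_leb) - \<kappa>) \<le> 0 + e" by simp
    qed
    then show ?thesis by simp
  qed
  have gint: "integrable unit_leb g" by (rule bounded_integrable_unit_leb[where B=M]) (use gb in auto)
  have not0: "\<not> (AE x in unit_leb. g x = 0)"
  proof
    assume "AE x in unit_leb. g x = 0"
    then have "AE x in unit_leb. ennreal (F x) \<le> ennreal (q x)"
      by eventually_elim (simp add: g_def)
    then have "Y (\<lambda>x. ennreal (F x)) \<le> Y (\<lambda>x. ennreal (q x))"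
      by (intro ri_norm_mono_AE[OF Y] Mp) auto
    then show False using F1 qY by auto
  qed
  \<comment> \<open>The positive constant of norm one is admissible in \<open>var\<close>, and
    \<open>g\<close> has positive integral since \<open>F\<close> lies outside the ball while
    \<open>q\<close> lies inside.\<close>
  have \<kappa>pos: "0 < \<kappa>"
  proof -
    obtain c where c: "0 < c" "Y (\<lambda>_. 1) = ennreal c" using ri_norm_one_pos[OF Y] .
    have "Y (\<lambda>_. ennreal (1 / c) * 1) = ennreal (1 / c) * Y (\<lambda>_. 1)"
      by (rule ri_norm_cmult[OF Y]) (use c in auto)
    also have "\<dots> = 1" using c by (simp add: ennreal_mult[symmetric] ennreal_1[symmetric] del: ennreal_1)
    finally have "(\<integral>x. g x * (1 / c) \<partial>unit_leb) \<le> \<kappa>"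
      by (intro var[where K="1 / c"]) (use c in auto)
    moreover have "0 < (\<integral>x. g x \<partial>unit_leb)"
      using integral_nonneg_eq_0_iff_AE[OF gint] not0 gb integral_nonneg_AE[where M=unit_leb and f=g]
      by (auto simp: less_le)
    then have "0 < (\<integral>x. g x \<partial>unit_leb) / c" using c by (simp add: divide_pos_pos)
    ultimately show ?thesis by simp
  qed
  define G where "G x = ennreal (g x / \<kappa>)" for x
  have Gm: "G \<in> Mplus" unfolding G_def[abs_def] by (rule Mp) measurable
  have "associate_norm Y G \<le> 1"
  proof (rule associate_norm_least)
    fix \<phi> assume \<phi>: "\<phi> \<in> Mplus" "Y \<phi> \<le> 1"
    have [measurable]: "\<phi> \<in> borel_measurable unit_leb" "G \<in> borel_measurable unit_leb"
      using \<phi> Gm by (auto simp: Mplus_iff)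
    \<comment> \<open>\<open>var\<close> covers only bounded functions, so a general
      \<open>\<phi>\<close> is reached through its truncations and monotone convergence.\<close>
    have n: "(\<integral>\<^sup>+s. min (\<phi> s) (of_nat n) * G s \<partial>unit_leb) \<le> 1" for n
    proof -
      define v where "v x = enn2real (min (\<phi> x) (of_nat n))" for x
      have v: "ennreal (v x) = min (\<phi> x) (of_nat n)" for x
        unfolding v_def by (rule ennreal_enn2real) (simp add: min_less_iff_disj of_nat_less_top)
      have vb: "0 \<le> v x" "v x \<le> real n" for x
        using v[of x] by (auto simp: v_def intro!: enn2real_leI simp: ennreal_of_nat_eq_real_of_nat)
      have vm [measurable]: "v \<in> borel_measurable unit_leb" unfolding v_def[abs_def] by measurable
      have "Y (\<lambda>x. ennreal (v x)) \<le> Y \<phi>"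
        by (rule ri_norm_mono[OF Y Mp[OF vm] \<phi>(1)]) (simp add: v)
      then have "(\<integral>x. g x * v x \<partial>unit_leb) \<le> \<kappa>"
        using \<phi>(2) by (intro var[OF vm vb]) auto
      moreover have "(\<integral>\<^sup>+s. ennreal (v s) * G s \<partial>unit_leb) = ennreal (\<integral>x. g x * v x / \<kappa> \<partial>unit_leb)"
      proof -
        have "(\<integral>\<^sup>+s. ennreal (v s) * G s \<partial>unit_leb) = (\<integral>\<^sup>+s. ennreal (g s * v s / \<kappa>) \<partial>unit_leb)"
          unfolding G_def using vb gb \<kappa>pos by (intro nn_integral_cong) (simp add: ennreal_mult[symmetric] mult.commute)
        also have "\<dots> = ennreal (\<integral>x. g x * v x / \<kappa> \<partial>unit_leb)"
          by (rule nn_integral_eq_integral)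
            (use int_mult[OF gm vm gb vb] vb gb \<kappa>pos in auto)
        finally show ?thesis .
      qed
      ultimately show ?thesis using \<kappa>pos by (simp add: v ennreal_1[symmetric] del: ennreal_1) 
    qed
    have "(\<integral>\<^sup>+s. \<phi> s * G s \<partial>unit_leb) = (\<integral>\<^sup>+s. (SUP n. min (\<phi> s) (of_nat n) * G s) \<partial>unit_leb)"
    proof (rule nn_integral_cong)
      fix s
      have "(SUP n. min (\<phi> s) (of_nat n)) = \<phi> s"
        by (simp add: inf_min[symmetric] inf_SUP[symmetric] ennreal_SUP_of_nat_eq_top)
      then show "\<phi> s * G s = (SUP n. min (\<phi> s) (of_nat n) * G s)"
        by (metis SUP_mult_right_ennreal)
    qed
    also have "\<dots> = (SUP n. \<integral>\<^sup>+s. min (\<phi> s) (of_nat n) * G s \<partial>unit_leb)"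
      by (rule nn_integral_monotone_convergence_SUP)
        (auto simp: incseq_def le_fun_def simp del: min.bounded_iff intro!: mult_right_mono min.mono)
    also have "\<dots> \<le> 1" by (rule SUP_least) (rule n)
    finally show "(\<integral>\<^sup>+s. \<phi> s * G s \<partial>unit_leb) \<le> 1" .
  qed
  \<comment> \<open>Since \<open>F = q + g\<close>, the pairing of \<open>F\<close> with
    \<open>g\<close> exceeds \<open>\<kappa>\<close> by the integral of the square of
    \<open>g\<close>.\<close>
  moreover have "1 < (\<integral>\<^sup>+x. ennreal (F x) * G x \<partial>unit_leb)"
  proof -
    have i: "integrable unit_leb (\<lambda>x. g x * F x)" "integrable unit_leb (\<lambda>x. g x * q x)" "integrable unit_leb (\<lambda>x. g x * g x)"
      by (rule int_mult[where K=M and K'=M]; use gb F0 FM qb in auto)+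
    have "(\<integral>x. g x * F x \<partial>unit_leb) = (\<integral>x. g x * q x + g x * g x \<partial>unit_leb)"
      by (rule Bochner_Integration.integral_cong) (auto simp: g_def algebra_simps)
    also have "\<dots> = \<kappa> + (\<integral>x. g x * g x \<partial>unit_leb)" using i by (simp add: \<kappa>_def)
    finally have e: "(\<integral>x. g x * F x \<partial>unit_leb) = \<kappa> + (\<integral>x. g x * g x \<partial>unit_leb)" .
    have "0 < (\<integral>x. g x * g x \<partial>unit_leb)"
      using integral_nonneg_eq_0_iff_AE[OF i(3)] not0 integral_nonneg_AE[where M=unit_leb and f="\<lambda>x. g x * g x"]
      by (auto simp: less_le)
    then have "1 < (\<integral>x. g x * F x / \<kappa> \<partial>unit_leb)" using e \<kappa>pos by simp
    moreover have "(\<integral>\<^sup>+x. ennreal (F x) * G x \<partial>unit_leb) = ennreal (\<integral>x. g x * F x / \<kappa> \<partial>unit_leb)"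
    proof -
      have "(\<integral>\<^sup>+s. ennreal (F s) * G s \<partial>unit_leb) = (\<integral>\<^sup>+s. ennreal (g s * F s / \<kappa>) \<partial>unit_leb)"
        unfolding G_def using F0 gb \<kappa>pos by (intro nn_integral_cong) (simp add: ennreal_mult[symmetric] mult.commute)
      also have "\<dots> = ennreal (\<integral>x. g x * F x / \<kappa> \<partial>unit_leb)"
        by (rule nn_integral_eq_integral) (use i F0 gb \<kappa>pos in auto)
      finally show ?thesis .
    qed
    ultimately show ?thesis by (simp add: ennreal_1[symmetric] ennreal_less_iff del: ennreal_1)
  qed
  ultimately show thesis using that Gm by blast
qed

text \<open>If the inequality were strict, (P3) would provide a truncation of \<open>f\<close> with
  norm above an intermediate value \<open>r\<close>. Divided by \<open>r\<close>, it is bounded and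
  outside the unit ball, and the separating functional pushes the second associate norm of
  \<open>f\<close> above \<open>r\<close>.\<close>

theorem lorentz_luxemburg:
  assumes Y: "ri_norm Y" and f: "f \<in> Mplus"
  shows "associate_norm (associate_norm Y) f = Y f"
proof (rule antisym)
  show "associate_norm (associate_norm Y) f \<le> Y f" by (rule associate_norm_twice_le[OF Y f])
  show "Y f \<le> associate_norm (associate_norm Y) f"
  proof (rule ccontr)
    assume "\<not> Y f \<le> associate_norm (associate_norm Y) f"
    then have lt: "associate_norm (associate_norm Y) f < Y f" by simp
    then obtain r' where r': "associate_norm (associate_norm Y) f < r'" "r' < Y f" using dense by blast
    then obtain r where r: "r' = ennreal r" "0 < r"
      by (cases r') (auto simp: top_unique dest: le_less_trans[OF zero_le])
    define p where "p n x = min (f x) (of_nat n)" for n x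
    have pm: "p n \<in> Mplus" for n unfolding p_def[abs_def] by (rule Mplus_min) (use f in auto)
    have "(SUP n. Y (p n)) = Y f"
    proof (rule ri_norm_SUP[OF Y pm f], rule AE_I2, rule conjI)
      fix x
      show "incseq (\<lambda>n. p n x)" unfolding incseq_def p_def by (intro allI impI min.mono order_refl) simp
      show "(SUP n. p n x) = f x" unfolding p_def
        by (simp add: inf_min[symmetric] inf_SUP[symmetric] ennreal_SUP_of_nat_eq_top)
    qed
    then obtain n where n: "ennreal r < Y (p n)" using r' r by (metis less_SUP_iff)
    define F where "F x = enn2real (p n x) / r" for x
    have pr: "ennreal (enn2real (p n x)) = p n x" for x
      unfolding p_def by (rule ennreal_enn2real) (simp add: min_less_iff_disj of_nat_less_top)
    have eF: "ennreal (F x) = ennreal (1 / r) * p n x" for x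
      unfolding F_def using r by (subst (2) pr[symmetric]) (simp add: ennreal_mult[symmetric])
    obtain g where g: "g \<in> Mplus" "associate_norm Y g \<le> 1" "1 < (\<integral>\<^sup>+x. ennreal (F x) * g x \<partial>unit_leb)"
    proof (rule separation_from_unit_ball[OF Y, of F "real n / r"])
      have [measurable]: "p n \<in> borel_measurable unit_leb" using pm by (simp add: Mplus_iff)
      show "F \<in> borel_measurable unit_leb" unfolding F_def[abs_def] by measurable
      show "0 \<le> F x" for x using r by (simp add: F_def)
      show "F x \<le> real n / r" for x
        unfolding F_def using r
        by (intro divide_right_mono enn2real_leI) (auto simp: p_def ennreal_of_nat_eq_real_of_nat)
      have "ennreal (1 / r) * ennreal r < ennreal (1 / r) * Y (p n)"
        by (rule ennreal_mult_strict_left_mono) (use n r in auto)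
      then show "1 < Y (\<lambda>x. ennreal (F x))"
        unfolding eF using r by (simp add: ri_norm_cmult[OF Y pm] ennreal_mult[symmetric])
    qed
    have [measurable]: "g \<in> borel_measurable unit_leb" "f \<in> borel_measurable unit_leb" using g f by (auto simp: Mplus_iff)
    have "1 < (\<integral>\<^sup>+x. ennreal (F x) * g x \<partial>unit_leb)" by (rule g)
    also have "\<dots> \<le> (\<integral>\<^sup>+x. ennreal (1 / r) * (g x * f x) \<partial>unit_leb)"
      unfolding eF by (rule nn_integral_mono)
        (auto simp: p_def mult.assoc mult.commute[of "g _"] intro!: mult_left_mono mult_right_mono)
    also have "\<dots> = ennreal (1 / r) * (\<integral>\<^sup>+x. g x * f x \<partial>unit_leb)"
      by (rule nn_integral_cmult) measurable
    also have "\<dots> \<le> ennreal (1 / r) * associate_norm (associate_norm Y) f"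
      by (intro mult_left_mono associate_norm_upper g) auto
    also have "\<dots> \<le> ennreal (1 / r) * ennreal r"
      by (intro mult_left_mono) (use r' r in auto)
    also have "\<dots> = 1" using r by (simp add: ennreal_mult[symmetric])
    finally show False by simp
  qed
qed

section \<open>The operators defining the spaces\<close>

lemma set_nn_integral_unit_leb:
  assumes "A \<subseteq> {0<..<1}"
  shows "(\<integral>\<^sup>+x\<in>A. f x \<partial>lebesgue) = (\<integral>\<^sup>+x. f x * indicator A x \<partial>unit_leb)"
proof -
  have "(\<integral>\<^sup>+x. f x * indicator A x \<partial>unit_leb) = (\<integral>\<^sup>+x. (f x * indicator A x) * indicator {0<..<1} x \<partial>lebesgue)"
    by (rule nn_integral_restrict_space) simp
  also have "\<dots> = (\<integral>\<^sup>+x\<in>A. f x \<partial>lebesgue)"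
    by (rule nn_integral_cong) (use assms in \<open>auto simp: indicator_def\<close>)
  finally show ?thesis ..
qed

lemma nn_integral_unit_leb_const_interval:
  assumes "0 \<le> a" "a \<le> b" "b \<le> 1"
  shows "(\<integral>\<^sup>+x. c * indicator {a<..<b} x \<partial>unit_leb) = c * ennreal (b - a)"
proof -
  have "{a<..<b} \<in> sets unit_leb" "emeasure unit_leb {a<..<b} = ennreal (b - a)"
    by (rule emeasure_unit_leb_interval[of a b]; use assms in auto)+
  then show ?thesis by (simp add: nn_integral_cmult_indicator)
qed

lemma indicator_interval_measurable [measurable]:
  fixes a b :: real
  shows "(\<lambda>x. indicator {a<..<b} x :: ennreal) \<in> borel_measurable unit_leb"
proof -
  have "(\<lambda>x. if a < x \<and> x < b then 1 else 0 :: ennreal) \<in> borel_measurable unit_leb" by measurable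
  then show ?thesis by (simp add: indicator_def)
qed

text \<open>A substitute for monotonicity that survives \<open>R\<close> at the price of doubling
  the constant.\<close>

definition quasi_decreasing :: "real \<Rightarrow> (real \<Rightarrow> ennreal) \<Rightarrow> bool" where
  "quasi_decreasing C u \<longleftrightarrow> 0 < C \<and> (\<forall>b\<in>{0<..<1}. \<forall>t\<in>{b/2..b}. u b \<le> ennreal C * u t)"

lemma nn_integral_unit_leb_scale:
  assumes u: "u \<in> Mplus" and c: "0 < c" and b: "0 \<le> b" "b \<le> 1" "b / c \<le> 1"
  shows "(\<integral>\<^sup>+x. u x * indicator {0<..<b} x \<partial>unit_leb) =
    ennreal c * (\<integral>\<^sup>+x. u (c * x) * indicator {0<..<b / c} x \<partial>unit_leb)"
proof -
  have bc: "0 \<le> b / c" using b c by simp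
  have [measurable]: "(\<lambda>x. u x * indicator {0<..<b} x) \<in> borel_measurable lebesgue"
  proof -
    have m: "u \<in> borel_measurable unit_leb" using u by (simp add: Mplus_iff)
    have "(\<lambda>x. u x * indicator {0<..<1} x) \<in> borel_measurable lebesgue"
      using m borel_measurable_restrict_space_iff_ennreal[of "{0<..<1}" lebesgue u] by simp
    then have "(\<lambda>x. (u x * indicator {0<..<1} x) * indicator {0<..<b} x) \<in> borel_measurable lebesgue"
      by (rule borel_measurable_times_ennreal) (auto intro!: borel_measurable_indicator)
    also have "(\<lambda>x. (u x * indicator {0<..<1} x) * indicator {0<..<b} x) = (\<lambda>x. u x * indicator {0<..<b} x)"
      using b by (auto simp: indicator_def fun_eq_iff)
    finally show ?thesis .
  qed
  have "(\<integral>\<^sup>+x. u x * indicator {0<..<b} x \<partial>unit_leb) = (\<integral>\<^sup>+x. u x * indicator {0<..<b} x \<partial>lebesgue)"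
    by (rule set_nn_integral_unit_leb[symmetric]) (use b in auto)
  also have "\<dots> = ennreal \<bar>c\<bar> * (\<integral>\<^sup>+x. u (0 + c * x) * indicator {0<..<b} (0 + c * x) \<partial>lebesgue)"
    by (rule nn_integral_real_affine_lebesgue) (use c in auto)
  also have "(\<integral>\<^sup>+x. u (0 + c * x) * indicator {0<..<b} (0 + c * x) \<partial>lebesgue) =
    (\<integral>\<^sup>+x\<in>{0<..<b / c}. u (c * x) \<partial>lebesgue)"
    by (rule nn_integral_cong) (use c in \<open>auto simp: indicator_def field_simps zero_less_mult_iff\<close>)
  also have "\<dots> = (\<integral>\<^sup>+x. u (c * x) * indicator {0<..<b / c} x \<partial>unit_leb)"
    by (rule set_nn_integral_unit_leb) (use b bc in auto)
  finally show ?thesis using c by simp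
qed

text \<open>Substituting \<open>2 * x\<close> moves the integral to the half interval and costs the
  factor 2; there \<open>u (2 * x)\<close> is compared with \<open>u x\<close>, which costs
  \<open>C\<close>.\<close>

lemma quasi_decreasing_half_integral:
  assumes u: "u \<in> Mplus" and q: "quasi_decreasing C u" and b: "0 < b" "b \<le> 1"
  shows "(\<integral>\<^sup>+x. u x * indicator {0<..<b} x \<partial>unit_leb) \<le>
    ennreal (2 * C) * (\<integral>\<^sup>+x. u x * indicator {0<..<b / 2} x \<partial>unit_leb)"
proof -
  have C: "0 < C" and qd: "\<And>b t. b \<in> {0<..<1} \<Longrightarrow> t \<in> {b/2..b} \<Longrightarrow> u b \<le> ennreal C * u t"
    using q by (auto simp: quasi_decreasing_def)
  have [measurable]: "u \<in> borel_measurable unit_leb" using u by (simp add: Mplus_iff)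
  have "(\<integral>\<^sup>+x. u x * indicator {0<..<b} x \<partial>unit_leb) =
      ennreal 2 * (\<integral>\<^sup>+x. u (2 * x) * indicator {0<..<b / 2} x \<partial>unit_leb)"
    by (rule nn_integral_unit_leb_scale) (use u b in auto)
  also have "(\<integral>\<^sup>+x. u (2 * x) * indicator {0<..<b / 2} x \<partial>unit_leb) \<le>
      (\<integral>\<^sup>+x. ennreal C * (u x * indicator {0<..<b / 2} x) \<partial>unit_leb)"
    using qd b by (intro nn_integral_mono) (auto simp: indicator_def)
  also have "\<dots> = ennreal C * (\<integral>\<^sup>+x. u x * indicator {0<..<b / 2} x \<partial>unit_leb)"
    by (rule nn_integral_cmult) measurable
  finally show ?thesis using C by (simp add: ennreal_mult mult.assoc mult_left_mono)
qed

section \<open>The weighted Hardy operator and the kernels in the definition of the spaces\<close>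

locale hardy_weight =
  fixes I :: "real \<Rightarrow> real" and a :: real
  assumes I_mono: "\<And>s t. 0 \<le> s \<Longrightarrow> s \<le> t \<Longrightarrow> t \<le> 1 \<Longrightarrow> I s \<le> I t"
    and a_pos: "0 < a"
    and I_lower: "\<And>t. 0 < t \<Longrightarrow> t < 1 \<Longrightarrow> a * t \<le> I t"
begin

definition J :: "real \<Rightarrow> ennreal" where
  "J t = ennreal (1 / I t)"

text \<open>Cutting off inside the integrand gives direct access to joint measurability in
  \<open>s\<close> and \<open>t\<close>, which Fubini requires.\<close>

definition Hk :: "real \<Rightarrow> real \<Rightarrow> ennreal" where
  "Hk s t = (\<integral>\<^sup>+r. J r * of_bool (s < r \<and> r < t) \<partial>unit_leb)"

definition R :: "(real \<Rightarrow> ennreal) \<Rightarrow> real \<Rightarrow> ennreal" where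
  "R u t = J t * (\<integral>\<^sup>+s. u s * of_bool (s < t) \<partial>unit_leb)"

definition kern :: "nat \<Rightarrow> real \<Rightarrow> real \<Rightarrow> ennreal" where
  "kern m t s = J t * Hk s t ^ (m - 1) * of_bool (s < t)"

definition T :: "nat \<Rightarrow> (real \<Rightarrow> ennreal) \<Rightarrow> real \<Rightarrow> ennreal" where
  "T m u t = (\<integral>\<^sup>+s. u s * kern m t s \<partial>unit_leb)"

lemma I_pos: "0 < t \<Longrightarrow> t \<le> 1 \<Longrightarrow> 0 < I t"
  using I_lower[of "t/2"] a_pos I_mono[of "t/2" t] by (smt (verit) divide_pos_pos field_sum_of_halves mult_pos_pos)

lemma J_antimono: "0 < s \<Longrightarrow> s \<le> t \<Longrightarrow> t \<le> 1 \<Longrightarrow> J t \<le> J s"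
  unfolding J_def using I_mono[of s t] I_pos[of s]
  by (intro ennreal_leI) (auto intro!: divide_left_mono)

lemma J_le: "0 < t \<Longrightarrow> t < 1 \<Longrightarrow> ennreal t * J t \<le> ennreal (1 / a)"
proof -
  assume t: "0 < t" "t < 1"
  then have "t * (1 / I t) \<le> 1 / a" using I_lower[of t] I_pos[of t] a_pos by (simp add: field_simps)
  then show ?thesis unfolding J_def using t by (simp add: ennreal_mult'[symmetric] ennreal_leI)
qed

lemma J_Mplus [simp]: "J \<in> Mplus"
  by (rule antimono_on_Mplus) (auto simp: monotone_on_def intro: J_antimono)

lemma J_measurable [measurable]: "J \<in> borel_measurable unit_leb"
  using J_Mplus by (simp add: Mplus_iff)

lemma Hk_mono: "s' \<le> s \<Longrightarrow> t \<le> t' \<Longrightarrow> Hk s t \<le> Hk s' t'"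
  unfolding Hk_def by (intro nn_integral_mono mult_left_mono) auto

lemma Hk_measurable [measurable]:
  "(\<lambda>(s, t). Hk s t) \<in> borel_measurable (unit_leb \<Otimes>\<^sub>M unit_leb)"
  unfolding Hk_def by measurable

lemma kern_measurable [measurable]:
  "(\<lambda>(t, s). kern m t s) \<in> borel_measurable (unit_leb \<Otimes>\<^sub>M unit_leb)"
proof -
  have [measurable]: "(\<lambda>(t, s). Hk s t) \<in> borel_measurable (unit_leb \<Otimes>\<^sub>M unit_leb)"
    unfolding Hk_def by measurable
  show ?thesis unfolding kern_def by measurable
qed

text \<open>Decrease in \<open>s\<close> makes the kernel an admissible weight for
  Hardy--Littlewood, resonance and the subadditivity of integrals of rearrangements.\<close>

lemma kern_antimono: "antimono_on {0<..<1} (kern m t)"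
  unfolding monotone_on_def kern_def
  by (auto intro!: mult_left_mono power_mono Hk_mono)

lemma kern_Mplus: "kern m t \<in> Mplus"
  by (rule antimono_on_Mplus) (rule kern_antimono)

lemma T_Mplus [simp]:
  assumes "u \<in> Mplus"
  shows "T m u \<in> Mplus"
proof -
  have [measurable]: "u \<in> borel_measurable unit_leb" using assms by (simp add: Mplus_iff)
  show ?thesis unfolding Mplus_iff T_def by measurable
qed

lemma R_eq_T: "u \<in> Mplus \<Longrightarrow> R u = T 1 u"
  unfolding R_def T_def kern_def Mplus_iff
  by (subst nn_integral_cmult[symmetric]) (auto simp: mult_ac fun_eq_iff)

lemma R_Mplus [simp]: "u \<in> Mplus \<Longrightarrow> R u \<in> Mplus"
  using R_eq_T[of u] T_Mplus[of u 1] by simp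

lemma R_pow_Mplus [simp]: "u \<in> Mplus \<Longrightarrow> (R ^^ m) u \<in> Mplus"
  by (induction m) auto

lemma R_mono: "(\<And>s. s \<in> {0<..<1} \<Longrightarrow> u s \<le> v s) \<Longrightarrow> R u t \<le> R v t"
  unfolding R_def by (intro mult_left_mono nn_integral_mono mult_right_mono) auto

lemma R_pow_mono:
  assumes "\<And>s. s \<in> {0<..<1} \<Longrightarrow> u s \<le> v s" and "t \<in> {0<..<1}"
  shows "(R ^^ m) u t \<le> (R ^^ m) v t"
  using assms(2)
proof (induction m arbitrary: t)
  case 0
  then show ?case using assms(1) by simp
next
  case (Suc m)
  then show ?case by (auto intro!: R_mono)
qed

lemma R_cmult: "u \<in> Mplus \<Longrightarrow> R (\<lambda>s. c * u s) t = c * R u t"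
  unfolding R_def Mplus_iff
  by (simp add: mult.assoc nn_integral_cmult mult.left_commute)

lemma T_mono: "(\<And>s. s \<in> {0<..<1} \<Longrightarrow> u s \<le> v s) \<Longrightarrow> T m u t \<le> T m v t"
  unfolding T_def by (intro nn_integral_mono mult_right_mono) auto

lemma T_cmult: "u \<in> Mplus \<Longrightarrow> T m (\<lambda>s. c * u s) t = c * T m u t"
  using kern_Mplus[of m t] unfolding T_def Mplus_iff by (simp add: mult.assoc nn_integral_cmult)

lemma assoc_XmI_eq:
  "assoc_XmI X m I f = associate_norm X (T m (rearr01 f))"
  unfolding assoc_XmI_def
proof (rule associate_norm_cong)
  fix t :: real assume t: "t \<in> {0<..<1}"
  have H: "(\<integral>\<^sup>+r\<in>{s<..<t}. ennreal (1 / I r) \<partial>lebesgue) = Hk s t" if "0 < s" for s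
  proof -
    have "{s<..<t} \<subseteq> {0<..<1}" using that t by auto
    then show ?thesis unfolding Hk_def J_def
      by (subst set_nn_integral_unit_leb) (auto intro!: nn_integral_cong simp: indicator_def)
  qed
  have K: "(\<integral>\<^sup>+s\<in>{0<..<t}. (g s * rearr01 f s) \<partial>lebesgue) = (\<integral>\<^sup>+s. rearr01 f s * (g s * of_bool (s < t)) \<partial>unit_leb)" for g :: "real \<Rightarrow> ennreal"
    using t by (subst set_nn_integral_unit_leb) (auto intro!: nn_integral_cong simp: indicator_def mult.commute)
  have "(\<integral>\<^sup>+s\<in>{0<..<t}. ((\<integral>\<^sup>+r\<in>{s<..<t}. ennreal (1 / I r) \<partial>lebesgue) ^ (m - 1) * rearr01 f s) \<partial>lebesgue)
     = (\<integral>\<^sup>+s\<in>{0<..<t}. (Hk s t ^ (m - 1) * rearr01 f s) \<partial>lebesgue)"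
  proof (rule nn_integral_cong)
    fix s :: real
    show "((\<integral>\<^sup>+r\<in>{s<..<t}. ennreal (1 / I r) \<partial>lebesgue) ^ (m - 1) * rearr01 f s) * indicator {0<..<t} s
      = (Hk s t ^ (m - 1) * rearr01 f s) * indicator {0<..<t} s"
      by (cases "0 < s") (simp_all only: H, simp)
  qed
  also have "\<dots> = (\<integral>\<^sup>+s. rearr01 f s * (Hk s t ^ (m - 1) * of_bool (s < t)) \<partial>unit_leb)" by (rule K)
  finally have "ennreal (1 / I t) * (\<integral>\<^sup>+s\<in>{0<..<t}. ((\<integral>\<^sup>+r\<in>{s<..<t}. ennreal (1 / I r) \<partial>lebesgue) ^ (m - 1) * rearr01 f s) \<partial>lebesgue)
     = J t * (\<integral>\<^sup>+s. rearr01 f s * (Hk s t ^ (m - 1) * of_bool (s < t)) \<partial>unit_leb)"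
    by (simp only: J_def)
  also have "\<dots> = (\<integral>\<^sup>+s. J t * (rearr01 f s * (Hk s t ^ (m - 1) * of_bool (s < t))) \<partial>unit_leb)"
  proof (rule nn_integral_cmult[symmetric])
    have [measurable]: "rearr01 f \<in> borel_measurable unit_leb"
      using rearr_Mplus[of unit_leb "\<lambda>x. enn2ereal (f x)"] by (simp add: Mplus_iff)
    have [measurable]: "(\<lambda>s. Hk s t) \<in> borel_measurable unit_leb"
      using measurable_Pair1[OF Hk_measurable, of t] t by simp
    show "(\<lambda>s. rearr01 f s * (Hk s t ^ (m - 1) * of_bool (s < t))) \<in> borel_measurable unit_leb"
      by measurable
  qed
  also have "\<dots> = T m (rearr01 f) t"
    unfolding T_def kern_def by (rule nn_integral_cong) (simp add: mult_ac)
  finally show "ennreal (1 / I t) * (\<integral>\<^sup>+s\<in>{0<..<t}. ((\<integral>\<^sup>+r\<in>{s<..<t}. ennreal (1 / I r) \<partial>lebesgue) ^ (m - 1) * rearr01 f s) \<partial>lebesgue)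
     = T m (rearr01 f) t" .
qed

section \<open>Kernel powers compared with iterates of the Hardy operator\<close>

lemma Hk_add:
  assumes "0 < s" "s \<le> r" "r \<le> t" "t < 1"
  shows "Hk s t = Hk s r + Hk r t"
proof -
  have "{r} \<in> null_sets lebesgue" by (intro null_sets_completionI finite_imp_null_set_lborel) auto
  then have n: "AE x in unit_leb. x \<noteq> r"
    using assms by (intro AE_I'[of "{r}"]) (auto simp: null_sets_def sets_unit_leb emeasure_unit_leb)
  have "Hk s t = (\<integral>\<^sup>+x. J x * of_bool (s < x \<and> x < r) + J x * of_bool (r < x \<and> x < t) \<partial>unit_leb)"
    unfolding Hk_def by (rule nn_integral_cong_AE, use n in eventually_elim) (use assms in auto)
  also have "\<dots> = Hk s r + Hk r t" unfolding Hk_def by (rule nn_integral_add) measurable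
  finally show ?thesis .
qed

lemma Hk_le:
  assumes "0 < s" "s \<le> r" "r \<le> t" "t < 1"
  shows "Hk r t \<le> J s * ennreal (t - r)"
proof -
  have "Hk r t \<le> (\<integral>\<^sup>+x. J s * indicator {r<..<t} x \<partial>unit_leb)"
    unfolding Hk_def by (rule nn_integral_mono) (use assms in \<open>auto simp: indicator_def intro: J_antimono\<close>)
  also have "\<dots> = J s * ennreal (t - r)" by (rule nn_integral_unit_leb_const_interval) (use assms in auto)
  finally show ?thesis .
qed

text \<open>As a function of its upper limit, \<open>Hk s\<close> is Lipschitz with constant
  \<open>J s\<close>, so it takes half its final value somewhere.\<close>

lemma Hk_midpoint:
  assumes st: "0 < s" "s \<le> t" "t < 1"
  obtains r where "s \<le> r" "r \<le> t" "Hk s t = 2 * Hk s r" "Hk s r = Hk r t"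
proof -
  define e where "e r = enn2real (Hk s r)" for r
  obtain j where j: "J s = ennreal j" "0 \<le> j" by (auto simp: J_def intro!: that[of "max 0 (1 / I s)"] simp: max_def ennreal_neg)
  have fin: "Hk s r \<noteq> top" if "s \<le> r" "r \<le> t" for r
    using Hk_le[of s s r] that st j by (auto simp: ennreal_mult[symmetric] top_unique)
  have e: "Hk s r = ennreal (e r)" if "s \<le> r" "r \<le> t" for r
    unfolding e_def using fin[OF that] by (simp add: less_top)
  have e0: "0 \<le> e r" for r by (simp add: e_def)
  have lip: "e x \<le> e y \<and> e y \<le> e x + j * (y - x)" if "s \<le> x" "x \<le> y" "y \<le> t" for x y
  proof
    show "e x \<le> e y" using Hk_mono[of s s x y] that e[of x] e[of y] e0 by simp
    have "Hk s y = Hk s x + Hk x y" by (rule Hk_add) (use that st in auto)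
    also have "\<dots> \<le> Hk s x + J s * ennreal (y - x)" by (intro add_left_mono Hk_le) (use that st in auto)
    finally have "ennreal (e y) \<le> ennreal (e x + j * (y - x))"
      using that j e[of x] e[of y] e0 by (simp add: ennreal_mult[symmetric] ennreal_plus[symmetric] del: ennreal_plus)
    then show "e y \<le> e x + j * (y - x)" using e0 j that by (subst (asm) ennreal_le_iff) auto
  qed
  have "continuous_on {s..t} e"
    unfolding continuous_on_iff
  proof (intro ballI allI impI)
    fix x \<epsilon> :: real assume x: "x \<in> {s..t}" "0 < \<epsilon>"
    show "\<exists>d>0. \<forall>x'\<in>{s..t}. dist x' x < d \<longrightarrow> dist (e x') (e x) < \<epsilon>"
    proof (intro exI[of _ "\<epsilon> / (j + 1)"] conjI ballI impI)
      show "0 < \<epsilon> / (j + 1)" using x j by simp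
      fix x' assume x': "x' \<in> {s..t}" "dist x' x < \<epsilon> / (j + 1)"
      have "\<bar>e x' - e x\<bar> \<le> j * \<bar>x' - x\<bar>"
      proof (cases "x \<le> x'")
        case True
        then show ?thesis using lip[of x x'] x x' by auto
      next
        case False
        then show ?thesis using lip[of x' x] x x' by auto
      qed
      also have "\<dots> \<le> (j + 1) * \<bar>x' - x\<bar>" by (intro mult_right_mono) auto
      also have "\<dots> < \<epsilon>" using x' j by (simp add: dist_real_def field_simps)
      finally show "dist (e x') (e x) < \<epsilon>" by (simp add: dist_real_def)
    qed
  qed
  moreover have "e s = 0" using Hk_le[of s s s] st e[of s] e0[of s] by simp
  ultimately obtain r where r: "s \<le> r" "r \<le> t" "e r = e t / 2"
    using IVT'[of e s "e t / 2" t] st e0[of t] by auto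
  have 1: "Hk s t = 2 * Hk s r"
  proof -
    have "e t = 2 * e r" using r(3) by simp
    then have "Hk s t = ennreal (2 * e r)" using e[of t] st by simp
    also have "\<dots> = 2 * Hk s r" unfolding e[OF r(1,2)] by (simp add: ennreal_mult e0)
    finally show ?thesis .
  qed
  have "Hk s r + Hk s r = Hk s r + Hk r t" using Hk_add[of s r t] st r 1 by (simp add: mult_2)
  then have "Hk s r = Hk r t" using fin[OF r(1,2)] by (simp add: ennreal_add_left_cancel)
  with 1 r show thesis using that by blast
qed

text \<open>A version up to constants of integrating the derivative of a power, without
  differentiation. For the upper bound the inner power is replaced by its final value. For the lower
  bound only \<open>r\<close> beyond the midpoint \<open>r0\<close> is kept: there the inner
  integral is at least half of \<open>Hk s t\<close>, and so is the remaining mass.\<close>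

lemma Hk_power:
  assumes st: "0 < s" "s \<le> t" "t < 1" and m: "m \<ge> 1"
  defines "Q \<equiv> (\<integral>\<^sup>+r. J r * Hk s r ^ (m - 1) * of_bool (s < r \<and> r < t) \<partial>unit_leb)"
  shows "Q \<le> Hk s t ^ m" "Hk s t ^ m \<le> 2 ^ m * Q"
proof -
  have pw: "x ^ m = x * x ^ (m - 1)" for x :: ennreal using m by (cases m) auto
  have sm: "s \<in> space unit_leb" using st by simp
  have [measurable]: "(\<lambda>r. Hk s r) \<in> borel_measurable unit_leb"
    using measurable_Pair2[OF Hk_measurable sm] by simp
  have "Q \<le> (\<integral>\<^sup>+r. J r * of_bool (s < r \<and> r < t) * Hk s t ^ (m - 1) \<partial>unit_leb)"
    unfolding Q_def by (intro nn_integral_mono) (auto intro!: mult_left_mono power_mono Hk_mono)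
  also have "\<dots> = Hk s t * Hk s t ^ (m - 1)" unfolding Hk_def by (rule nn_integral_multc) measurable
  finally show "Q \<le> Hk s t ^ m" by (simp add: pw)
  obtain r0 where r0: "s \<le> r0" "r0 \<le> t" "Hk s t = 2 * Hk s r0" "Hk s r0 = Hk r0 t"
    using Hk_midpoint[OF st] .
  have "Hk r0 t * Hk s r0 ^ (m - 1) = (\<integral>\<^sup>+r. J r * of_bool (r0 < r \<and> r < t) * Hk s r0 ^ (m - 1) \<partial>unit_leb)"
    unfolding Hk_def[of r0 t] by (rule nn_integral_multc[symmetric]) measurable
  also have "\<dots> \<le> Q"
    unfolding Q_def using r0(1) by (intro nn_integral_mono) (auto intro!: mult_left_mono power_mono Hk_mono)
  finally have "Hk s r0 ^ m \<le> Q" using r0(4) by (simp add: pw)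
  then show "Hk s t ^ m \<le> 2 ^ m * Q" using r0(3) by (simp add: power_mult_distrib mult_left_mono)
qed

text \<open>Fubini brings \<open>R (T m u)\<close> into the form of \<open>T (Suc m) u\<close> with
  \<open>Hk s t ^ m\<close> replaced by \<open>Q s\<close>, and \<open>Hk_power\<close> compares the
  two.\<close>

lemma R_T:
  assumes u: "u \<in> Mplus" and t: "t \<in> {0<..<1}" and m: "m \<ge> 1"
  shows "R (T m u) t \<le> T (Suc m) u t" "T (Suc m) u t \<le> 2 ^ m * R (T m u) t"
proof -
  interpret P: pair_sigma_finite unit_leb unit_leb ..
  have um [measurable]: "u \<in> borel_measurable unit_leb" using u by (simp add: Mplus_iff)
  define Q where "Q s = (\<integral>\<^sup>+r. J r * Hk s r ^ (m - 1) * of_bool (s < r \<and> r < t) \<partial>unit_leb)" for s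
  have [measurable]: "Q \<in> borel_measurable unit_leb" unfolding Q_def[abs_def] by measurable
  have tm: "t \<in> space unit_leb" using t by simp
  have [measurable]: "(\<lambda>s. Hk s t) \<in> borel_measurable unit_leb"
    using measurable_Pair1[OF Hk_measurable tm] by simp
  have "(\<integral>\<^sup>+r. T m u r * of_bool (r < t) \<partial>unit_leb) = (\<integral>\<^sup>+r. (\<integral>\<^sup>+s. u s * kern m r s * of_bool (r < t) \<partial>unit_leb) \<partial>unit_leb)"
    unfolding T_def using kern_Mplus[of m] by (intro nn_integral_cong nn_integral_multc[symmetric]) (auto simp: Mplus_iff)
  also have "\<dots> = (\<integral>\<^sup>+s. (\<integral>\<^sup>+r. u s * kern m r s * of_bool (r < t) \<partial>unit_leb) \<partial>unit_leb)"
    by (rule P.Fubini') measurable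
  also have "\<dots> = (\<integral>\<^sup>+s. u s * of_bool (s < t) * Q s \<partial>unit_leb)"
  proof (rule nn_integral_cong)
    fix s assume s: "s \<in> space unit_leb"
    have [measurable]: "(\<lambda>r. Hk s r) \<in> borel_measurable unit_leb"
      using measurable_Pair2[OF Hk_measurable s] by simp
    have "(\<integral>\<^sup>+r. u s * kern m r s * of_bool (r < t) \<partial>unit_leb) =
      (\<integral>\<^sup>+r. u s * of_bool (s < t) * (J r * Hk s r ^ (m - 1) * of_bool (s < r \<and> r < t)) \<partial>unit_leb)"
      by (rule nn_integral_cong) (auto simp: kern_def mult_ac)
    also have "\<dots> = u s * of_bool (s < t) * Q s"
      unfolding Q_def by (rule nn_integral_cmult) measurable
    finally show "(\<integral>\<^sup>+r. u s * kern m r s * of_bool (r < t) \<partial>unit_leb) = u s * of_bool (s < t) * Q s" .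
  qed
  finally have R: "R (T m u) t = J t * (\<integral>\<^sup>+s. u s * of_bool (s < t) * Q s \<partial>unit_leb)"
    by (simp add: R_def)
  have T: "T (Suc m) u t = J t * (\<integral>\<^sup>+s. u s * of_bool (s < t) * Hk s t ^ m \<partial>unit_leb)"
    unfolding T_def kern_def by (subst nn_integral_cmult[symmetric]) (auto simp: mult_ac)
  have Q: "Q s \<le> Hk s t ^ m" "Hk s t ^ m \<le> 2 ^ m * Q s" if "s \<in> {0<..<1}" "s < t" for s
    unfolding Q_def using Hk_power[of s t m] that t m by auto
  then have Q: "u s * of_bool (s < t) * Q s \<le> u s * of_bool (s < t) * Hk s t ^ m"
    "u s * of_bool (s < t) * Hk s t ^ m \<le> 2 ^ m * (u s * of_bool (s < t) * Q s)"
    if "s \<in> {0<..<1}" for s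
    using that by (auto simp: mult.left_commute[of "2 ^ m"] intro!: mult_left_mono)
  show "R (T m u) t \<le> T (Suc m) u t"
    unfolding R T by (rule mult_left_mono, rule nn_integral_mono) (simp_all only: space_unit_leb Q zero_le)
  have "T (Suc m) u t \<le> J t * (\<integral>\<^sup>+s. 2 ^ m * (u s * of_bool (s < t) * Q s) \<partial>unit_leb)"
    unfolding T by (rule mult_left_mono, rule nn_integral_mono) (simp_all only: space_unit_leb Q zero_le)
  also have "\<dots> = 2 ^ m * R (T m u) t"
    unfolding R by (subst nn_integral_cmult) (auto simp: mult_ac)
  finally show "T (Suc m) u t \<le> 2 ^ m * R (T m u) t" .
qed

text \<open>Each step costs \<open>2 ^ m\<close>. The generous exponent \<open>m * m\<close> closes
  the induction because \<open>m + m * m \<le> Suc m * Suc m\<close>.\<close>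

lemma R_pow_T:
  assumes u: "u \<in> Mplus"
  shows "m \<ge> 1 \<Longrightarrow> t \<in> {0<..<1} \<Longrightarrow> (R ^^ m) u t \<le> T m u t"
    and "m \<ge> 1 \<Longrightarrow> t \<in> {0<..<1} \<Longrightarrow> T m u t \<le> 2 ^ (m * m) * (R ^^ m) u t"
proof (induction m arbitrary: t)
  case (Suc m)
  {
    case 1
    show ?case
    proof (cases "m = 0")
      case True
      then show ?thesis using R_eq_T[OF u] by simp
    next
      case False
      have "(R ^^ Suc m) u t \<le> R (T m u) t"
        using False Suc.IH(1) by (auto intro!: R_mono)
      also have "\<dots> \<le> T (Suc m) u t" using R_T(1)[OF u 1(2)] False by simp
      finally show ?thesis .
    qed
  next
    case 2
    show ?case
    proof (cases "m = 0")
      case True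
      then show ?thesis using R_eq_T[OF u] mult_right_mono[of 1 "2::ennreal" "T 1 u t"] by simp
    next
      case False
      have "T (Suc m) u t \<le> 2 ^ m * R (T m u) t" using R_T(2)[OF u 2(2)] False by simp
      also have "R (T m u) t \<le> R (\<lambda>s. 2 ^ (m * m) * (R ^^ m) u s) t"
        using False Suc.IH(2) by (intro R_mono) auto
      also have "\<dots> = 2 ^ (m * m) * (R ^^ Suc m) u t" using u by (simp add: R_cmult)
      also have "2 ^ m * (2 ^ (m * m) * (R ^^ Suc m) u t) = 2 ^ (m + m * m) * (R ^^ Suc m) u t"
        by (simp add: power_add mult.assoc)
      also have "\<dots> \<le> 2 ^ (Suc m * Suc m) * (R ^^ Suc m) u t"
        by (intro mult_right_mono power_increasing) auto
      finally show ?thesis by (simp add: mult_left_mono)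
    qed
  }
qed simp_all

end

section \<open>Existence of the spaces\<close>

context hardy_weight
begin

section \<open>Quasi-decreasing iterates and the bounds behind (P4) and (P5)\<close>

lemma of_bool_unit_leb:
  "(\<integral>\<^sup>+s. u s * of_bool (s < t) \<partial>unit_leb) = (\<integral>\<^sup>+s. u s * indicator {0<..<t} s \<partial>unit_leb)"
  by (rule nn_integral_cong) (auto simp: indicator_def)

lemma quasi_decreasing_R:
  assumes u: "u \<in> Mplus" and q: "quasi_decreasing C u"
  shows "quasi_decreasing (2 * C) (R u)"
  unfolding quasi_decreasing_def
proof (intro conjI ballI)
  show "0 < 2 * C" using q by (simp add: quasi_decreasing_def)
  fix b t :: real assume b: "b \<in> {0<..<1}" and t: "t \<in> {b/2..b}"
  have "(\<integral>\<^sup>+s. u s * of_bool (s < b) \<partial>unit_leb) \<le>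
      ennreal (2 * C) * (\<integral>\<^sup>+s. u s * indicator {0<..<b/2} s \<partial>unit_leb)"
    unfolding of_bool_unit_leb by (rule quasi_decreasing_half_integral[OF u q]) (use b in auto)
  also have "\<dots> \<le> ennreal (2 * C) * (\<integral>\<^sup>+s. u s * of_bool (s < t) \<partial>unit_leb)"
    using t by (intro mult_left_mono nn_integral_mono) (auto simp: indicator_def)
  finally have "J b * (\<integral>\<^sup>+s. u s * of_bool (s < b) \<partial>unit_leb) \<le>
      J t * (ennreal (2 * C) * (\<integral>\<^sup>+s. u s * of_bool (s < t) \<partial>unit_leb))"
    using b t by (intro mult_mono J_antimono) auto
  then show "R u b \<le> ennreal (2 * C) * R u t"
    by (simp add: R_def mult.left_commute)
qed

lemma quasi_decreasing_antimono: "antimono_on {0<..<1} u \<Longrightarrow> quasi_decreasing 1 u"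
  by (auto simp: quasi_decreasing_def monotone_on_def)

lemma quasi_decreasing_R_pow:
  assumes u: "antimono_on {0<..<1} u"
  shows "quasi_decreasing (2 ^ m) ((R ^^ m) u)"
proof (induction m)
  case 0
  then show ?case using quasi_decreasing_antimono[OF u] by simp
next
  case (Suc m)
  then show ?case using quasi_decreasing_R[OF R_pow_Mplus[OF antimono_on_Mplus[OF u]] Suc.IH] by simp
qed

text \<open>A reverse bound, the source of (P5) for the new norm. The integral of \<open>u\<close>
  is at most \<open>2 * C\<close> times its part over the left half, and on the right half, of
  length 1/2, \<open>R u\<close> is at least \<open>J 1\<close> times that part.\<close>

lemma nn_integral_le_R:
  assumes u: "u \<in> Mplus" and q: "quasi_decreasing C u"
  shows "(\<integral>\<^sup>+s. u s \<partial>unit_leb) \<le> ennreal (4 * C * I 1) * (\<integral>\<^sup>+s. R u s \<partial>unit_leb)"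
proof -
  have C: "0 < C" using q by (simp add: quasi_decreasing_def)
  have I1: "0 < I 1" by (rule I_pos) auto
  define A where "A = (\<integral>\<^sup>+s. u s * indicator {0<..<1/2} s \<partial>unit_leb)"
  have "(\<integral>\<^sup>+s. u s \<partial>unit_leb) = (\<integral>\<^sup>+s. u s * indicator {0<..<1} s \<partial>unit_leb)"
    by (rule nn_integral_cong) auto
  also have "\<dots> \<le> ennreal (2 * C) * A"
    unfolding A_def by (rule quasi_decreasing_half_integral[OF u q]) auto
  finally have 1: "(\<integral>\<^sup>+s. u s \<partial>unit_leb) \<le> ennreal (2 * C) * A" .
  have "(J 1 * A) * ennreal (1 - 1/2) = (\<integral>\<^sup>+t. (J 1 * A) * indicator {1/2<..<1} t \<partial>unit_leb)"
    by (rule nn_integral_unit_leb_const_interval[symmetric]) auto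
  also have "\<dots> \<le> (\<integral>\<^sup>+t. R u t \<partial>unit_leb)"
  proof (rule nn_integral_mono)
    fix t assume "t \<in> space unit_leb"
    then have t: "0 < t" "t < 1" by auto
    show "(J 1 * A) * indicator {1/2<..<1} t \<le> R u t"
    proof (cases "1/2 < t")
      case True
      have "A \<le> (\<integral>\<^sup>+s. u s * of_bool (s < t) \<partial>unit_leb)"
        unfolding A_def using True by (intro nn_integral_mono) (auto simp: indicator_def)
      then have "J 1 * A \<le> R u t" unfolding R_def using t by (intro mult_mono J_antimono) auto
      then show ?thesis by (auto simp: indicator_def)
    qed simp
  qed
  finally have 2: "(J 1 * A) * ennreal (1 - 1/2) \<le> (\<integral>\<^sup>+t. R u t \<partial>unit_leb)" .
  have "ennreal (2 * C) = ennreal (4 * C * I 1 * (1 / I 1 * (1 - 1/2)))" using I1 by (simp add: field_simps)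
  also have "\<dots> = ennreal (4 * C * I 1) * (J 1 * ennreal (1 - 1/2))"
    unfolding J_def using I1 C by (subst ennreal_mult[symmetric], simp, simp)
      (subst ennreal_mult[symmetric], simp_all)
  finally have "ennreal (2 * C) * A = ennreal (4 * C * I 1) * ((J 1 * A) * ennreal (1 - 1/2))"
    by (simp add: mult_ac)
  with 1 have "(\<integral>\<^sup>+s. u s \<partial>unit_leb) \<le> ennreal (4 * C * I 1) * ((J 1 * A) * ennreal (1 - 1/2))"
    by simp
  also have "\<dots> \<le> ennreal (4 * C * I 1) * (\<integral>\<^sup>+t. R u t \<partial>unit_leb)"
    by (rule mult_left_mono[OF 2]) simp
  finally show ?thesis .
qed

lemma nn_integral_le_R_pow:
  assumes u: "antimono_on {0<..<1} u"
  shows "(\<integral>\<^sup>+s. u s \<partial>unit_leb) \<le> ennreal (\<Prod>j<m. 4 * 2 ^ j * I 1) * (\<integral>\<^sup>+s. (R ^^ m) u s \<partial>unit_leb)"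
proof (induction m)
  case (Suc m)
  have I1: "0 < I 1" by (rule I_pos) auto
  note Suc.IH
  also have "(\<integral>\<^sup>+s. (R ^^ m) u s \<partial>unit_leb) \<le> ennreal (4 * 2 ^ m * I 1) * (\<integral>\<^sup>+s. R ((R ^^ m) u) s \<partial>unit_leb)"
    by (rule nn_integral_le_R[OF R_pow_Mplus[OF antimono_on_Mplus[OF u]] quasi_decreasing_R_pow[OF u]])
  finally show ?case
    using I1 by (simp add: mult_left_mono ennreal_mult prod_nonneg mult.assoc)
qed simp

text \<open>Applied to a constant, \<open>R\<close> multiplies it by \<open>t * J t\<close>, which
  the linear lower bound on \<open>I\<close> keeps below \<open>1 / a\<close>.\<close>

lemma R_pow_le_const:
  assumes "\<And>s. s \<in> {0<..<1} \<Longrightarrow> u s \<le> B" "t \<in> {0<..<1}"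
  shows "(R ^^ m) u t \<le> ennreal (1 / a) ^ m * B"
  using assms(2)
proof (induction m arbitrary: t)
  case 0
  then show ?case using assms(1) by simp
next
  case (Suc m)
  let ?B = "ennreal (1 / a) ^ m * B"
  have t: "0 < t" "t < 1" using Suc.prems by auto
  have "(R ^^ Suc m) u t \<le> R (\<lambda>_. ?B) t" using Suc.IH by (auto intro!: R_mono)
  also have "\<dots> = J t * (\<integral>\<^sup>+s. ?B * indicator {0<..<t} s \<partial>unit_leb)"
    by (simp only: R_def of_bool_unit_leb)
  also have "\<dots> = (ennreal t * J t) * ?B"
    using t by (subst nn_integral_unit_leb_const_interval) (auto simp: mult_ac)
  also have "\<dots> \<le> ennreal (1 / a) * ?B" by (intro mult_right_mono J_le t) auto
  finally show ?case by (simp add: mult.assoc)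
qed

section \<open>The prescribed functional as an r.i. norm and as an associate norm\<close>

lemma T_SUP:
  assumes F: "\<And>j. F j \<in> Mplus" and inc: "\<And>s. incseq (\<lambda>j::nat. F j s)"
  shows "incseq (\<lambda>j. T m (F j) t)" "(SUP j. T m (F j) t) = T m (\<lambda>s. SUP j. F j s) t"
proof -
  show "incseq (\<lambda>j. T m (F j) t)"
    by (intro incseq_SucI T_mono) (use inc in \<open>auto simp: incseq_def\<close>)
  have [measurable]: "\<And>j. F j \<in> borel_measurable unit_leb" "kern m t \<in> borel_measurable unit_leb"
    using F kern_Mplus by (auto simp: Mplus_iff)
  have "T m (\<lambda>s. SUP j. F j s) t = (\<integral>\<^sup>+s. (SUP j. F j s * kern m t s) \<partial>unit_leb)"
    by (simp add: T_def SUP_mult_right_ennreal)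
  also have "\<dots> = (SUP j. T m (F j) t)"
    unfolding T_def by (rule nn_integral_monotone_convergence_SUP)
      (use inc in \<open>auto simp: incseq_def le_fun_def intro!: mult_right_mono\<close>)
  finally show "(SUP j. T m (F j) t) = T m (\<lambda>s. SUP j. F j s) t" ..
qed

text \<open>The triangle inequality already holds for \<open>T m (rearr01 f) t\<close> at each
  single \<open>t\<close>, because the kernel decreases in \<open>s\<close>; afterwards only the
  norm \<open>N\<close> is involved.\<close>

theorem ri_norm_assoc_XmI:
  assumes X: "ri_norm X" and m: "m \<ge> 1"
  shows "ri_norm (assoc_XmI X m I)"
proof -
  define N where "N = associate_norm X"
  have N: "ri_norm N" unfolding N_def by (rule ri_norm_associate[OF X])
  have F: "assoc_XmI X m I f = N (T m (rearr01 f))" for f by (simp add: assoc_XmI_eq N_def)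
  have mono: "N (T m (rearr01 f)) \<le> N (T m (rearr01 g))"
    if "\<And>s. s \<in> {0<..<1} \<Longrightarrow> rearr01 f s \<le> rearr01 g s" for f g
    by (rule ri_norm_mono[OF N]) (auto intro!: T_mono that)
  obtain C where C: "\<And>f. f \<in> Mplus \<Longrightarrow> (\<integral>\<^sup>+x. f x \<partial>unit_leb) \<le> ennreal C * N f"
    using ri_norm_L1[OF N] by blast
  define D where "D = (\<Prod>j<m. 4 * 2 ^ j * I 1)"
  \<comment> \<open>\<open>max 0 C\<close> appears because (P5) does not assert that its constant is
    nonnegative.\<close>
  have L1: "(\<integral>\<^sup>+x. f x \<partial>unit_leb) \<le> ennreal (D * max 0 C) * assoc_XmI X m I f" if f: "f \<in> Mplus" for f
  proof -
    have D0: "0 \<le> D" unfolding D_def using I_pos[of 1] by (intro prod_nonneg) auto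
    have "(\<integral>\<^sup>+x. f x \<partial>unit_leb) = (\<integral>\<^sup>+x. rearr01 f x \<partial>unit_leb)"
      by (rule nn_integral_cong_dfun) (use f in \<open>auto simp: dfun_rearr01\<close>)
    also have "\<dots> \<le> ennreal D * (\<integral>\<^sup>+s. (R ^^ m) (rearr01 f) s \<partial>unit_leb)"
      unfolding D_def by (rule nn_integral_le_R_pow) (rule antimono_on_rearr)
    also have "\<dots> \<le> ennreal D * (\<integral>\<^sup>+s. T m (rearr01 f) s \<partial>unit_leb)"
      using m by (intro mult_left_mono nn_integral_mono) (auto intro!: R_pow_T(1))
    also have "\<dots> \<le> ennreal D * (ennreal C * N (T m (rearr01 f)))"
      by (intro mult_left_mono C) auto
    also have "\<dots> = ennreal (D * max 0 C) * assoc_XmI X m I f"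
      using D0 by (simp add: F ennreal_mult mult.assoc max_def ennreal_neg)
    finally show ?thesis .
  qed
  show ?thesis
    unfolding ri_norm_def
  proof (intro conjI ballI allI impI)
    fix f assume f: "f \<in> Mplus"
    show "(assoc_XmI X m I f = 0) = (AE x in unit_leb. f x = 0)"
    proof
      assume "assoc_XmI X m I f = 0"
      then have "(\<integral>\<^sup>+x. f x \<partial>unit_leb) = 0" using L1[OF f] by simp
      then show "AE x in unit_leb. f x = 0" using f by (simp add: nn_integral_0_iff_AE Mplus_iff)
    next
      assume "AE x in unit_leb. f x = 0"
      then have "rearr01 f s \<le> 0" if "s \<in> {0<..<1}" for s
        using that by (intro rearr01_upper_bound[OF f]) (auto elim!: eventually_mono)
      then have "T m (rearr01 f) t \<le> T m (\<lambda>_. 0) t" for t by (intro T_mono) auto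
      then have "T m (rearr01 f) t = 0" for t by (simp add: T_def)
      then show "assoc_XmI X m I f = 0"
        using ri_norm_zero_iff[OF N, of "T m (rearr01 f)"] by (simp add: F)
    qed
    show "assoc_XmI X m I (\<lambda>x. ennreal c * f x) = ennreal c * assoc_XmI X m I f" if "0 \<le> c" for c
    proof -
      have "rearr01 (\<lambda>x. ennreal c * f x) = (\<lambda>s. ennreal c * rearr01 f s)"
        using rearr01_cmult[OF f that] by auto
      then have "T m (rearr01 (\<lambda>x. ennreal c * f x)) = T m (\<lambda>s. ennreal c * rearr01 f s)"
        by (rule arg_cong)
      also have "\<dots> = (\<lambda>t. ennreal c * T m (rearr01 f) t)"
        by (rule ext) (simp add: T_cmult)
      finally show ?thesis using that by (simp add: F ri_norm_cmult[OF N])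
    qed
    fix g assume g: "g \<in> Mplus"
    show "assoc_XmI X m I (\<lambda>x. f x + g x) \<le> assoc_XmI X m I f + assoc_XmI X m I g"
    proof -
      have "N (T m (rearr01 (\<lambda>x. f x + g x))) \<le> N (\<lambda>t. T m (rearr01 f) t + T m (rearr01 g) t)"
        by (rule ri_norm_mono[OF N])
          (auto simp: T_def intro!: Mplus_add nn_integral_rearr01_add_le f g kern_antimono T_Mplus[unfolded T_def[abs_def]])
      also have "\<dots> \<le> N (T m (rearr01 f)) + N (T m (rearr01 g))"
        by (rule ri_norm_add[OF N]) auto
      finally show ?thesis by (simp add: F)
    qed
    show "assoc_XmI X m I f \<le> assoc_XmI X m I g" if "AE x in unit_leb. f x \<le> g x"
      unfolding F by (intro mono rearr01_mono_AE f g that)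
    show "assoc_XmI X m I f = assoc_XmI X m I g" if "\<forall>s\<in>{0<..<1}. rearr01 f s = rearr01 g s"
      unfolding F by (intro antisym mono) (use that in auto)
  next
    fix F' :: "nat \<Rightarrow> real \<Rightarrow> ennreal" and f
    assume F': "\<forall>j. F' j \<in> Mplus" and f: "f \<in> Mplus"
      and lim: "AE x in unit_leb. incseq (\<lambda>j. F' j x) \<and> (SUP j. F' j x) = f x"
    have F'M: "\<And>j. F' j \<in> Mplus" using F' by blast
    note r = rearr01_SUP[OF F'M f lim]
    show "incseq (\<lambda>j. assoc_XmI X m I (F' j))"
      unfolding F by (intro incseq_SucI mono) (use r(1) in \<open>auto simp: incseq_def\<close>)
    have "T m (rearr01 f) t = (SUP j. T m (rearr01 (F' j)) t)" for t
      using T_SUP(2)[OF rearr_Mplus r(1), of m t] r(2) by (simp add: fun_eq_iff)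
    then show "(SUP j. assoc_XmI X m I (F' j)) = assoc_XmI X m I f"
      unfolding F by (intro ri_norm_SUP[OF N]) (use T_SUP(1)[OF rearr_Mplus r(1)] in auto)
  next
    obtain K where K: "N (\<lambda>_. 1) = ennreal K" using ri_norm_one_pos[OF N] by blast
    have "T m (rearr01 (\<lambda>_. 1)) t \<le> 2 ^ (m * m) * ennreal (1 / a) ^ m * 1" if "t \<in> {0<..<1}" for t
    proof -
      have "T m (rearr01 (\<lambda>_. 1)) t \<le> 2 ^ (m * m) * (R ^^ m) (rearr01 (\<lambda>_. 1)) t"
        using R_pow_T(2) m that by auto
      also have "\<dots> \<le> 2 ^ (m * m) * (ennreal (1 / a) ^ m * 1)"
        by (intro mult_left_mono R_pow_le_const) (use that in \<open>auto intro!: rearr01_upper_bound\<close>)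
      finally show ?thesis by simp
    qed
    moreover have "2 ^ (m * m) * ennreal (1 / a) ^ m = ennreal (2 ^ (m * m) * (1 / a) ^ m)"
      using a_pos by (simp add: ennreal_mult ennreal_power[symmetric])
    ultimately have "assoc_XmI X m I (\<lambda>_. 1) \<le> N (\<lambda>_. ennreal (2 ^ (m * m) * (1 / a) ^ m) * 1)"
      unfolding F by (intro ri_norm_mono[OF N]) auto
    also have "\<dots> = ennreal (2 ^ (m * m) * (1 / a) ^ m) * N (\<lambda>_. 1)"
      by (rule ri_norm_cmult[OF N]) (use a_pos in auto)
    also have "\<dots> < \<infinity>" by (simp add: K ennreal_mult_less_top)
    finally show "assoc_XmI X m I (\<lambda>_. 1) < \<infinity>" .
    show "\<exists>C::real. \<forall>f\<in>Mplus. (\<integral>\<^sup>+x. f x \<partial>unit_leb) \<le> ennreal C * assoc_XmI X m I f"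
      using L1 by blast
  qed
qed

text \<open>Being a supremum of functionals \<open>f \<mapsto> \<integral> f\<^sup>* w\<close> with \<open>w\<close> decreasing, hence of linear functionals
  \<open>f \<mapsto> \<integral> f w'\<close> with \<open>w'\<close> equimeasurable with \<open>w\<close>, the functional is its own second associate.\<close>

theorem associate_twice_assoc_XmI:
  assumes X: "ri_norm X" and m: "m \<ge> 1" and f: "f \<in> Mplus"
  shows "associate_norm (associate_norm (assoc_XmI X m I)) f = assoc_XmI X m I f"
proof (rule antisym)
  interpret P: pair_sigma_finite unit_leb unit_leb ..
  let ?F = "assoc_XmI X m I"
  show "associate_norm (associate_norm ?F) f \<le> ?F f"
    by (rule associate_norm_twice_le[OF ri_norm_assoc_XmI[OF X m] f])
  show "?F f \<le> associate_norm (associate_norm ?F) f"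
    unfolding assoc_XmI_eq[of X m f]
  proof (rule associate_norm_least)
    fix \<phi> assume \<phi>: "\<phi> \<in> Mplus" "X \<phi> \<le> 1"
    have [measurable]: "\<phi> \<in> borel_measurable unit_leb" using \<phi> by (simp add: Mplus_iff)
    \<comment> \<open>The adjoint of \<open>T m\<close> applied to \<open>\<phi>\<close>; it
      inherits the decrease in \<open>s\<close> from the kernel, so resonance is available.\<close>
    define w where "w s = (\<integral>\<^sup>+t. \<phi> t * kern m t s \<partial>unit_leb)" for s
    have w: "antimono_on {0<..<1} w"
    proof (rule monotone_onI)
      fix x y :: real assume xy: "x \<in> {0<..<1}" "y \<in> {0<..<1}" "x \<le> y"
      have "kern m t y \<le> kern m t x" for t
        using monotone_onD[OF kern_antimono xy] .
      then show "w y \<le> w x" unfolding w_def by (intro nn_integral_mono mult_left_mono) auto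
    qed
    have dual: "(\<integral>\<^sup>+t. \<phi> t * T m (rearr01 p) t \<partial>unit_leb) = (\<integral>\<^sup>+s. rearr01 p s * w s \<partial>unit_leb)" for p
    proof -
      have [measurable]: "rearr01 p \<in> borel_measurable unit_leb"
        using rearr_Mplus[of unit_leb "\<lambda>x. enn2ereal (p x)"] by (simp add: Mplus_iff)
      have k1: "(\<lambda>s. kern m t s) \<in> borel_measurable unit_leb" for t using kern_Mplus[of m t] by (simp add: Mplus_iff)
      have "(\<integral>\<^sup>+t. \<phi> t * T m (rearr01 p) t \<partial>unit_leb) =
          (\<integral>\<^sup>+t. (\<integral>\<^sup>+s. \<phi> t * (rearr01 p s * kern m t s) \<partial>unit_leb) \<partial>unit_leb)"
        unfolding T_def using k1 by (intro nn_integral_cong nn_integral_cmult[symmetric]) auto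
      also have "\<dots> = (\<integral>\<^sup>+s. (\<integral>\<^sup>+t. \<phi> t * (rearr01 p s * kern m t s) \<partial>unit_leb) \<partial>unit_leb)"
        by (rule P.Fubini') measurable
      also have "\<dots> = (\<integral>\<^sup>+s. rearr01 p s * w s \<partial>unit_leb)"
      proof (rule nn_integral_cong)
        fix s assume s: "s \<in> space unit_leb"
        have [measurable]: "(\<lambda>t. kern m t s) \<in> borel_measurable unit_leb"
          using measurable_Pair1[OF kern_measurable s] by simp
        have "(\<integral>\<^sup>+t. \<phi> t * (rearr01 p s * kern m t s) \<partial>unit_leb) = (\<integral>\<^sup>+t. rearr01 p s * (\<phi> t * kern m t s) \<partial>unit_leb)"
          by (simp add: mult_ac)
        also have "\<dots> = rearr01 p s * w s" unfolding w_def by (rule nn_integral_cmult) measurable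
        finally show "(\<integral>\<^sup>+t. \<phi> t * (rearr01 p s * kern m t s) \<partial>unit_leb) = rearr01 p s * w s" .
      qed
      finally show ?thesis .
    qed
    \<comment> \<open>Aligned with the given \<open>f\<close>, while for any other \<open>p\<close>
      Hardy--Littlewood still bounds its pairing by that of the rearrangement with \<open>w\<close>.
      Hence \<open>w'\<close> is an admissible test function for the second associate norm.\<close>
    obtain w' where w': "w' \<in> Mplus" "\<And>l. dfun w' l = dfun w l"
      "(\<integral>\<^sup>+x. f x * w' x \<partial>unit_leb) = (\<integral>\<^sup>+x. rearr01 f x * w x \<partial>unit_leb)"
      by (rule resonance[OF f w]) blast
    have "associate_norm ?F w' \<le> 1"
    proof (rule associate_norm_least)
      fix p assume p: "p \<in> Mplus" "?F p \<le> 1"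
      have "(\<integral>\<^sup>+s. p s * w' s \<partial>unit_leb) \<le> (\<integral>\<^sup>+s. rearr01 p s * w s \<partial>unit_leb)"
        by (rule hardy_littlewood_antimono[OF p(1) w w'(1,2)])
      also have "\<dots> \<le> ?F p"
        unfolding assoc_XmI_eq dual[symmetric] using \<phi> by (rule associate_norm_upper)
      finally show "(\<integral>\<^sup>+s. p s * w' s \<partial>unit_leb) \<le> 1" using p(2) by (rule order_trans)
    qed
    with w'(1) have "(\<integral>\<^sup>+s. w' s * f s \<partial>unit_leb) \<le> associate_norm (associate_norm ?F) f"
      by (rule associate_norm_upper)
    then show "(\<integral>\<^sup>+t. \<phi> t * T m (rearr01 f) t \<partial>unit_leb) \<le> associate_norm (associate_norm ?F) f"
      using w'(3) by (simp add: dual mult.commute)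
  qed
qed

text \<open>The witness for the choice operator is the associate norm of the prescribed functional,
  since that functional is its own second associate.\<close>

theorem XmI_spec:
  assumes X: "ri_norm X" and m: "m \<ge> 1"
  shows "ri_norm (XmI X m I)"
    and "f \<in> Mplus \<Longrightarrow> associate_norm (XmI X m I) f = associate_norm X (T m (rearr01 f))"
proof -
  have "ri_norm (associate_norm (assoc_XmI X m I)) \<and>
     (\<forall>f\<in>Mplus. associate_norm (associate_norm (assoc_XmI X m I)) f = assoc_XmI X m I f)"
    using ri_norm_associate[OF ri_norm_assoc_XmI[OF X m]] associate_twice_assoc_XmI[OF X m] by blast
  then have "\<exists>Y. ri_norm Y \<and> (\<forall>f\<in>Mplus. associate_norm Y f = assoc_XmI X m I f)"
    by (intro exI[of _ "associate_norm (assoc_XmI X m I)"])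
  then have *: "ri_norm (XmI X m I) \<and> (\<forall>f\<in>Mplus. associate_norm (XmI X m I) f = assoc_XmI X m I f)"
    unfolding XmI_def by (rule someI_ex)
  then show "ri_norm (XmI X m I)" by blast
  show "associate_norm (XmI X m I) f = associate_norm X (T m (rearr01 f))" if "f \<in> Mplus"
    using * that by (simp add: assoc_XmI_eq)
qed

end

section \<open>Decreasing majorants\<close>

definition majorant :: "(real \<Rightarrow> ennreal) \<Rightarrow> real \<Rightarrow> ennreal" where
  "majorant u t = (SUP s\<in>{t..<1}. u s)"

lemma majorant_upper: "t \<le> s \<Longrightarrow> s < 1 \<Longrightarrow> u s \<le> majorant u t"
  unfolding majorant_def by (rule SUP_upper) auto

lemma majorant_antimono: "antimono_on A (majorant u)"
  unfolding monotone_on_def majorant_def by (auto intro!: SUP_subset_mono)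

lemma majorant_Mplus [simp]: "majorant u \<in> Mplus"
  by (rule antimono_on_Mplus) (rule majorant_antimono)

text \<open>Values of \<open>u\<close> above \<open>majorant u t\<close> can occur only to the left
  of \<open>t\<close>, on a set of measure at most \<open>t\<close>.\<close>

lemma rearr01_le_majorant:
  assumes u: "u \<in> Mplus" and t: "t \<in> {0<..<1}"
  shows "rearr01 u t \<le> majorant u t"
proof (rule ccontr)
  assume "\<not> rearr01 u t \<le> majorant u t"
  then have "ennreal t < dfun u (majorant u t)" using less_rearr01_iff[OF u] by (simp add: not_le)
  also have "\<dots> \<le> emeasure unit_leb {0<..<t}"
    unfolding dfun_def
  proof (rule emeasure_mono)
    show "{x \<in> {0<..<1}. majorant u t < u x} \<subseteq> {0<..<t}"
      using majorant_upper[of t _ u] by (auto simp: not_le[symmetric])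
    show "{0<..<t} \<in> sets unit_leb" using t by (auto simp: sets_unit_leb)
  qed
  also have "\<dots> = ennreal (t - 0)" by (rule emeasure_unit_leb_interval) (use t in auto)
  finally show False by simp
qed

lemma quasi_decreasingD:
  assumes "quasi_decreasing C u"
  shows "0 < C" "0 < b \<Longrightarrow> b < 1 \<Longrightarrow> b / 2 \<le> t \<Longrightarrow> t \<le> b \<Longrightarrow> u b \<le> ennreal C * u t"
  using assms by (auto simp: quasi_decreasing_def)

text \<open>A large value \<open>u b\<close> with \<open>b \<ge> t\<close> forces \<open>u\<close>
  to be at least \<open>u b / C\<close> on an interval of length \<open>b / 2 \<ge> t / 2\<close>.
  Taking a third instead of a half provides the strict inequality demanded by
  \<open>less_rearr01_iff\<close>.\<close>

lemma majorant_le_rearr01: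
  assumes u: "u \<in> Mplus" and q: "quasi_decreasing C u" and t: "t \<in> {0<..<1}"
  shows "majorant u t \<le> ennreal C * rearr01 u (t / 3)"
  unfolding majorant_def
proof (rule SUP_least, rule ccontr)
  fix b assume "b \<in> {t..<1}"
  then have b: "0 < b" "b < 1" "t \<le> b" using t by auto
  let ?l = "rearr01 u (t / 3)"
  assume "\<not> u b \<le> ennreal C * ?l"
  then have l: "ennreal C * ?l < u b" by simp
  have sub: "{b/2<..<b} \<subseteq> {x \<in> {0<..<1}. ?l < u x}"
  proof
    fix x assume x: "x \<in> {b/2<..<b}"
    then have "u b \<le> ennreal C * u x" using b by (intro quasi_decreasingD[OF q]) auto
    with l have "ennreal C * ?l < ennreal C * u x" by (rule less_le_trans)
    then have "?l < u x" by (metis linorder_not_le mult_left_mono zero_le)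
    then show "x \<in> {x \<in> {0<..<1}. ?l < u x}" using x b by auto
  qed
  have "ennreal (t / 3) < ennreal (b - b / 2)" using b t by (intro ennreal_lessI) auto
  also have "\<dots> = emeasure unit_leb {b/2<..<b}"
    by (rule emeasure_unit_leb_interval(2)[symmetric]) (use b in auto)
  also have "\<dots> \<le> dfun u ?l"
    unfolding dfun_def by (rule emeasure_mono[OF sub]) (use u in auto)
  finally show False using less_rearr01_iff[OF u, of ?l "t / 3"] by simp
qed

text \<open>The rearrangement at \<open>s / 3\<close> is a dilation. Substituting
  \<open>3 * s\<close> moves the dilation to the test function, whose rearrangement only grows when
  the argument shrinks; the substitution accounts for the factor 3.\<close>

lemma associate_norm_majorant:
  assumes X: "ri_norm X" and u: "u \<in> Mplus" and q: "quasi_decreasing C u"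
  shows "associate_norm X (majorant u) \<le> ennreal (3 * C) * associate_norm X u"
proof (rule associate_norm_least)
  fix \<phi> assume \<phi>: "\<phi> \<in> Mplus" "X \<phi> \<le> 1"
  have C: "0 < C" by (rule quasi_decreasingD[OF q])
  define g where "g t = rearr01 \<phi> t * rearr01 u (t / 3)" for t
  have g: "g \<in> Mplus"
    by (rule antimono_on_Mplus) (auto simp: g_def monotone_on_def intro!: mult_mono rearr_antimono)
  have [measurable]: "g \<in> borel_measurable unit_leb" "rearr01 \<phi> \<in> borel_measurable unit_leb"
    "rearr01 u \<in> borel_measurable unit_leb"
    using g rearr_Mplus[of unit_leb "\<lambda>x. enn2ereal (\<phi> x)"] rearr_Mplus[of unit_leb "\<lambda>x. enn2ereal (u x)"]
    by (auto simp: Mplus_iff)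
  have "(\<integral>\<^sup>+s. \<phi> s * majorant u s \<partial>unit_leb) \<le> (\<integral>\<^sup>+s. rearr01 \<phi> s * majorant u s \<partial>unit_leb)"
    by (rule hardy_littlewood_antimono[OF \<phi>(1) majorant_antimono]) auto
  also have "\<dots> \<le> (\<integral>\<^sup>+s. ennreal C * g s \<partial>unit_leb)"
  proof (rule nn_integral_mono)
    fix s assume "s \<in> space unit_leb"
    then have "majorant u s \<le> ennreal C * rearr01 u (s / 3)" by (intro majorant_le_rearr01[OF u q]) auto
    then have "rearr01 \<phi> s * majorant u s \<le> rearr01 \<phi> s * (ennreal C * rearr01 u (s / 3))"
      by (rule mult_left_mono) simp
    then show "rearr01 \<phi> s * majorant u s \<le> ennreal C * g s" by (simp add: g_def mult_ac)
  qed
  also have "\<dots> = ennreal C * (\<integral>\<^sup>+s. g s \<partial>unit_leb)" by (rule nn_integral_cmult) measurable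
  also have "\<dots> \<le> ennreal C * (ennreal 3 * associate_norm X u)"
  proof (rule mult_left_mono)
    have "(\<integral>\<^sup>+s. g s \<partial>unit_leb) = (\<integral>\<^sup>+s. g s * indicator {0<..<1} s \<partial>unit_leb)"
      by (rule nn_integral_cong) auto
    also have "\<dots> = ennreal 3 * (\<integral>\<^sup>+s. g (3 * s) * indicator {0<..<1 / 3} s \<partial>unit_leb)"
      by (rule nn_integral_unit_leb_scale[OF g]) auto
    also have "\<dots> \<le> ennreal 3 * (\<integral>\<^sup>+s. rearr01 \<phi> s * rearr01 u s \<partial>unit_leb)"
    proof (intro mult_left_mono nn_integral_mono)
      fix s assume "s \<in> space unit_leb"
      then have "rearr01 \<phi> (3 * s) \<le> rearr01 \<phi> s" by (intro rearr_antimono) auto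
      then show "g (3 * s) * indicator {0<..<1 / 3} s \<le> rearr01 \<phi> s * rearr01 u s"
        by (auto simp: g_def indicator_def intro: mult_right_mono)
    qed simp
    also have "(\<integral>\<^sup>+s. rearr01 \<phi> s * rearr01 u s \<partial>unit_leb) \<le> associate_norm X (rearr01 u)"
      by (rule associate_norm_upper) (use \<phi> X in \<open>auto simp: ri_norm_rearr01\<close>)
    also have "associate_norm X (rearr01 u) = associate_norm X u"
      by (rule ri_norm_rearr01[OF ri_norm_associate[OF X] u])
    finally show "(\<integral>\<^sup>+s. g s \<partial>unit_leb) \<le> ennreal 3 * associate_norm X u"
      by (simp only: mult_left_mono zero_le)
  qed simp
  also have "\<dots> = ennreal (3 * C) * associate_norm X u"
    using C by (simp add: ennreal_mult mult_ac)
  finally show "(\<integral>\<^sup>+s. \<phi> s * majorant u s \<partial>unit_leb) \<le> ennreal (3 * C) * associate_norm X u" .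
qed

text \<open>Replaces the supremum by an integral so that Fubini becomes applicable. For
  \<open>b < t\<close>, \<open>u b\<close> is averaged over the interval from \<open>b / 2\<close>
  to \<open>b\<close>, where \<open>r\<close> satisfies \<open>s < 2 * r\<close> and
  \<open>1 / b \<le> 1 / r\<close>; for \<open>b \<ge> t\<close> the last term suffices.\<close>

lemma majorant_pointwise:
  assumes u: "u \<in> Mplus" and q: "quasi_decreasing C u" and s: "0 < s" and t: "t < 1"
  shows "majorant u s \<le> (\<integral>\<^sup>+r. ennreal (2 * C / r) * u r * of_bool (s < 2 * r \<and> r < t) \<partial>unit_leb) + majorant u t"
  unfolding majorant_def[of u s]
proof (rule SUP_least)
  fix b assume "b \<in> {s..<1}"
  then have b: "s \<le> b" "0 < b" "b < 1" using s by auto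
  have C: "0 < C" by (rule quasi_decreasingD[OF q])
  show "u b \<le> (\<integral>\<^sup>+r. ennreal (2 * C / r) * u r * of_bool (s < 2 * r \<and> r < t) \<partial>unit_leb) + majorant u t"
  proof (cases "t \<le> b")
    case True
    then have "u b \<le> majorant u t" using b by (intro majorant_upper) auto
    then show ?thesis by (simp add: add_increasing)
  next
    case False
    have "u b = (ennreal (2 / b) * u b) * ennreal (b - b / 2)"
      using b by (simp add: mult_ac ennreal_mult[symmetric] mult.assoc[symmetric])
    also have "\<dots> = (\<integral>\<^sup>+r. (ennreal (2 / b) * u b) * indicator {b/2<..<b} r \<partial>unit_leb)"
      by (rule nn_integral_unit_leb_const_interval[symmetric]) (use b in auto)
    also have "\<dots> \<le> (\<integral>\<^sup>+r. ennreal (2 * C / r) * u r * of_bool (s < 2 * r \<and> r < t) \<partial>unit_leb)"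
    proof (rule nn_integral_mono)
      fix r assume "r \<in> space unit_leb"
      then have r: "0 < r" "r < 1" by auto
      show "(ennreal (2 / b) * u b) * indicator {b/2<..<b} r \<le> ennreal (2 * C / r) * u r * of_bool (s < 2 * r \<and> r < t)"
      proof (cases "r \<in> {b/2<..<b}")
        case True
        have "ennreal (2 / b) * u b \<le> ennreal (2 / r) * (ennreal C * u r)"
          using True b r by (intro mult_mono quasi_decreasingD[OF q] ennreal_leI divide_left_mono) auto
        also have "\<dots> = ennreal (2 * C / r) * u r"
          using C r by (simp add: mult.assoc[symmetric] ennreal_mult[symmetric])
        finally show ?thesis using True False b by auto
      qed simp
    qed
    finally show ?thesis by (simp add: add_increasing2)
  qed
qed

text \<open>After Fubini the inner integral over \<open>s < 2 * r\<close> contributes at most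
  \<open>2 * r\<close>, which cancels the denominator in \<open>2 * C / r\<close> and leaves
  \<open>4 * C\<close>.\<close>

lemma nn_integral_majorant:
  assumes u: "u \<in> Mplus" and q: "quasi_decreasing C u" and t: "t \<in> {0<..<1}"
  shows "(\<integral>\<^sup>+s. majorant u s * of_bool (s < t) \<partial>unit_leb) \<le>
     ennreal (4 * C) * (\<integral>\<^sup>+s. u s * of_bool (s < t) \<partial>unit_leb) + ennreal t * majorant u t"
proof -
  interpret P: pair_sigma_finite unit_leb unit_leb ..
  have C: "0 < C" by (rule quasi_decreasingD[OF q])
  have um [measurable]: "u \<in> borel_measurable unit_leb" using u by (simp add: Mplus_iff)
  let ?k = "\<lambda>s r. ennreal (2 * C / r) * u r * of_bool (s < 2 * r \<and> r < t)"
  have "(\<integral>\<^sup>+s. majorant u s * of_bool (s < t) \<partial>unit_leb) \<le>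
     (\<integral>\<^sup>+s. (\<integral>\<^sup>+r. ?k s r \<partial>unit_leb) + majorant u t * indicator {0<..<t} s \<partial>unit_leb)"
  proof (rule nn_integral_mono)
    fix s assume "s \<in> space unit_leb"
    then have s: "0 < s" "s < 1" by auto
    have "majorant u s \<le> (\<integral>\<^sup>+r. ?k s r \<partial>unit_leb) + majorant u t"
      by (rule majorant_pointwise[OF u q]) (use s t in auto)
    then show "majorant u s * of_bool (s < t) \<le> (\<integral>\<^sup>+r. ?k s r \<partial>unit_leb) + majorant u t * indicator {0<..<t} s"
      using s by (cases "s < t") auto
  qed
  also have "\<dots> = (\<integral>\<^sup>+s. (\<integral>\<^sup>+r. ?k s r \<partial>unit_leb) \<partial>unit_leb) + (\<integral>\<^sup>+s. majorant u t * indicator {0<..<t} s \<partial>unit_leb)"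
    by (rule nn_integral_add) measurable
  also have "(\<integral>\<^sup>+s. majorant u t * indicator {0<..<t} s \<partial>unit_leb) = majorant u t * ennreal (t - 0)"
    by (rule nn_integral_unit_leb_const_interval) (use t in auto)
  also have "(\<integral>\<^sup>+s. (\<integral>\<^sup>+r. ?k s r \<partial>unit_leb) \<partial>unit_leb) = (\<integral>\<^sup>+r. (\<integral>\<^sup>+s. ?k s r \<partial>unit_leb) \<partial>unit_leb)"
    by (rule P.Fubini') measurable
  also have "\<dots> \<le> (\<integral>\<^sup>+r. ennreal (4 * C) * (u r * of_bool (r < t)) \<partial>unit_leb)"
  proof (rule nn_integral_mono)
    fix r assume "r \<in> space unit_leb"
    then have r: "0 < r" "r < 1" by auto
    have "(\<integral>\<^sup>+s. ?k s r \<partial>unit_leb) = (\<integral>\<^sup>+s. (ennreal (2 * C / r) * u r * of_bool (r < t)) * indicator {0<..<min 1 (2 * r)} s \<partial>unit_leb)"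
      by (rule nn_integral_cong) (auto simp: indicator_def)
    also have "\<dots> = (ennreal (2 * C / r) * u r * of_bool (r < t)) * ennreal (min 1 (2 * r) - 0)"
      by (rule nn_integral_unit_leb_const_interval) (use r in auto)
    also have "\<dots> \<le> (ennreal (2 * C / r) * u r * of_bool (r < t)) * ennreal (2 * r)"
      by (intro mult_left_mono ennreal_leI) auto
    also have "\<dots> = (ennreal (2 * C / r) * ennreal (2 * r)) * (u r * of_bool (r < t))"
      by (simp only: mult_ac)
    also have "ennreal (2 * C / r) * ennreal (2 * r) = ennreal (4 * C)"
      using r C by (simp add: ennreal_mult[symmetric])
    finally show "(\<integral>\<^sup>+s. ?k s r \<partial>unit_leb) \<le> ennreal (4 * C) * (u r * of_bool (r < t))" .
  qed
  also have "\<dots> = ennreal (4 * C) * (\<integral>\<^sup>+s. u s * of_bool (s < t) \<partial>unit_leb)"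
    by (rule nn_integral_cmult) measurable
  finally show ?thesis by (simp add: add_right_mono mult.commute)
qed

section \<open>Rearranging before applying the operators\<close>

context hardy_weight
begin

text \<open>Averaging over the interval from \<open>t / 2\<close> to \<open>t\<close>, whose length
  \<open>t / 2\<close> explains the factor 2.\<close>

lemma J_mult_le_R:
  assumes u: "u \<in> Mplus" and q: "quasi_decreasing C u" and t: "t \<in> {0<..<1}"
  shows "ennreal t * J t * u t \<le> ennreal (2 * C) * R u t"
proof -
  have C: "0 < C" by (rule quasi_decreasingD[OF q])
  have [measurable]: "u \<in> borel_measurable unit_leb" using u by (simp add: Mplus_iff)
  have "u t * ennreal (t - t / 2) = (\<integral>\<^sup>+s. u t * indicator {t/2<..<t} s \<partial>unit_leb)"
    by (rule nn_integral_unit_leb_const_interval[symmetric]) (use t in auto)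
  also have "\<dots> \<le> (\<integral>\<^sup>+s. ennreal C * (u s * of_bool (s < t)) \<partial>unit_leb)"
    using t by (intro nn_integral_mono) (auto simp: indicator_def intro!: quasi_decreasingD[OF q])
  also have "\<dots> = ennreal C * (\<integral>\<^sup>+s. u s * of_bool (s < t) \<partial>unit_leb)"
    by (rule nn_integral_cmult) measurable
  finally have "(2 * J t) * (u t * ennreal (t - t / 2)) \<le> (2 * J t) * (ennreal C * (\<integral>\<^sup>+s. u s * of_bool (s < t) \<partial>unit_leb))"
    by (rule mult_left_mono) simp
  moreover have "2 * ennreal (t - t / 2) = ennreal t"
    using t by (simp add: ennreal_mult[symmetric] ennreal_numeral[symmetric] del: ennreal_numeral)
  then have "(2 * J t) * (u t * ennreal (t - t / 2)) = ennreal t * J t * u t"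
    by (metis mult.assoc mult.commute)
  moreover have "(2 * J t) * (ennreal C * (\<integral>\<^sup>+s. u s * of_bool (s < t) \<partial>unit_leb)) = ennreal (2 * C) * R u t"
    using C by (simp add: R_def ennreal_mult mult_ac)
  ultimately show ?thesis by simp
qed

lemma ennreal_near_SUP:
  fixes f :: "'b \<Rightarrow> ennreal"
  assumes "(SUP x\<in>A. f x) \<noteq> 0" "(SUP x\<in>A. f x) \<noteq> top"
  obtains x where "x \<in> A" "(SUP x\<in>A. f x) \<le> 2 * f x"
proof -
  obtain M where M: "(SUP x\<in>A. f x) = ennreal M" "0 < M"
    using assms by (cases "SUP x\<in>A. f x") (auto simp: less_le)
  then have "ennreal (M / 2) < (SUP x\<in>A. f x)" by (simp add: ennreal_lessI)
  then obtain x where x: "x \<in> A" "ennreal (M / 2) < f x" by (auto simp: less_SUP_iff)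
  have "ennreal M = 2 * ennreal (M / 2)"
    using M by (simp add: ennreal_mult[symmetric] ennreal_numeral[symmetric] del: ennreal_numeral)
  also have "\<dots> \<le> 2 * f x" using x by (intro mult_left_mono) auto
  finally show thesis using that x M by simp
qed

text \<open>In the induction step the point \<open>s\<close> nearly maximises \<open>R\<^sup>h\<^sup>+\<^sup>1 v\<close> on \<open>[t,1)\<close>; this choice absorbs the
  term produced by the induction hypothesis.\<close>

lemma J_mult_majorant_le:
  "\<exists>D\<ge>0. \<forall>v B. antimono_on {0<..<1} v \<longrightarrow> (\<forall>s\<in>{0<..<1}. v s \<le> ennreal B) \<longrightarrow>
     (\<forall>t\<in>{0<..<1}. ennreal t * J t * majorant ((R ^^ h) v) t \<le> ennreal D * majorant ((R ^^ Suc h) v) t)"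
proof (induction h)
  case 0
  show ?case
  proof (intro exI[of _ 2] conjI allI impI ballI)
    fix v :: "real \<Rightarrow> ennreal" and B t :: real
    assume v: "antimono_on {0<..<1} v" and t: "t \<in> {0<..<1}"
    have vM: "v \<in> Mplus" by (rule antimono_on_Mplus[OF v])
    have "majorant v t \<le> v t"
      unfolding majorant_def by (rule SUP_least) (use v t in \<open>auto simp: monotone_on_def\<close>)
    then have "ennreal t * J t * majorant v t \<le> ennreal t * J t * v t" by (rule mult_left_mono) simp
    also have "\<dots> \<le> ennreal (2 * 1) * R v t"
      by (rule J_mult_le_R[OF vM quasi_decreasing_antimono[OF v] t])
    also have "\<dots> \<le> ennreal (2 * 1) * majorant (R v) t"
      by (intro mult_left_mono majorant_upper) (use t in auto)
    finally show "ennreal t * J t * majorant ((R ^^ 0) v) t \<le> ennreal 2 * majorant ((R ^^ Suc 0) v) t"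
      by simp
  qed simp
next
  case (Suc h)
  then obtain D where D: "0 \<le> D" and IH: "\<And>v B t. antimono_on {0<..<1} v \<Longrightarrow> (\<And>s. s \<in> {0<..<1} \<Longrightarrow> v s \<le> ennreal B) \<Longrightarrow>
     t \<in> {0<..<1} \<Longrightarrow> ennreal t * J t * majorant ((R ^^ h) v) t \<le> ennreal D * majorant ((R ^^ Suc h) v) t"
    by blast
  \<comment> \<open>The constant of \<open>J_mult_le_R\<close> for the iterate \<open>Suc h\<close>,
    which is quasi-decreasing with constant \<open>2 ^ Suc h\<close>.\<close>
  define E :: real where "E = 2 * 2 ^ Suc h"
  have E: "0 \<le> E" by (simp add: E_def)
  show ?case
  proof (intro exI[of _ "2 * (E + 2 * D * E)"] conjI allI impI ballI)
    show "0 \<le> 2 * (E + 2 * D * E)" using D E by simp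
    fix v :: "real \<Rightarrow> ennreal" and B t :: real
    assume v: "antimono_on {0<..<1} v" and B: "\<forall>s\<in>{0<..<1}. v s \<le> ennreal B" and t: "t \<in> {0<..<1}"
    define f where "f j = (R ^^ j) v" for j
    have fM: "f j \<in> Mplus" for j unfolding f_def by (rule R_pow_Mplus[OF antimono_on_Mplus[OF v]])
    have fS: "f (Suc j) = R (f j)" for j by (simp add: f_def)
    define M where "M = majorant (f (Suc h)) t"
    have A: "ennreal s * J s * f (Suc h) s \<le> ennreal E * f (Suc (Suc h)) s" if "s \<in> {0<..<1}" for s
      unfolding E_def fS[of "Suc h"]
      by (rule J_mult_le_R[OF fM _ that]) (use quasi_decreasing_R_pow[OF v, of "Suc h"] in \<open>simp add: f_def\<close>)
    \<comment> \<open>The bound \<open>B\<close> on \<open>v\<close> enters here only qualitatively: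
      a near maximiser exists only for a finite supremum.\<close>
    have "M \<noteq> top"
    proof -
      have "M \<le> ennreal (1 / a) ^ Suc h * ennreal B"
        unfolding M_def majorant_def f_def
        by (rule SUP_least, rule R_pow_le_const) (use B t in auto)
      also have "\<dots> < top" by (simp add: ennreal_power[symmetric] ennreal_mult_less_top power_less_top_ennreal)
      finally show ?thesis by simp
    qed
    have "ennreal t * J t * M \<le> ennreal (2 * (E + 2 * D * E)) * majorant (f (Suc (Suc h))) t"
    proof (cases "M = 0")
      case False
      obtain s where s: "s \<in> {t..<1}" "M \<le> 2 * f (Suc h) s"
        using ennreal_near_SUP[of "f (Suc h)" "{t..<1}"] False \<open>M \<noteq> top\<close>
        unfolding M_def majorant_def by blast
      have s01: "s \<in> {0<..<1}" and ts: "t \<le> s" using s t by auto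
      define g where "g = majorant (f h) t"
      have [measurable]: "f h \<in> borel_measurable unit_leb" using fM by (simp add: Mplus_iff)
      \<comment> \<open>The integral up to \<open>s\<close> is split at \<open>t\<close>; beyond
        \<open>t\<close> the integrand is at most the majorant value \<open>g\<close>.\<close>
      have "(\<integral>\<^sup>+x. f h x * of_bool (x < s) \<partial>unit_leb) \<le>
          (\<integral>\<^sup>+x. f h x * of_bool (x < t) + g * indicator {0<..<s} x \<partial>unit_leb)"
      proof (rule nn_integral_mono)
        fix x assume "x \<in> space unit_leb"
        then have "0 < x" "x < 1" by auto
        then show "f h x * of_bool (x < s) \<le> f h x * of_bool (x < t) + g * indicator {0<..<s} x"
          using majorant_upper[of t x "f h"] by (cases "x < t"; cases "x < s") (auto simp: g_def)
      qed
      also have "\<dots> = (\<integral>\<^sup>+x. f h x * of_bool (x < t) \<partial>unit_leb) + (\<integral>\<^sup>+x. g * indicator {0<..<s} x \<partial>unit_leb)"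
        by (rule nn_integral_add) measurable
      also have "(\<integral>\<^sup>+x. g * indicator {0<..<s} x \<partial>unit_leb) = g * ennreal (s - 0)"
        by (rule nn_integral_unit_leb_const_interval) (use s01 in auto)
      finally have "f (Suc h) s \<le> J s * ((\<integral>\<^sup>+x. f h x * of_bool (x < t) \<partial>unit_leb) + g * ennreal s)"
        unfolding fS R_def by (intro mult_left_mono) auto
      also have "\<dots> \<le> f (Suc h) t + J s * (g * ennreal s)"
        unfolding fS R_def distrib_left using t ts s01 by (intro add_mono mult_right_mono J_antimono) auto
      finally have fs: "f (Suc h) s \<le> f (Suc h) t + J s * (g * ennreal s)" .
      \<comment> \<open>The induction hypothesis returns the supremum \<open>M\<close>, which the
        choice of \<open>s\<close> turns back into the value at \<open>s\<close>. The remaining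
        factor \<open>s * J s\<close> then raises that value to the next iterate by
        \<open>A\<close>.\<close>
      have "ennreal t * J t * g \<le> ennreal D * M"
        unfolding g_def M_def f_def by (rule IH[OF v _ t]) (use B in auto)
      also have "\<dots> \<le> ennreal D * (2 * f (Suc h) s)" by (rule mult_left_mono[OF s(2)]) simp
      finally have g: "ennreal t * J t * g \<le> ennreal D * (2 * f (Suc h) s)" .
      have mt: "f (Suc (Suc h)) x \<le> majorant (f (Suc (Suc h))) t" if "t \<le> x" "x < 1" for x
        using that by (rule majorant_upper)
      have "ennreal t * J t * f (Suc h) s \<le> ennreal t * J t * (f (Suc h) t + J s * (g * ennreal s))"
        by (rule mult_left_mono[OF fs]) simp
      also have "\<dots> = ennreal t * J t * f (Suc h) t + (ennreal s * J s) * (ennreal t * J t * g)"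
        by (simp add: distrib_left mult_ac)
      also have "\<dots> \<le> ennreal E * f (Suc (Suc h)) t + (ennreal s * J s) * (ennreal D * (2 * f (Suc h) s))"
        by (intro add_mono mult_left_mono g A t) auto
      also have "(ennreal s * J s) * (ennreal D * (2 * f (Suc h) s)) = (ennreal D * 2) * (ennreal s * J s * f (Suc h) s)"
        by (simp only: mult_ac)
      also have "\<dots> \<le> (ennreal D * 2) * (ennreal E * f (Suc (Suc h)) s)"
        by (intro mult_left_mono A s01) auto
      also have "ennreal E * f (Suc (Suc h)) t + (ennreal D * 2) * (ennreal E * f (Suc (Suc h)) s) \<le>
          ennreal E * majorant (f (Suc (Suc h))) t + (ennreal D * 2) * (ennreal E * majorant (f (Suc (Suc h))) t)"
        by (intro add_mono mult_left_mono mt) (use t ts s01 in auto)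
      also have "\<dots> = ennreal (E + 2 * D * E) * majorant (f (Suc (Suc h))) t"
        using D E by (simp add: ennreal_plus ennreal_mult distrib_right distrib_left mult_ac)
      finally have fin: "ennreal t * J t * f (Suc h) s \<le> ennreal (E + 2 * D * E) * majorant (f (Suc (Suc h))) t" by simp
      have "ennreal t * J t * M \<le> ennreal t * J t * (2 * f (Suc h) s)" by (rule mult_left_mono[OF s(2)]) simp
      also have "\<dots> = 2 * (ennreal t * J t * f (Suc h) s)" by (simp only: mult_ac)
      also have "\<dots> \<le> 2 * (ennreal (E + 2 * D * E) * majorant (f (Suc (Suc h))) t)"
        by (rule mult_left_mono[OF fin]) simp
      also have "\<dots> = ennreal (2 * (E + 2 * D * E)) * majorant (f (Suc (Suc h))) t"
        by (subst ennreal_mult') (simp_all only: ennreal_numeral mult.assoc zero_le_numeral)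
      finally show ?thesis .
    qed simp
    then show "ennreal t * J t * majorant ((R ^^ Suc h) v) t \<le>
        ennreal (2 * (E + 2 * D * E)) * majorant ((R ^^ Suc (Suc h)) v) t"
      by (simp only: M_def f_def)
  qed
qed

text \<open>\<open>K\<close> is chosen before \<open>X\<close>, \<open>v\<close> and
  \<open>B\<close>: uniformity in \<open>X\<close> permits a change of norm in the induction on
  \<open>k\<close>, and independence of \<open>B\<close> permits truncation.\<close>

lemma associate_norm_R_rearr01:
  "\<exists>K\<ge>0. \<forall>X v B. ri_norm X \<longrightarrow> antimono_on {0<..<1} v \<longrightarrow> (\<forall>s\<in>{0<..<1}. v s \<le> ennreal B) \<longrightarrow>
     associate_norm X (R (rearr01 ((R ^^ h) v))) \<le> ennreal K * associate_norm X ((R ^^ Suc h) v)"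
proof -
  obtain D where D: "0 \<le> D" "\<And>v B t. antimono_on {0<..<1} v \<Longrightarrow> (\<And>s. s \<in> {0<..<1} \<Longrightarrow> v s \<le> ennreal B) \<Longrightarrow>
     t \<in> {0<..<1} \<Longrightarrow> ennreal t * J t * majorant ((R ^^ h) v) t \<le> ennreal D * majorant ((R ^^ Suc h) v) t"
    using J_mult_majorant_le[of h] by blast
  \<comment> \<open>\<open>4 * 2 ^ h\<close> comes from integrating the majorant of the
    \<open>h\<close>-th iterate, \<open>D\<close> from its boundary term at
    \<open>t\<close>.\<close>
  define L :: real where "L = 4 * 2 ^ h + D"
  have L: "0 \<le> L" using D by (simp add: L_def)
  show ?thesis
  proof (intro exI[of _ "L * (3 * 2 ^ Suc h)"] conjI allI impI)
    show "0 \<le> L * (3 * 2 ^ Suc h)" using L by simp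
    fix X and v :: "real \<Rightarrow> ennreal" and B :: real
    assume X: "ri_norm X" and v: "antimono_on {0<..<1} v" and B: "\<forall>s\<in>{0<..<1}. v s \<le> ennreal B"
    let ?u = "(R ^^ h) v" and ?w = "(R ^^ Suc h) v"
    have uM: "?u \<in> Mplus" and wM: "?w \<in> Mplus" by (rule R_pow_Mplus[OF antimono_on_Mplus[OF v]])+
    have "R (rearr01 ?u) t \<le> ennreal L * majorant ?w t" if t: "t \<in> {0<..<1}" for t
    proof -
      have "R (rearr01 ?u) t \<le> R (majorant ?u) t"
        by (rule R_mono) (rule rearr01_le_majorant[OF uM])
      also have "\<dots> \<le> J t * (ennreal (4 * 2 ^ h) * (\<integral>\<^sup>+s. ?u s * of_bool (s < t) \<partial>unit_leb) + ennreal t * majorant ?u t)"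
        unfolding R_def[of "majorant ?u"]
        by (intro mult_left_mono nn_integral_majorant[OF uM quasi_decreasing_R_pow[OF v] t]) auto
      also have "\<dots> = ennreal (4 * 2 ^ h) * ?w t + ennreal t * J t * majorant ?u t"
        by (simp add: R_def distrib_left mult_ac)
      also have "\<dots> \<le> ennreal (4 * 2 ^ h) * majorant ?w t + ennreal D * majorant ?w t"
        by (intro add_mono mult_left_mono majorant_upper D(2)[OF v _ t]) (use t B in auto)
      also have "\<dots> = ennreal L * majorant ?w t"
        using D unfolding L_def by (subst ennreal_plus) (auto simp: distrib_right)
      finally show ?thesis .
    qed
    then have "associate_norm X (R (rearr01 ?u)) \<le> associate_norm X (\<lambda>t. ennreal L * majorant ?w t)"
      by (rule associate_norm_mono)
    also have "\<dots> = ennreal L * associate_norm X (majorant ?w)" by (rule associate_norm_cmult) simp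
    also have "\<dots> \<le> ennreal L * (ennreal (3 * 2 ^ Suc h) * associate_norm X ?w)"
      by (intro mult_left_mono associate_norm_majorant[OF X wM quasi_decreasing_R_pow[OF v]]) auto
    also have "\<dots> = ennreal (L * (3 * 2 ^ Suc h)) * associate_norm X ?w"
      using L by (subst (2) ennreal_mult) (auto simp: mult.assoc)
    finally show "associate_norm X (R (rearr01 ?u)) \<le> ennreal (L * (3 * 2 ^ Suc h)) * associate_norm X ?w" .
  qed
qed

section \<open>Iterates of the operator on rearranged functions\<close>

lemma R_le_R_rearr01:
  assumes u: "u \<in> Mplus"
  shows "R u t \<le> R (rearr01 u) t"
proof -
  have w: "antimono_on {0<..<1} (\<lambda>s. of_bool (s < t) :: ennreal)" by (auto simp: monotone_on_def)
  show ?thesis unfolding R_def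
    by (rule mult_left_mono, rule hardy_littlewood_antimono[OF u w antimono_on_Mplus[OF w]]) auto
qed

text \<open>False for \<open>k = 0\<close>, as a function need not lie below its rearrangement. The
  innermost \<open>R\<close> integrates over an initial interval, where Hardy--Littlewood applies;
  the outer ones are monotone.\<close>

lemma R_pow_le_R_pow_rearr01:
  assumes u: "u \<in> Mplus" and k: "k \<ge> 1" and t: "t \<in> {0<..<1}"
  shows "(R ^^ k) u t \<le> (R ^^ k) (rearr01 u) t"
proof -
  obtain j where j: "k = Suc j" using k by (cases k) auto
  show ?thesis unfolding j funpow_Suc_right comp_def
    by (rule R_pow_mono[OF R_le_R_rearr01[OF u] t])
qed

lemma associate_norm_R_pow_rearr01:
  assumes "k \<ge> 1"
  shows "\<exists>K\<ge>0. \<forall>X v B. ri_norm X \<longrightarrow> antimono_on {0<..<1} v \<longrightarrow> (\<forall>s\<in>{0<..<1}. v s \<le> ennreal B) \<longrightarrow>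
     associate_norm X ((R ^^ k) (rearr01 ((R ^^ h) v))) \<le> ennreal K * associate_norm X ((R ^^ (k + h)) v)"
  using assms
proof (induction k rule: dec_induct)
  case base
  then show ?case using associate_norm_R_rearr01[of h] by simp
next
  case (step k)
  obtain K where K: "0 \<le> K" "\<And>X v B. ri_norm X \<Longrightarrow> antimono_on {0<..<1} v \<Longrightarrow> (\<And>s. s \<in> {0<..<1} \<Longrightarrow> v s \<le> ennreal B) \<Longrightarrow>
     associate_norm X ((R ^^ k) (rearr01 ((R ^^ h) v))) \<le> ennreal K * associate_norm X ((R ^^ (k + h)) v)"
    using step.IH by blast
  obtain K' where K': "0 \<le> K'" "\<And>X v B. ri_norm X \<Longrightarrow> antimono_on {0<..<1} v \<Longrightarrow> (\<And>s. s \<in> {0<..<1} \<Longrightarrow> v s \<le> ennreal B) \<Longrightarrow>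
     associate_norm X (R (rearr01 ((R ^^ (k + h)) v))) \<le> ennreal K' * associate_norm X ((R ^^ Suc (k + h)) v)"
    using associate_norm_R_rearr01[of "k + h"] by blast
  show ?case
  proof (intro exI[of _ "K * K'"] conjI allI impI)
    show "0 \<le> K * K'" using K K' by simp
    fix X and v :: "real \<Rightarrow> ennreal" and B :: real
    assume X: "ri_norm X" and v: "antimono_on {0<..<1} v" and B: "\<forall>s\<in>{0<..<1}. v s \<le> ennreal B"
    let ?X1 = "XmI X 1 I"
    have X1: "ri_norm ?X1" by (rule XmI_spec[OF X]) simp
    have X1': "associate_norm ?X1 f = associate_norm X (R (rearr01 f))" if "f \<in> Mplus" for f
      using XmI_spec(2)[OF X _ that, of 1] by (simp add: R_eq_T)
    let ?g = "(R ^^ k) (rearr01 ((R ^^ h) v))" and ?w = "(R ^^ (k + h)) v"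
    have gM: "?g \<in> Mplus" and wM: "?w \<in> Mplus" using R_pow_Mplus antimono_on_Mplus[OF v] by auto
    \<comment> \<open>Rearranging \<open>?g\<close> under the outermost \<open>R\<close> hides that
      operator in the associate norm of \<open>?X1\<close>, to which the induction hypothesis
      applies.\<close>
    have "associate_norm X ((R ^^ Suc k) (rearr01 ((R ^^ h) v))) \<le> associate_norm X (R (rearr01 ?g))"
      by (rule associate_norm_mono) (use R_le_R_rearr01[OF gM] in simp)
    also have "\<dots> = associate_norm ?X1 ?g" by (rule X1'[OF gM, symmetric])
    also have "\<dots> \<le> ennreal K * associate_norm ?X1 ?w"
      by (rule K(2)[OF X1 v]) (use B in auto)
    \<comment> \<open>Unfolding that norm releases the hidden \<open>R\<close>, now in front of a
      rearranged iterate of order \<open>k + h\<close>; this is the case of a single outer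
      operator.\<close>
    also have "associate_norm ?X1 ?w = associate_norm X (R (rearr01 ?w))" by (rule X1'[OF wM])
    also have "\<dots> \<le> ennreal K' * associate_norm X ((R ^^ Suc (k + h)) v)"
      by (rule K'(2)[OF X v]) (use B in auto)
    finally show "associate_norm X ((R ^^ Suc k) (rearr01 ((R ^^ h) v))) \<le>
        ennreal (K * K') * associate_norm X ((R ^^ (Suc k + h)) v)"
      using K(1) K'(1) by (simp add: ennreal_mult mult_left_mono mult.assoc)
  qed
qed

section \<open>Reiteration\<close>

lemma T_le_R_pow:
  assumes "u \<in> Mplus" "m \<ge> 1" "t \<in> {0<..<1}"
  shows "T m u t \<le> ennreal (2 ^ (m * m)) * (R ^^ m) u t"
  using R_pow_T(2)[OF assms] by (simp add: ennreal_power[symmetric])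

lemma associate_norm_XmI_XmI:
  assumes X: "ri_norm X" and k: "k \<ge> 1" and h: "h \<ge> 1" and f: "f \<in> Mplus"
  shows "associate_norm (XmI (XmI X k I) h I) f = associate_norm X (T k (rearr01 (T h (rearr01 f))))"
  using XmI_spec(2)[OF XmI_spec(1)[OF X k] h f] XmI_spec(2)[OF X k, of "T h (rearr01 f)"] by simp

text \<open>The easy direction. Only passing from \<open>T (k + h)\<close> to the iterate of
  \<open>R\<close> costs a constant.\<close>

lemma associate_norm_reiteration_ge:
  assumes X: "ri_norm X" and k: "k \<ge> 1" and h: "h \<ge> 1" and f: "f \<in> Mplus"
  shows "associate_norm (XmI X (k + h) I) f \<le>
    ennreal (2 ^ ((k + h) * (k + h))) * associate_norm (XmI (XmI X k I) h I) f"
proof -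
  let ?C = "ennreal (2 ^ ((k + h) * (k + h)))" and ?u = "(R ^^ h) (rearr01 f)"
  have uM: "?u \<in> Mplus" by simp
  have "T (k + h) (rearr01 f) t \<le> ?C * T k (rearr01 (T h (rearr01 f))) t" if t: "t \<in> {0<..<1}" for t
  proof -
    have "T (k + h) (rearr01 f) t \<le> ?C * (R ^^ (k + h)) (rearr01 f) t"
      by (rule T_le_R_pow) (use k t in auto)
    also have "(R ^^ (k + h)) (rearr01 f) t = (R ^^ k) ?u t" by (simp add: funpow_add)
    also have "\<dots> \<le> (R ^^ k) (rearr01 ?u) t" by (rule R_pow_le_R_pow_rearr01[OF uM k t])
    also have "\<dots> \<le> T k (rearr01 ?u) t" by (rule R_pow_T(1)[OF _ k t]) simp
    also have "\<dots> \<le> T k (rearr01 (T h (rearr01 f))) t"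
      by (rule T_mono, rule rearr01_mono_AE) (use h in \<open>auto intro!: AE_I2 R_pow_T(1)\<close>)
    finally show ?thesis by (simp add: mult_left_mono)
  qed
  then have "associate_norm X (T (k + h) (rearr01 f)) \<le> associate_norm X (\<lambda>t. ?C * T k (rearr01 (T h (rearr01 f))) t)"
    by (rule associate_norm_mono)
  also have "\<dots> = ?C * associate_norm X (T k (rearr01 (T h (rearr01 f))))"
    by (rule associate_norm_cmult) simp
  finally show ?thesis
    using XmI_spec(2)[OF X _ f, of "k + h"] k by (simp add: associate_norm_XmI_XmI[OF X k h f])
qed

text \<open>The hard direction, first for bounded \<open>f\<close>, where the majorant estimates are
  available, then for all \<open>f\<close> by truncation, since the constant does not involve the
  bound.\<close>

lemma associate_norm_reiteration_le:
  assumes X: "ri_norm X" and k: "k \<ge> 1" and h: "h \<ge> 1"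
  shows "\<exists>K\<ge>0. \<forall>f\<in>Mplus. associate_norm (XmI (XmI X k I) h I) f \<le> ennreal K * associate_norm (XmI X (k + h) I) f"
proof -
  let ?Z = "XmI (XmI X k I) h I" and ?W = "XmI X (k + h) I"
  have Z: "ri_norm ?Z" and W: "ri_norm ?W" using XmI_spec(1) X k h by auto
  obtain K where K: "0 \<le> K" "\<And>X v B. ri_norm X \<Longrightarrow> antimono_on {0<..<1} v \<Longrightarrow> (\<And>s. s \<in> {0<..<1} \<Longrightarrow> v s \<le> ennreal B) \<Longrightarrow>
     associate_norm X ((R ^^ k) (rearr01 ((R ^^ h) v))) \<le> ennreal K * associate_norm X ((R ^^ (k + h)) v)"
    using associate_norm_R_pow_rearr01[OF k, of h] by blast
  define Ch :: real where "Ch = 2 ^ (h * h)"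
  define Ck :: real where "Ck = 2 ^ (k * k)"
  have C0: "0 \<le> Ch" "0 \<le> Ck" by (auto simp: Ch_def Ck_def)
  have bounded: "associate_norm ?Z f \<le> ennreal (Ch * Ck * K) * associate_norm ?W f"
    if f: "f \<in> Mplus" and B: "\<And>x. f x \<le> ennreal B" for f B
  proof -
    let ?u = "(R ^^ h) (rearr01 f)"
    have uM: "?u \<in> Mplus" by simp
    have "T k (rearr01 (T h (rearr01 f))) t \<le> ennreal (Ch * Ck) * (R ^^ k) (rearr01 ?u) t" if t: "t \<in> {0<..<1}" for t
    proof -
      have "rearr01 (T h (rearr01 f)) s \<le> ennreal Ch * rearr01 ?u s" for s
      proof -
        have "rearr01 (T h (rearr01 f)) s \<le> rearr01 (\<lambda>x. ennreal Ch * ?u x) s"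
          by (rule rearr01_mono_AE)
            (use h in \<open>auto simp: Ch_def intro!: AE_I2 T_le_R_pow Mplus_mult\<close>)
        also have "\<dots> = ennreal Ch * rearr01 ?u s" by (rule rearr01_cmult[OF uM C0(1)])
        finally show ?thesis .
      qed
      then have "T k (rearr01 (T h (rearr01 f))) t \<le> T k (\<lambda>s. ennreal Ch * rearr01 ?u s) t" by (rule T_mono)
      also have "\<dots> = ennreal Ch * T k (rearr01 ?u) t" by (rule T_cmult) simp
      also have "\<dots> \<le> ennreal Ch * (ennreal Ck * (R ^^ k) (rearr01 ?u) t)"
        unfolding Ck_def by (intro mult_left_mono T_le_R_pow k t) auto
      finally show ?thesis using C0 by (simp add: ennreal_mult mult.assoc)
    qed
    then have "associate_norm X (T k (rearr01 (T h (rearr01 f)))) \<le> associate_norm X (\<lambda>t. ennreal (Ch * Ck) * (R ^^ k) (rearr01 ?u) t)"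
      by (rule associate_norm_mono)
    also have "\<dots> = ennreal (Ch * Ck) * associate_norm X ((R ^^ k) (rearr01 ?u))"
      by (rule associate_norm_cmult) simp
    also have "associate_norm X ((R ^^ k) (rearr01 ?u)) \<le> ennreal K * associate_norm X ((R ^^ (k + h)) (rearr01 f))"
      by (rule K(2)[OF X antimono_on_rearr, where B=B]) (use B in \<open>auto intro!: rearr01_upper_bound[OF f]\<close>)
    also have "associate_norm X ((R ^^ (k + h)) (rearr01 f)) \<le> associate_norm X (T (k + h) (rearr01 f))"
      by (rule associate_norm_mono, rule R_pow_T(1)) (use k in auto)
    also have "\<dots> = associate_norm ?W f" using XmI_spec(2)[OF X _ f, of "k + h"] k by simp
    finally show ?thesis
      using C0 K(1) by (simp add: associate_norm_XmI_XmI[OF X k h f] ennreal_mult mult_left_mono mult.assoc)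
  qed
  show ?thesis
  proof (intro exI[of _ "Ch * Ck * K"] conjI ballI)
    show "0 \<le> Ch * Ck * K" using C0 K by simp
    fix f assume f: "f \<in> Mplus"
    define p where "p n x = min (f x) (of_nat n)" for n x
    have pM: "p n \<in> Mplus" for n unfolding p_def[abs_def] by (rule Mplus_min) (use f in auto)
    have "(SUP n. associate_norm ?Z (p n)) = associate_norm ?Z f"
    proof (rule associate_norm_SUP(2)[OF pM f], rule AE_I2, rule conjI)
      fix x
      show "incseq (\<lambda>n. p n x)" unfolding incseq_def p_def by (intro allI impI min.mono order_refl) simp
      show "(SUP n. p n x) = f x" unfolding p_def
        by (simp add: inf_min[symmetric] inf_SUP[symmetric] ennreal_SUP_of_nat_eq_top)
    qed
    moreover have "associate_norm ?Z (p n) \<le> ennreal (Ch * Ck * K) * associate_norm ?W f" for n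
    proof -
      have "associate_norm ?Z (p n) \<le> ennreal (Ch * Ck * K) * associate_norm ?W (p n)"
        by (rule bounded[OF pM, of _ "real n"]) (simp add: p_def ennreal_of_nat_eq_real_of_nat)
      also have "\<dots> \<le> ennreal (Ch * Ck * K) * associate_norm ?W f"
        by (intro mult_left_mono associate_norm_mono) (auto simp: p_def)
      finally show ?thesis .
    qed
    ultimately show "associate_norm ?Z f \<le> ennreal (Ch * Ck * K) * associate_norm ?W f"
      by (metis SUP_least)
  qed
qed

end

text \<open>Duality reverses the inequality: a larger associate norm has a smaller unit ball of test
  functions. Lorentz--Luxemburg identifies the second associates with the norms themselves.\<close>

lemma ri_norm_le_of_associate_norm_le:
  assumes Y: "ri_norm Y" and Z: "ri_norm Z" and K: "0 < K"
    and le: "\<And>g. g \<in> Mplus \<Longrightarrow> associate_norm Z g \<le> ennreal K * associate_norm Y g" and f: "f \<in> Mplus"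
  shows "Y f \<le> ennreal K * Z f"
proof -
  have "associate_norm (associate_norm Y) f \<le> ennreal K * associate_norm (associate_norm Z) f"
  proof (rule associate_norm_least)
    fix g assume g: "g \<in> Mplus" "associate_norm Y g \<le> 1"
    have "(\<integral>\<^sup>+s. g s * f s \<partial>unit_leb) = (\<integral>\<^sup>+s. f s * g s \<partial>unit_leb)" by (simp add: mult.commute)
    also have "\<dots> \<le> Z f * associate_norm Z g" by (rule hoelder_associate[OF Z f g(1)])
    also have "\<dots> \<le> Z f * (ennreal K * associate_norm Y g)" by (intro mult_left_mono le g) auto
    also have "\<dots> \<le> Z f * (ennreal K * 1)" by (intro mult_left_mono g) auto
    finally show "(\<integral>\<^sup>+s. g s * f s \<partial>unit_leb) \<le> ennreal K * associate_norm (associate_norm Z) f"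
      by (simp add: lorentz_luxemburg[OF Z f] mult.commute)
  qed
  then show ?thesis by (simp add: lorentz_luxemburg Y Z f)
qed

text \<open>Comparison on \<open>Mplus\<close> suffices for any measure \<open>M\<close>, because
  every rearrangement is decreasing and hence lies in \<open>Mplus\<close>.\<close>

lemma equal_up_to_equivalent_normsI:
  assumes A: "0 < A" "\<And>f. f \<in> Mplus \<Longrightarrow> Y f \<le> ennreal A * Z f"
    and B: "0 < B" "\<And>f. f \<in> Mplus \<Longrightarrow> Z f \<le> ennreal B * Y f"
  shows "equal_up_to_equivalent_norms M Y Z"
  unfolding equal_up_to_equivalent_norms_def
proof (rule conjI)
  have YZ: "ri_space_norm M Y u \<le> ennreal A * ri_space_norm M Z u"
    and ZY: "ri_space_norm M Z u \<le> ennreal B * ri_space_norm M Y u" for u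
    unfolding ri_space_norm_def by (auto intro: A(2) B(2))
  have "ri_space_norm M Y u < \<infinity> \<longleftrightarrow> ri_space_norm M Z u < \<infinity>" for u
    using YZ[of u] ZY[of u] by (auto simp: ennreal_mult_less_top intro: le_less_trans)
  then show "ri_space M Y = ri_space M Z" by (simp add: ri_space_def)
  have "ennreal (1 / B) * ri_space_norm M Z u \<le> ri_space_norm M Y u" for u
  proof -
    have "ennreal (1 / B) * ri_space_norm M Z u \<le> ennreal (1 / B) * (ennreal B * ri_space_norm M Y u)"
      by (rule mult_left_mono[OF ZY]) simp
    then show ?thesis
      using B(1) by (simp add: mult.assoc[symmetric] ennreal_mult[symmetric])
  qed
  then show "\<exists>C1>0. \<exists>C2>0. \<forall>u\<in>ri_space M Y. ennreal C1 * ri_space_norm M Z u \<le> ri_space_norm M Y u \<and>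
      ri_space_norm M Y u \<le> ennreal C2 * ri_space_norm M Z u"
    using A(1) B(1) YZ by (meson zero_less_divide_1_iff)
qed

theorem theorem5p7:
  fixes \<Omega> :: "(real ^ 'n) set"
    and \<omega> :: "real ^ 'n \<Rightarrow> real"
    and I :: "real \<Rightarrow> real"
    and X :: "(real \<Rightarrow> ennreal) \<Rightarrow> ennreal"
    and k h :: nat
    and c :: real
  assumes "open \<Omega>" and "connected \<Omega>"
    and "\<omega> \<in> borel_measurable (restrict_space borel \<Omega>)"
    and "AE x in lebesgue_on \<Omega>. \<omega> x > 0"
    and "emeasure (weighted_measure \<Omega> \<omega>) \<Omega> = 1"
    and "\<And>t. t \<in> {0..1} \<Longrightarrow> I t \<ge> 0"
    and "mono_on {0..1} I"
    and "(INF t\<in>{0<..<1}. I t / t) > 0"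
    and "c > 0"
    and "\<And>s. s \<in> {0..1/2} \<Longrightarrow> c * s \<le> 1 \<Longrightarrow>
           isoperimetric \<Omega> \<omega> s \<ge> ennreal (c * I (c * s))"
    and "ri_norm X"
    and "k \<ge> 1" and "h \<ge> 1"
  shows "equal_up_to_equivalent_norms (weighted_measure \<Omega> \<omega>)
           (XmI (XmI X k I) h I) (XmI X (k + h) I)"
proof -
  interpret hardy_weight I "INF t\<in>{0<..<1}. I t / t"
  proof
    show "I s \<le> I t" if "0 \<le> s" "s \<le> t" "t \<le> 1" for s t
      using \<open>mono_on {0..1} I\<close> that by (auto simp: monotone_on_def)
    show "0 < (INF t\<in>{0<..<1}. I t / t)" by fact
    show "(INF t\<in>{0<..<1}. I t / t) * t \<le> I t" if t: "0 < t" "t < 1" for t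
    proof -
      have "(INF t\<in>{0<..<1}. I t / t) \<le> I t / t"
        by (rule cINF_lower) (use t assms(6) in \<open>auto intro!: bdd_belowI[of _ 0]\<close>)
      then show ?thesis using t by (simp add: field_simps)
    qed
  qed
  note X = \<open>ri_norm X\<close> and k = \<open>k \<ge> 1\<close> and h = \<open>h \<ge> 1\<close>
  let ?Z = "XmI (XmI X k I) h I" and ?W = "XmI X (k + h) I"
  have Z: "ri_norm ?Z" and W: "ri_norm ?W" using XmI_spec(1) X k h by auto
  obtain K where K: "0 \<le> K" "\<And>f. f \<in> Mplus \<Longrightarrow> associate_norm ?Z f \<le> ennreal K * associate_norm ?W f"
    using associate_norm_reiteration_le[OF X k h] by blast
  show ?thesis
  proof (rule equal_up_to_equivalent_normsI)
    show "(0::real) < 2 ^ ((k + h) * (k + h))" by simp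
    show "?Z f \<le> ennreal (2 ^ ((k + h) * (k + h))) * ?W f" if "f \<in> Mplus" for f
      by (rule ri_norm_le_of_associate_norm_le[OF Z W _ associate_norm_reiteration_ge[OF X k h] that]) auto
    \<comment> \<open>\<open>K\<close> may be 0, whereas equivalence of norms asks for positive
      constants.\<close>
    show "0 < K + 1" using K by simp
    show "?W f \<le> ennreal (K + 1) * ?Z f" if "f \<in> Mplus" for f
    proof (rule ri_norm_le_of_associate_norm_le[OF W Z _ _ that])
      show "associate_norm ?Z g \<le> ennreal (K + 1) * associate_norm ?W g" if "g \<in> Mplus" for g
        using K(2)[OF that] by (rule order_trans) (intro mult_right_mono ennreal_leI, auto)
    qed (use K in simp)
  qed
qed

end
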